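(* Let $(\Omega,\mathcal F,P)$ be a probability space carrying a uniformly distributed $[0,1]$-valued random variable, let $X$ be a Banach space over $\mathbb K\in\{\mathbb R,\mathbb C\}$, $\sigma$ a distortion function, and $p\in[1,\infty)$ with conjugate exponent $q\in(1,\infty]$. Then the isometry $$\iota:(L_\sigma^{q\,*}(P,X^* ),|\cdot|_\sigma^{q,*})\to L_\sigma^p(P,X)^*,\qquad Z\mapsto\big(Y\mapsto\mathbb E(\langle Z,Y\rangle)\big)$$ is an isomorphism if and only if $X^*$ has the Radon–Nikodým property with respect to $(\Omega,\mathcal F,P)$.
   Context: $\mathscr U(0,1)$ denotes the set of all $[0,1]$-valued random variables $U$ on $(\Omega,\mathcal F,P)$ with $P(U\le u)=u$ for all $u\in[0,1]$. A distortion function is a nondecreasing, left-continuous function $\sigma:[0,1)\to[0,\infty)$ with $\int_0^1\sigma(u)\,du=1$. For $r\in[1,\infty)$, $L_\sigma^r(P,X)$ is the Banach space of (a.e.-classes of) strongly measurable $Y:\Omega\to X$ with $\|Y\|_{\sigma,r}:=\big(\sup_{U\in\mathscr U(0,1)}\mathbb E(\sigma(U)\|Y\|^r)\big)^{1/r}<\infty$; its continuous dual carries the dual norm. $\langle x^*,x\rangle=x^*(x)$. Scalar spaces: for a real random variable $W$, $F_W(t)=P(W\le t)$, $F_W^{-1}(\alpha)=\inf\{t:F_W(t)\ge\alpha\}$; for nonnegative $W$ and $\alpha\in[0,1)$, $\mathrm{AV@R}_\alpha(W)=\frac1{1-\alpha}\int_\alpha^1F_W^{-1}(u)\,du$. $L^0(P)$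 is the set of (a.e.-classes of) $\mathbb K$-valued random variables. For $Z\in L^0(P)$, $|Z|_{\sigma,\infty}^*:=\sup_{\alpha\in[0,1)}\int_\alpha^1F_{|Z|}^{-1}(u)\,du\big/\int_\alpha^1\sigma(u)\,du$. For $q\in(1,\infty)$, $|Z|_{\sigma,q}^*:=\inf\|Z'\|_{\sigma,q}$, the infimum over all $Z'\in L^0(P)$ for which there is $U\in\mathscr U(0,1)$ with $\mathrm{AV@R}_\alpha(\sigma(U)|Z'|)\ge\mathrm{AV@R}_\alpha(|Z|)$ for all $\alpha\in[0,1)$ ($\inf\emptyset=\infty$). For $q\in(1,\infty]$, $L_{\sigma,q}^*(P):=\{Z\in L^0(P):|Z|_{\sigma,q}^*<\infty\}$. $L_\sigma^{q\,*}(P,X^* )$ is the space of (a.e.-classes of) strongly measurable $Z:\Omega\to X^*$ with $\|Z\|\in L_{\sigma,q}^*(P)$, normed by $|Z|_\sigma^{q,*}:=\big|\,\|Z\|\,\big|_{\sigma,q}^*$. The map $\iota$ is well defined and isometric. $X^*$ has the Radon–Nikodým property with respect to $(\Omega,\mathcal F,P)$ if for every $P$-continuous $\sigma$-additive vector measure $\mu:\mathcal F\to X^*$ of bounded variation there is a Bochner integrable $Z\in L^1(P,X^* )$ with $\mu(E)=\int_EZ\,dP$ for all $E\in\mathcal F$. *)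

theory Defs
  imports "HOL-Probability.Probability"
begin

(* Up to isometric isomorphism of fields, the sort {real_normed_field, euclidean_space} has exactly
   two models, real and complex (finite-dimensional commutative normed field extensions of the
   reals). It plays the role of the scalar field K throughout. *)

section \<open>Banach spaces over K and their duals\<close>

text \<open>The type class \<open>banach\<close> provides a real Banach space; \<open>sc\<close> is a K-scalar multiplication
  that is compatible with the real structure and with the norm.\<close>

locale banach_over = vector_space sc
  for sc :: "'k::{real_normed_field, euclidean_space} \<Rightarrow> 'x::banach \<Rightarrow> 'x" +
  assumes scale_of_real: "sc (of_real r) x = r *\<^sub>R x"
    and norm_scale: "norm (sc c x) = norm c * norm x"

text \<open>The dual space of X consists of the K-linear elements of the Banach space of bounded
  real-linear maps from X to K. The norm of that type is the operator norm.\<close>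

definition dual_space ::
  "('k::{real_normed_field, euclidean_space} \<Rightarrow> 'x::banach \<Rightarrow> 'x) \<Rightarrow> ('x \<Rightarrow>\<^sub>L 'k) set" where
  "dual_space sc = {f. \<forall>c x. blinfun_apply f (sc c x) = c * blinfun_apply f x}"

definition dual_scale ::
  "'k::{real_normed_field, euclidean_space} \<Rightarrow> ('x::banach \<Rightarrow>\<^sub>L 'k) \<Rightarrow> ('x \<Rightarrow>\<^sub>L 'k)" where
  "dual_scale c f = Blinfun (\<lambda>x. c * blinfun_apply f x)"


section \<open>Normed spaces with explicit carrier\<close>

record ('k, 'v) normed_sp =
  vcarrier :: "'v set"
  vadd :: "'v \<Rightarrow> 'v \<Rightarrow> 'v"
  vscale :: "'k \<Rightarrow> 'v \<Rightarrow> 'v"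
  vnorm :: "'v \<Rightarrow> real"

text \<open>Functionals are extensional, so that equality of functions is equality of functionals.\<close>

definition continuous_dual ::
  "('k::real_normed_field, 'v) normed_sp \<Rightarrow> ('k, 'v \<Rightarrow> 'k) normed_sp" where
  "continuous_dual N = \<lparr>
     vcarrier = {\<phi> \<in> extensional (vcarrier N).
        (\<forall>v\<in>vcarrier N. \<forall>w\<in>vcarrier N. \<phi> (vadd N v w) = \<phi> v + \<phi> w) \<and>
        (\<forall>c. \<forall>v\<in>vcarrier N. \<phi> (vscale N c v) = c * \<phi> v) \<and>
        (\<exists>C. \<forall>v\<in>vcarrier N. norm (\<phi> v) \<le> C * vnorm N v)},
     vadd = (\<lambda>\<phi> \<psi>. \<lambda>v\<in>vcarrier N. \<phi> v + \<psi> v),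
     vscale = (\<lambda>c \<phi>. \<lambda>v\<in>vcarrier N. c * \<phi> v),
     vnorm = (\<lambda>\<phi>. SUP v\<in>{v \<in> vcarrier N. vnorm N v \<le> 1}. norm (\<phi> v)) \<rparr>"

definition linear_map ::
  "('k, 'v) normed_sp \<Rightarrow> ('k, 'w) normed_sp \<Rightarrow> ('v \<Rightarrow> 'w) \<Rightarrow> bool" where
  "linear_map N N' T \<longleftrightarrow>
     T \<in> vcarrier N \<rightarrow> vcarrier N' \<and>
     (\<forall>v\<in>vcarrier N. \<forall>w\<in>vcarrier N. T (vadd N v w) = vadd N' (T v) (T w)) \<and>
     (\<forall>c. \<forall>v\<in>vcarrier N. T (vscale N c v) = vscale N' c (T v))"

definition linear_isometry ::
  "('k, 'v) normed_sp \<Rightarrow> ('k, 'w) normed_sp \<Rightarrow> ('v \<Rightarrow> 'w) \<Rightarrow> bool" where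
  "linear_isometry N N' T \<longleftrightarrow>
     linear_map N N' T \<and> (\<forall>v\<in>vcarrier N. vnorm N' (T v) = vnorm N v)"

text \<open>A linear bijection that is bounded in both directions.\<close>

definition normed_isomorphism ::
  "('k, 'v) normed_sp \<Rightarrow> ('k, 'w) normed_sp \<Rightarrow> ('v \<Rightarrow> 'w) \<Rightarrow> bool" where
  "normed_isomorphism N N' T \<longleftrightarrow>
     linear_map N N' T \<and> bij_betw T (vcarrier N) (vcarrier N') \<and>
     (\<exists>C. \<forall>v\<in>vcarrier N. vnorm N' (T v) \<le> C * vnorm N v) \<and>
     (\<exists>C. \<forall>v\<in>vcarrier N. vnorm N v \<le> C * vnorm N' (T v))"


section \<open>Spaces of almost-everywhere classes\<close>

definition ae_class :: "'w measure \<Rightarrow> ('w \<Rightarrow> 'b) set \<Rightarrow> ('w \<Rightarrow> 'b) \<Rightarrow> ('w \<Rightarrow> 'b) set" where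
  "ae_class M V f = {g \<in> V. AE \<omega> in M. g \<omega> = f \<omega>}"

definition ae_rep :: "('w \<Rightarrow> 'b) set \<Rightarrow> ('w \<Rightarrow> 'b)" where
  "ae_rep A = (SOME f. f \<in> A)"

text \<open>The space of classes of the functions in \<open>V\<close> (with pointwise operations), normed by \<open>n\<close>.\<close>

definition ae_space ::
  "'w measure \<Rightarrow> ('k \<Rightarrow> 'b::plus \<Rightarrow> 'b) \<Rightarrow> ('w \<Rightarrow> 'b) set \<Rightarrow> (('w \<Rightarrow> 'b) \<Rightarrow> real)
    \<Rightarrow> ('k, ('w \<Rightarrow> 'b) set) normed_sp" where
  "ae_space M sc V n = \<lparr>
     vcarrier = ae_class M V ` V,
     vadd = (\<lambda>A B. ae_class M V (\<lambda>\<omega>. ae_rep A \<omega> + ae_rep B \<omega>)),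
     vscale = (\<lambda>c A. ae_class M V (\<lambda>\<omega>. sc c (ae_rep A \<omega>))),
     vnorm = (\<lambda>A. n (ae_rep A)) \<rparr>"


section \<open>Strong measurability, Bochner integral, Radon-Nikodym property\<close>

text \<open>The Bochner integral of HOL-Analysis requires a second countable range, which is not
  assumed here; only its part about simple functions is available in general. Functions take
  their values in a given set \<open>S\<close>. The limit is required at every point of the space, so that
  representatives are genuinely measurable; every class of almost everywhere limits contains such
  a representative.\<close>

definition simple_into :: "'w measure \<Rightarrow> 'b set \<Rightarrow> ('w \<Rightarrow> 'b) \<Rightarrow> bool" where
  "simple_into M S s \<longleftrightarrow> simple_function M s \<and> s \<in> space M \<rightarrow> S"

definition strongly_measurable ::
  "'w measure \<Rightarrow> 'b::real_normed_vector set \<Rightarrow> ('w \<Rightarrow> 'b) \<Rightarrow> bool" where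
  "strongly_measurable M S f \<longleftrightarrow>
     f \<in> space M \<rightarrow> S \<and>
     (\<exists>s. (\<forall>i::nat. simple_into M S (s i)) \<and> (\<forall>\<omega>\<in>space M. (\<lambda>i. s i \<omega>) \<longlonglongrightarrow> f \<omega>))"

definition has_bochner_integral_into ::
  "'w measure \<Rightarrow> 'b::real_normed_vector set \<Rightarrow> ('w \<Rightarrow> 'b) \<Rightarrow> 'b \<Rightarrow> bool" where
  "has_bochner_integral_into M S f x \<longleftrightarrow>
     strongly_measurable M S f \<and>
     (\<exists>s. (\<forall>i::nat. simple_into M S (s i) \<and> Bochner_Integration.simple_bochner_integrable M (s i)) \<and>
          (\<lambda>i. \<integral>\<^sup>+\<omega>. ennreal (norm (f \<omega> - s i \<omega>)) \<partial>M) \<longlonglongrightarrow> 0 \<and>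
          (\<lambda>i. Bochner_Integration.simple_bochner_integral M (s i)) \<longlonglongrightarrow> x)"

definition bochner_integrable_into ::
  "'w measure \<Rightarrow> 'b::real_normed_vector set \<Rightarrow> ('w \<Rightarrow> 'b) \<Rightarrow> bool" where
  "bochner_integrable_into M S f \<longleftrightarrow> (\<exists>x. has_bochner_integral_into M S f x)"

definition vector_measure ::
  "'w measure \<Rightarrow> 'b::real_normed_vector set \<Rightarrow> ('w set \<Rightarrow> 'b) \<Rightarrow> bool" where
  "vector_measure M S \<mu> \<longleftrightarrow>
     \<mu> \<in> sets M \<rightarrow> S \<and>
     (\<forall>A::nat \<Rightarrow> 'w set. range A \<subseteq> sets M \<longrightarrow> disjoint_family A \<longrightarrow>
        (\<lambda>i. \<mu> (A i)) sums \<mu> (\<Union>i. A i))"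

definition continuous_wrt ::
  "'w measure \<Rightarrow> ('w set \<Rightarrow> 'b::real_normed_vector) \<Rightarrow> bool" where
  "continuous_wrt M \<mu> \<longleftrightarrow>
     (\<forall>\<epsilon>>0. \<exists>\<delta>>0. \<forall>E\<in>sets M. measure M E < \<delta> \<longrightarrow> norm (\<mu> E) < \<epsilon>)"

definition finite_variation ::
  "'w measure \<Rightarrow> ('w set \<Rightarrow> 'b::real_normed_vector) \<Rightarrow> bool" where
  "finite_variation M \<mu> \<longleftrightarrow>
     (\<exists>C. \<forall>\<pi>. finite \<pi> \<longrightarrow> \<pi> \<subseteq> sets M \<longrightarrow> partition_on (space M) \<pi> \<longrightarrow>
        (\<Sum>E\<in>\<pi>. norm (\<mu> E)) \<le> C)"

text \<open>The Radon-Nikodym property of the closed subspace \<open>S\<close> of a Banach space with respect to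
  \<open>M\<close>.\<close>

definition radon_nikodym_property ::
  "'w measure \<Rightarrow> 'b::banach set \<Rightarrow> bool" where
  "radon_nikodym_property M S \<longleftrightarrow>
     (\<forall>\<mu>. vector_measure M S \<mu> \<longrightarrow> continuous_wrt M \<mu> \<longrightarrow> finite_variation M \<mu> \<longrightarrow>
        (\<exists>Z. bochner_integrable_into M S Z \<and>
             (\<forall>E\<in>sets M. has_bochner_integral_into M S (\<lambda>\<omega>. indicator E \<omega> *\<^sub>R Z \<omega>) (\<mu> E))))"


section \<open>Distortion functions and the associated norms\<close>

definition uniform_rvs :: "'w measure \<Rightarrow> ('w \<Rightarrow> real) set" where
  "uniform_rvs M = {U \<in> borel_measurable M.
     (\<forall>\<omega>\<in>space M. U \<omega> \<in> {0..1}) \<and>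
     (\<forall>u\<in>{0..1}. measure M {\<omega> \<in> space M. U \<omega> \<le> u} = u)}"

text \<open>Only the values on \<open>{0..<1}\<close> matter; a uniform variable equals 1 with probability 0.\<close>

definition distortion :: "(real \<Rightarrow> real) \<Rightarrow> bool" where
  "distortion \<sigma> \<longleftrightarrow>
     mono_on {0..<1} \<sigma> \<and>
     (\<forall>u\<in>{0..<1}. 0 \<le> \<sigma> u) \<and>
     (\<forall>u\<in>{0<..<1}. continuous (at_left u) \<sigma>) \<and>
     (\<integral>\<^sup>+u\<in>{0..<1}. ennreal (\<sigma> u) \<partial>lborel) = 1"

definition ennroot :: "real \<Rightarrow> ennreal \<Rightarrow> ennreal" where
  "ennroot r x = (if x = \<infinity> then \<infinity> else ennreal (enn2real x powr (1 / r)))"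

definition sigma_norm ::
  "'w measure \<Rightarrow> (real \<Rightarrow> real) \<Rightarrow> real \<Rightarrow> ('w \<Rightarrow> 'b::real_normed_vector) \<Rightarrow> ennreal" where
  "sigma_norm M \<sigma> r Y =
     ennroot r (SUP U\<in>uniform_rvs M. \<integral>\<^sup>+\<omega>. ennreal (\<sigma> (U \<omega>) * norm (Y \<omega>) powr r) \<partial>M)"

text \<open>The generalised inverse is only meaningful on the open unit interval, which is all that
  enters below.\<close>

definition quantile :: "'w measure \<Rightarrow> ('w \<Rightarrow> real) \<Rightarrow> real \<Rightarrow> real" where
  "quantile M W \<alpha> = Inf {t. \<alpha> \<le> measure M {\<omega> \<in> space M. W \<omega> \<le> t}}"

definition tail_integral :: "(real \<Rightarrow> real) \<Rightarrow> real \<Rightarrow> ennreal" where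
  "tail_integral f \<alpha> = (\<integral>\<^sup>+u\<in>{\<alpha><..<1}. ennreal (f u) \<partial>lborel)"

definition AVaR :: "'w measure \<Rightarrow> real \<Rightarrow> ('w \<Rightarrow> real) \<Rightarrow> ennreal" where
  "AVaR M \<alpha> W = tail_integral (quantile M W) \<alpha> / ennreal (1 - \<alpha>)"

definition sigma_star_norm ::
  "'w measure \<Rightarrow> (real \<Rightarrow> real) \<Rightarrow> ennreal
    \<Rightarrow> ('w \<Rightarrow> 'k::{real_normed_field, euclidean_space}) \<Rightarrow> ennreal" where
  "sigma_star_norm M \<sigma> q Z =
     (if q = \<infinity> then
        (SUP \<alpha>\<in>{0..<1}. tail_integral (quantile M (\<lambda>\<omega>. norm (Z \<omega>))) \<alpha> / tail_integral \<sigma> \<alpha>)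
      else
        (INF Z'\<in>{Z' :: 'w \<Rightarrow> 'k. Z' \<in> borel_measurable M \<and>
            (\<exists>U\<in>uniform_rvs M. \<forall>\<alpha>\<in>{0..<1}.
               AVaR M \<alpha> (\<lambda>\<omega>. \<sigma> (U \<omega>) * norm (Z' \<omega>)) \<ge> AVaR M \<alpha> (\<lambda>\<omega>. norm (Z \<omega>)))}.
          sigma_norm M \<sigma> (enn2real q) Z'))"


section \<open>The spaces of vector-valued functions and the canonical map\<close>

definition L_sigma_fun ::
  "'w measure \<Rightarrow> (real \<Rightarrow> real) \<Rightarrow> real \<Rightarrow> ('w \<Rightarrow> 'x::banach) set" where
  "L_sigma_fun M \<sigma> p = {Y. strongly_measurable M UNIV Y \<and> sigma_norm M \<sigma> p Y < \<infinity>}"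

definition L_sigma ::
  "'w measure \<Rightarrow> (real \<Rightarrow> real) \<Rightarrow> real
    \<Rightarrow> ('k::{real_normed_field, euclidean_space} \<Rightarrow> 'x::banach \<Rightarrow> 'x)
    \<Rightarrow> ('k, ('w \<Rightarrow> 'x) set) normed_sp" where
  "L_sigma M \<sigma> p sc =
     ae_space M sc (L_sigma_fun M \<sigma> p) (\<lambda>Y. enn2real (sigma_norm M \<sigma> p Y))"

definition L_star_norm ::
  "'w measure \<Rightarrow> (real \<Rightarrow> real) \<Rightarrow> ennreal
    \<Rightarrow> ('w \<Rightarrow> ('x::banach \<Rightarrow>\<^sub>L 'k::{real_normed_field, euclidean_space})) \<Rightarrow> ennreal" where
  "L_star_norm M \<sigma> q Z = sigma_star_norm M \<sigma> q (\<lambda>\<omega>. of_real (norm (Z \<omega>)) :: 'k)"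

definition L_star_fun ::
  "'w measure \<Rightarrow> (real \<Rightarrow> real) \<Rightarrow> ennreal
    \<Rightarrow> ('k::{real_normed_field, euclidean_space} \<Rightarrow> 'x::banach \<Rightarrow> 'x)
    \<Rightarrow> ('w \<Rightarrow> ('x \<Rightarrow>\<^sub>L 'k)) set" where
  "L_star_fun M \<sigma> q sc =
     {Z. strongly_measurable M (dual_space sc) Z \<and> L_star_norm M \<sigma> q Z < \<infinity>}"

definition L_star ::
  "'w measure \<Rightarrow> (real \<Rightarrow> real) \<Rightarrow> ennreal
    \<Rightarrow> ('k::{real_normed_field, euclidean_space} \<Rightarrow> 'x::banach \<Rightarrow> 'x)
    \<Rightarrow> ('k, ('w \<Rightarrow> ('x \<Rightarrow>\<^sub>L 'k)) set) normed_sp" where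
  "L_star M \<sigma> q sc =
     ae_space M dual_scale (L_star_fun M \<sigma> q sc) (\<lambda>Z. enn2real (L_star_norm M \<sigma> q Z))"

definition iota ::
  "'w measure \<Rightarrow> (real \<Rightarrow> real) \<Rightarrow> real
    \<Rightarrow> ('k::{real_normed_field, euclidean_space} \<Rightarrow> 'x::banach \<Rightarrow> 'x)
    \<Rightarrow> ('w \<Rightarrow> ('x \<Rightarrow>\<^sub>L 'k)) set \<Rightarrow> ('w \<Rightarrow> 'x) set \<Rightarrow> 'k" where
  "iota M \<sigma> p sc A =
     (\<lambda>B\<in>vcarrier (L_sigma M \<sigma> p sc).
        integral\<^sup>L M (\<lambda>\<omega>. blinfun_apply (ae_rep A \<omega>) (ae_rep B \<omega>)))"

end

(*
  The norm of L_sigma^p is a rearrangement norm: every nonnegative W is a.e. its quantile function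
  evaluated at some uniform variable U (the lexicographic rank of W and an arbitrary uniform
  variable), and E(g(U) h(V)) is maximal for U = V when g and h are nondecreasing. Hence the p-th
  power of the norm of f is the integral of sigma * (quantile of f)^p, and |Z|* is to be compared
  with the supremum of the integrals of w * g, where w is the quantile function of |Z| and g runs
  over the nondecreasing functions with integral of sigma * g^p at most 1. For p > 1 the infimum in
  |Z|* is almost attained by a step function v: for levels l_i = e (1 + e)^i, the point t_i maximises
  the tail integral of w - l_i sigma, and v jumps to l_(i+1) at t_i. Maximality on the left of t_i
  gives the tail dominance of sigma * v over w, maximality on the right of t_i gives the norm bound.

  Vector-valued Z are reduced to the scalar norm by near-norming simple functions, which gives the
  isometry. With the Radon-Nikodym property, a functional phi is represented by the density of
  E |-> phi(1_E x). Conversely, if all functionals are represented and mu is a measure of bounded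
  variation, a maximal disjoint family of sets B with |mu B| > n P(B) has total probability at most
  Var(mu) / n; off its union |mu E| <= n P(E), so mu defines a functional there, and the densities
  representing these functionals are glued.
*)

theory Submission
  imports Defs
begin

section \<open>Rearrangement on a probability space with a uniform variable\<close>

text \<open>The step function \<open>v\<close> of the scalar part approximates the level function of
  \<open>w\<close>: the slope of the least concave majorant of the tail integral of
  \<open>w\<close>, seen as a function of the tail integral of \<open>s\<close>. Maximising tail
  integral of \<open>w\<close> minus \<open>l\<close> times that of \<open>s\<close> finds the
  points where a line of slope \<open>l\<close> touches this majorant, without constructing it; the
  factor \<open>1 + e\<close> between levels is the price of using countably many slopes only. The
  norm is a supremum over uniform variables and not an integral with one fixed weight, so dominated
  convergence does not apply to it directly. Splitting the distortion at a high level restores it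
  uniformly in the variable, and with it the density of simple functions and the smallness of
  indicators of small sets. Neither \<open>X\<close> nor its dual is assumed separable.
  Vector-valued functions are therefore handled through simple approximations, and equalities
  between elements of the dual are tested on single vectors.\<close>

lemma layer_cake:
  assumes "sigma_finite_measure N" and [measurable]: "f \<in> borel_measurable N" "g \<in> borel_measurable N"
  shows "(\<integral>\<^sup>+x. f x * ennreal (g x) \<partial>N) =
    (\<integral>\<^sup>+t. (\<integral>\<^sup>+x. f x * indicator {x. 0 \<le> t \<and> t < g x} x \<partial>N) \<partial>lborel)"
proof -
  interpret N: sigma_finite_measure N by fact
  interpret pair_sigma_finite N lborel ..
  \<comment> \<open>\<open>g x\<close> is the length of the set of levels \<open>t\<close> with
    \<open>0 \<le> t < g x\<close>; for negative \<open>g x\<close> both sides vanish, because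
    \<open>ennreal\<close> cuts off at 0.\<close>
  have *: "ennreal (g x) = (\<integral>\<^sup>+t. indicator {x. 0 \<le> t \<and> t < g x} x \<partial>lborel)" for x
  proof -
    have "(\<integral>\<^sup>+t. indicator {x. 0 \<le> t \<and> t < g x} x \<partial>lborel) = (\<integral>\<^sup>+t. indicator {0..<g x} t \<partial>lborel)"
      by (intro nn_integral_cong) (auto simp: indicator_def)
    also have "\<dots> = ennreal (g x)"
      by (cases "0 \<le> g x") (auto simp: ennreal_neg)
    finally show ?thesis by simp
  qed
  have "(\<integral>\<^sup>+x. f x * ennreal (g x) \<partial>N) = (\<integral>\<^sup>+x. (\<integral>\<^sup>+t. f x * indicator {x. 0 \<le> t \<and> t < g x} x \<partial>lborel) \<partial>N)"
    by (intro nn_integral_cong) (subst *, subst nn_integral_cmult[symmetric], auto)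
  also have "\<dots> = (\<integral>\<^sup>+t. (\<integral>\<^sup>+x. f x * indicator {x. 0 \<le> t \<and> t < g x} x \<partial>N) \<partial>lborel)"
    by (rule Fubini'[symmetric]) measurable
  finally show ?thesis .
qed

section \<open>Profiles and their tail integrals\<close>

text \<open>Normal form of the nondecreasing weights on the open unit interval. The value 0 outside
  makes a profile Borel on the whole line and keeps the endpoints, where \<open>quantile\<close> has
  no meaning, out of the arguments.\<close>

definition profile :: "(real \<Rightarrow> real) \<Rightarrow> bool" where
  "profile g \<longleftrightarrow> mono_on {0<..<1} g \<and> (\<forall>u\<in>{0<..<1}. 0 \<le> g u) \<and> (\<forall>u. u \<notin> {0<..<1} \<longrightarrow> g u = 0)"

definition clip :: "(real \<Rightarrow> real) \<Rightarrow> real \<Rightarrow> real" where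
  "clip g u = (if u \<in> {0<..<1} then g u else 0)"

lemma profile_clip: "mono_on {0<..<1} g \<Longrightarrow> (\<And>u. u \<in> {0<..<1} \<Longrightarrow> 0 \<le> g u) \<Longrightarrow> profile (clip g)"
  unfolding profile_def clip_def monotone_on_def by auto

lemma profile_nonneg: "profile g \<Longrightarrow> 0 \<le> g u"
  unfolding profile_def by (cases "u \<in> {0<..<1}") auto

lemma profile_mono: "profile g \<Longrightarrow> 0 < u \<Longrightarrow> u \<le> v \<Longrightarrow> v < 1 \<Longrightarrow> g u \<le> g v"
  unfolding profile_def monotone_on_def by auto

lemma profileI:
  assumes "\<And>u v. 0 < u \<Longrightarrow> u \<le> v \<Longrightarrow> v < 1 \<Longrightarrow> g u \<le> g v" "\<And>u. 0 < u \<Longrightarrow> u < 1 \<Longrightarrow> 0 \<le> g u"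
    "\<And>u. u \<le> 0 \<or> 1 \<le> u \<Longrightarrow> g u = 0"
  shows "profile g"
  using assms unfolding profile_def monotone_on_def by (auto simp: not_less)

lemma profile_measurable [measurable_dest]:
  assumes "profile g" shows "g \<in> borel_measurable borel"
proof -
  have "g \<in> borel_measurable (restrict_space borel {0<..<1})"
    using assms unfolding profile_def by (intro borel_measurable_mono_on_fnc) auto
  then have "(\<lambda>x. indicat_real {0<..<1} x * g x) \<in> borel_measurable borel"
    by (subst (asm) borel_measurable_restrict_space_iff) auto
  also have "(\<lambda>x. indicat_real {0<..<1} x * g x) = g"
    using assms unfolding profile_def by (auto simp: indicator_def fun_eq_iff)
  finally show ?thesis .
qed

lemma profile_mult: "profile g \<Longrightarrow> profile h \<Longrightarrow> profile (\<lambda>u. g u * h u)"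
  unfolding profile_def monotone_on_def by (auto intro!: mult_mono)

lemma profile_cmult: "0 \<le> c \<Longrightarrow> profile h \<Longrightarrow> profile (\<lambda>u. c * h u)"
  unfolding profile_def monotone_on_def by (auto intro!: mult_left_mono)

lemma profile_powr: "0 \<le> r \<Longrightarrow> profile g \<Longrightarrow> profile (\<lambda>u. g u powr r)"
  unfolding profile_def monotone_on_def by (auto intro!: powr_mono2)

text \<open>Superlevel sets of a nondecreasing function are upper intervals. Whether the left end
  belongs to the interval depends on one-sided continuity, hence an equivalence almost everywhere
  only.\<close>

lemma profile_upper_set:
  assumes g: "profile g" and "0 \<le> t"
  obtains \<alpha> where "0 \<le> \<alpha>" "\<alpha> \<le> 1" "AE u in lborel. t < g u \<longleftrightarrow> u \<in> {\<alpha><..<1}"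
proof -
  let ?S = "insert 1 {u. 0 < u \<and> u < 1 \<and> t < g u}"
  \<comment> \<open>The point 1 in \<open>?S\<close> yields \<open>\<alpha> = 1\<close>, hence an
    empty interval, when the level \<open>t\<close> is never exceeded.\<close>
  define \<alpha> where "\<alpha> = Inf ?S"
  have bdd: "bdd_below ?S" by (rule bdd_belowI[of _ 0]) auto
  have le: "\<alpha> \<le> u" if "u \<in> ?S" for u unfolding \<alpha>_def using that bdd by (rule cInf_lower)
  have "0 \<le> \<alpha>" unfolding \<alpha>_def by (rule cInf_greatest) auto
  moreover have "\<alpha> \<le> 1" using le by auto
  moreover have "AE u in lborel. t < g u \<longleftrightarrow> u \<in> {\<alpha><..<1}"
    using AE_lborel_singleton[of \<alpha>]
  proof eventually_elim
    case (elim u)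
    show ?case
    proof
      assume t: "t < g u"
      then have "g u \<noteq> 0" using \<open>0 \<le> t\<close> by auto
      then have "u \<in> {0<..<1}" using g unfolding profile_def by blast
      then have "u \<in> ?S" using t by auto
      then show "u \<in> {\<alpha><..<1}" using le[of u] elim \<open>u \<in> {0<..<1}\<close> by auto
    next
      assume u: "u \<in> {\<alpha><..<1}"
      then obtain v where "v \<in> ?S" "v < u"
        using cInf_lessD[of ?S u] unfolding \<alpha>_def by auto
      then show "t < g u" using u profile_mono[OF g, of v u] by auto
    qed
  qed
  ultimately show thesis by (rule that)
qed

lemma tail_integral_mono:
  assumes "\<And>u. \<alpha> < u \<Longrightarrow> u < 1 \<Longrightarrow> f u \<le> g u" shows "tail_integral f \<alpha> \<le> tail_integral g \<alpha>"
  unfolding tail_integral_def using assms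
  by (intro nn_integral_mono) (auto simp: indicator_def intro!: ennreal_leI)

lemma tail_integral_cong:
  assumes "\<And>u. \<alpha> < u \<Longrightarrow> u < 1 \<Longrightarrow> f u = g u" shows "tail_integral f \<alpha> = tail_integral g \<alpha>"
  using assms by (intro antisym tail_integral_mono) auto

lemma tail_integral_clip: "0 \<le> \<alpha> \<Longrightarrow> tail_integral (clip f) \<alpha> = tail_integral f \<alpha>"
  by (intro tail_integral_cong) (auto simp: clip_def)

lemma tail_integral_ge1: "1 \<le> \<alpha> \<Longrightarrow> tail_integral f \<alpha> = 0"
  unfolding tail_integral_def by simp

lemma tail_integral_profile_mult:
  assumes [measurable]: "a \<in> borel_measurable borel" and g: "profile g"
  shows "tail_integral (\<lambda>u. a u * g u) 0 =
    (\<integral>\<^sup>+t. (\<integral>\<^sup>+u. ennreal (a u) * indicator {0<..<1} u * indicator {u. 0 \<le> t \<and> t < g u} u \<partial>lborel) \<partial>lborel)"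
proof -
  note [measurable] = profile_measurable[OF g]
  have "tail_integral (\<lambda>u. a u * g u) 0 = (\<integral>\<^sup>+u. (ennreal (a u) * indicator {0<..<1} u) * ennreal (g u) \<partial>lborel)"
    unfolding tail_integral_def
    by (intro nn_integral_cong) (auto simp: ennreal_mult'' profile_nonneg[OF g] ac_simps)
  also have "\<dots> = (\<integral>\<^sup>+t. (\<integral>\<^sup>+u. ennreal (a u) * indicator {0<..<1} u * indicator {u. 0 \<le> t \<and> t < g u} u \<partial>lborel) \<partial>lborel)"
    by (rule layer_cake) (auto intro: lborel.sigma_finite_measure_axioms)
  finally show ?thesis .
qed

lemma upper_set_integral:
  assumes "0 \<le> \<alpha>" "0 \<le> t" "AE u in lborel. t < g u \<longleftrightarrow> u \<in> {\<alpha><..<1}"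
  shows "(\<integral>\<^sup>+u. ennreal (a u) * indicator {0<..<1} u * indicator {u. 0 \<le> t \<and> t < g u} u \<partial>lborel) = tail_integral a \<alpha>"
  unfolding tail_integral_def
  using assms(3) by (intro nn_integral_cong_AE, eventually_elim) (use assms(1,2) in \<open>auto simp: indicator_def\<close>)

text \<open>A profile is a mixture of indicators of upper intervals, one for each level, and on each
  of these the comparison is the hypothesis; intervals starting at 1 contribute nothing.\<close>

lemma tail_dominance:
  assumes [measurable]: "a \<in> borel_measurable borel" "b \<in> borel_measurable borel" and g: "profile g"
    and le: "\<And>\<alpha>. 0 \<le> \<alpha> \<Longrightarrow> \<alpha> < 1 \<Longrightarrow> tail_integral a \<alpha> \<le> tail_integral b \<alpha>"
  shows "tail_integral (\<lambda>u. a u * g u) 0 \<le> tail_integral (\<lambda>u. b u * g u) 0"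
  unfolding tail_integral_profile_mult[OF assms(1) g] tail_integral_profile_mult[OF assms(2) g]
proof (rule nn_integral_mono)
  fix t :: real
  show "(\<integral>\<^sup>+u. ennreal (a u) * indicator {0<..<1} u * indicator {u. 0 \<le> t \<and> t < g u} u \<partial>lborel)
    \<le> (\<integral>\<^sup>+u. ennreal (b u) * indicator {0<..<1} u * indicator {u. 0 \<le> t \<and> t < g u} u \<partial>lborel)"
  proof (cases "0 \<le> t")
    case True
    obtain \<alpha> where \<alpha>: "0 \<le> \<alpha>" "\<alpha> \<le> 1" "AE u in lborel. t < g u \<longleftrightarrow> u \<in> {\<alpha><..<1}"
      using profile_upper_set[OF g True] .
    show ?thesis unfolding upper_set_integral[OF \<alpha>(1) True \<alpha>(3)]
      using le[OF \<alpha>(1)] tail_integral_ge1[of \<alpha>] by (cases "\<alpha> < 1") auto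
  qed (auto simp: indicator_def)
qed

section \<open>Uniform variables and the Hardy-Littlewood inequality\<close>

context prob_space
begin

lemma uniform_nn_integral:
  assumes U: "U \<in> uniform_rvs M" and [measurable]: "f \<in> borel_measurable borel"
  shows "(\<integral>\<^sup>+\<omega>. f (U \<omega>) \<partial>M) = (\<integral>\<^sup>+u\<in>{0<..<1}. f u \<partial>lborel)"
proof -
  have "distributed M lborel U (\<lambda>x. indicator {0..1} x / measure lborel {0..1::real})"
    by (rule uniform_distrI_borel_atLeastAtMost) (use U in \<open>auto simp: uniform_rvs_def\<close>)
  then have "(\<integral>\<^sup>+\<omega>. f (U \<omega>) \<partial>M) = (\<integral>\<^sup>+u. ennreal (indicator {0..1} u / measure lborel {0..1::real}) * f u \<partial>lborel)"
    by (rule distributed_nn_integral[symmetric]) auto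
  also have "\<dots> = (\<integral>\<^sup>+u\<in>{0<..<1}. f u \<partial>lborel)"
    using AE_lborel_singleton[of 0] AE_lborel_singleton[of 1]
    by (intro nn_integral_cong_AE, eventually_elim) (auto simp: indicator_def)
  finally show ?thesis .
qed

lemma uniform_measurable [measurable_dest]: "U \<in> uniform_rvs M \<Longrightarrow> U \<in> borel_measurable M"
  by (simp add: uniform_rvs_def)

lemma uniform_AE:
  assumes U: "U \<in> uniform_rvs M" and "AE u in lborel. 0 < u \<longrightarrow> u < 1 \<longrightarrow> P u"
  shows "AE \<omega> in M. P (U \<omega>)"
proof -
  have "AE u in lborel. u \<in> {0<..<1} \<longrightarrow> P u" using assms(2) by eventually_elim auto
  then obtain N where N: "{u. \<not> (u \<in> {0<..<1} \<longrightarrow> P u)} \<subseteq> N" "emeasure lborel N = 0" "N \<in> sets lborel"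
    by (auto elim!: AE_E)
  note [measurable] = uniform_measurable[OF U]
  have [measurable]: "N \<in> sets borel" using N(3) by simp
  \<comment> \<open>The hypothesis is silent outside the open interval, so those values join the
    exceptional set; the law of \<open>U\<close> does not charge them.\<close>
  let ?N = "N \<union> - {0<..<1}"
  have "(\<integral>\<^sup>+\<omega>. indicator ?N (U \<omega>) \<partial>M) = (\<integral>\<^sup>+u\<in>{0<..<1}. indicator ?N u \<partial>lborel)"
    by (rule uniform_nn_integral[OF U]) auto
  also have "\<dots> \<le> (\<integral>\<^sup>+u. indicator N u \<partial>lborel)" by (intro nn_integral_mono) (auto simp: indicator_def)
  also have "\<dots> = 0" using N by simp
  finally have "AE \<omega> in M. indicator ?N (U \<omega>) = (0::ennreal)"
    by (subst (asm) le_zero_eq, subst (asm) nn_integral_0_iff_AE) auto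
  then show ?thesis by eventually_elim (use N(1) in \<open>auto simp: indicator_def split: if_splits\<close>)
qed

lemma uniform_interior:
  assumes U: "U \<in> uniform_rvs M" shows "AE \<omega> in M. 0 < U \<omega> \<and> U \<omega> < 1"
  by (rule uniform_AE[OF U]) auto

lemma uniform_tail:
  assumes U: "U \<in> uniform_rvs M" and "profile g" "0 \<le> \<alpha>"
  shows "(\<integral>\<^sup>+\<omega>. ennreal (g (U \<omega>)) * indicator {\<alpha><..} (U \<omega>) \<partial>M) = tail_integral g \<alpha>"
proof -
  note [measurable] = profile_measurable[OF assms(2)]
  have "(\<integral>\<^sup>+\<omega>. ennreal (g (U \<omega>)) * indicator {\<alpha><..} (U \<omega>) \<partial>M) =
      (\<integral>\<^sup>+u\<in>{0<..<1}. ennreal (g u) * indicator {\<alpha><..} u \<partial>lborel)"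
    by (rule uniform_nn_integral[OF U]) simp
  also have "\<dots> = tail_integral g \<alpha>"
    unfolding tail_integral_def by (rule nn_integral_cong) (use \<open>0 \<le> \<alpha>\<close> in \<open>simp split: split_indicator\<close>)
  finally show ?thesis .
qed

lemma uniform_tail_0:
  assumes U: "U \<in> uniform_rvs M" and "profile g"
  shows "(\<integral>\<^sup>+\<omega>. ennreal (g (U \<omega>)) \<partial>M) = tail_integral g 0"
  unfolding uniform_tail[OF assms order_refl, symmetric]
  using uniform_interior[OF U] by (intro nn_integral_cong_AE, eventually_elim) auto

lemma uniform_upper_prob:
  assumes U: "U \<in> uniform_rvs M" and "0 \<le> \<alpha>" "\<alpha> \<le> 1"
  shows "(\<integral>\<^sup>+\<omega>. indicator {\<alpha><..} (U \<omega>) \<partial>M) = ennreal (1 - \<alpha>)"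
proof -
  have "(\<integral>\<^sup>+\<omega>. indicator {\<alpha><..} (U \<omega>) \<partial>M) = (\<integral>\<^sup>+u\<in>{0<..<1}. indicator {\<alpha><..} u \<partial>lborel)"
    by (rule uniform_nn_integral[OF U]) simp
  also have "\<dots> = (\<integral>\<^sup>+u. indicator {\<alpha><..<1} u \<partial>lborel)"
    by (rule nn_integral_cong) (use \<open>0 \<le> \<alpha>\<close> in \<open>simp split: split_indicator\<close>)
  finally show ?thesis using assms by simp
qed

text \<open>Bathtub principle: among the events of probability \<open>1 - \<alpha>\<close>, the
  event that \<open>V\<close> exceeds \<open>\<alpha>\<close> collects most of
  \<open>h (V \<omega>)\<close>. With the threshold \<open>c = h \<alpha>\<close>, the integrand is
  at most \<open>c\<close> on the event plus the positive part of \<open>h (V \<omega>) - c\<close>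
  everywhere, and these two bounds integrate exactly to the tail of \<open>h\<close>.\<close>

lemma uniform_tail_le:
  assumes U: "U \<in> uniform_rvs M" and V: "V \<in> uniform_rvs M" and h: "profile h" and \<alpha>: "0 \<le> \<alpha>" "\<alpha> < 1"
  shows "(\<integral>\<^sup>+\<omega>. ennreal (h (V \<omega>)) * indicator {\<alpha><..} (U \<omega>) \<partial>M) \<le> tail_integral h \<alpha>"
proof -
  note [measurable] = profile_measurable[OF h] uniform_measurable[OF U] uniform_measurable[OF V]
  define c where "c = h \<alpha>"
  have c: "0 \<le> c" using profile_nonneg[OF h] by (simp add: c_def)
  have "(\<integral>\<^sup>+\<omega>. ennreal (h (V \<omega>)) * indicator {\<alpha><..} (U \<omega>) \<partial>M)
     \<le> (\<integral>\<^sup>+\<omega>. ennreal c * indicator {\<alpha><..} (U \<omega>) + ennreal (h (V \<omega>) - c) \<partial>M)"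
  proof (intro nn_integral_mono)
    fix \<omega>
    have "ennreal (h (V \<omega>)) \<le> ennreal c + ennreal (h (V \<omega>) - c)"
      using c by (cases "c \<le> h (V \<omega>)") (auto simp flip: ennreal_plus simp: ennreal_neg ennreal_leI)
    then show "ennreal (h (V \<omega>)) * indicator {\<alpha><..} (U \<omega>) \<le> ennreal c * indicator {\<alpha><..} (U \<omega>) + ennreal (h (V \<omega>) - c)"
      by (auto simp: indicator_def)
  qed
  also have "\<dots> = ennreal c * ennreal (1 - \<alpha>) + (\<integral>\<^sup>+\<omega>. ennreal (h (V \<omega>) - c) \<partial>M)"
    using \<alpha> by (subst nn_integral_add) (auto simp: nn_integral_cmult uniform_upper_prob[OF U])
  also have "(\<integral>\<^sup>+\<omega>. ennreal (h (V \<omega>) - c) \<partial>M) = (\<integral>\<^sup>+u. ennreal (h u - c) * indicator {\<alpha><..<1} u \<partial>lborel)"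
  proof (subst uniform_nn_integral[OF V], (auto)[1], intro nn_integral_cong)
    fix u :: real
    have "h u - c \<le> 0" if "0 < u" "u \<le> \<alpha>" unfolding c_def using profile_mono[OF h that \<alpha>(2)] by simp
    then show "ennreal (h u - c) * indicator {0<..<1} u = ennreal (h u - c) * indicator {\<alpha><..<1} u"
      using \<alpha> by (cases "u \<le> \<alpha>") (auto simp: indicator_def ennreal_neg)
  qed
  also have "ennreal c * ennreal (1 - \<alpha>) = (\<integral>\<^sup>+u. ennreal c * indicator {\<alpha><..<1} u \<partial>lborel)"
    using \<alpha> by (subst nn_integral_cmult_indicator) auto
  also have "\<dots> + (\<integral>\<^sup>+u. ennreal (h u - c) * indicator {\<alpha><..<1} u \<partial>lborel) = tail_integral h \<alpha>"
    unfolding tail_integral_def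
  proof (subst nn_integral_add[symmetric], (auto)[2], intro nn_integral_cong)
    fix u :: real
    \<comment> \<open>For \<open>\<alpha> = 0\<close> the threshold is 0, because a profile vanishes
      at 0; nonnegativity then takes the place of monotonicity.\<close>
    have "c \<le> h u" if "\<alpha> < u" "u < 1"
      unfolding c_def using that \<alpha> profile_mono[OF h, of \<alpha> u] profile_nonneg[OF h, of u] h
      by (cases "\<alpha> = 0") (auto simp: profile_def)
    then show "ennreal c * indicator {\<alpha><..<1} u + ennreal (h u - c) * indicator {\<alpha><..<1} u = ennreal (h u) * indicator {\<alpha><..<1} u"
      using c by (auto simp: indicator_def simp flip: ennreal_plus)
  qed
  finally show ?thesis .
qed

text \<open>By the layer cake formula in \<open>g\<close> only events
  \<open>t < g (U \<omega>)\<close> matter. Up to null sets these are events that \<open>U\<close>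
  exceeds some \<open>\<alpha>\<close>, where \<open>uniform_tail_le\<close> applies, and the
  resulting tails of \<open>h\<close> reassemble to the coupled integral.\<close>

lemma Hardy_Littlewood_uniform:
  assumes U: "U \<in> uniform_rvs M" and V: "V \<in> uniform_rvs M" and g: "profile g" and h: "profile h"
  shows "(\<integral>\<^sup>+\<omega>. ennreal (h (V \<omega>) * g (U \<omega>)) \<partial>M) \<le> tail_integral (\<lambda>u. h u * g u) 0"
proof -
  note [measurable] = profile_measurable[OF h] profile_measurable[OF g] uniform_measurable[OF U] uniform_measurable[OF V]
  have "(\<integral>\<^sup>+\<omega>. ennreal (h (V \<omega>) * g (U \<omega>)) \<partial>M) = (\<integral>\<^sup>+\<omega>. ennreal (h (V \<omega>)) * ennreal (g (U \<omega>)) \<partial>M)"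
    by (simp add: ennreal_mult profile_nonneg g h)
  also have "\<dots> = (\<integral>\<^sup>+t. (\<integral>\<^sup>+\<omega>. ennreal (h (V \<omega>)) * indicator {\<omega>. 0 \<le> t \<and> t < g (U \<omega>)} \<omega> \<partial>M) \<partial>lborel)"
    by (rule layer_cake) (auto intro: sigma_finite_measure_axioms)
  also have "\<dots> \<le> tail_integral (\<lambda>u. h u * g u) 0"
    unfolding tail_integral_profile_mult[OF profile_measurable[OF h] g]
  proof (rule nn_integral_mono)
    fix t :: real
    show "(\<integral>\<^sup>+\<omega>. ennreal (h (V \<omega>)) * indicator {\<omega>. 0 \<le> t \<and> t < g (U \<omega>)} \<omega> \<partial>M)
      \<le> (\<integral>\<^sup>+u. ennreal (h u) * indicator {0<..<1} u * indicator {u. 0 \<le> t \<and> t < g u} u \<partial>lborel)"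
    proof (cases "0 \<le> t")
      case True
      obtain \<alpha> where \<alpha>: "0 \<le> \<alpha>" "\<alpha> \<le> 1" "AE u in lborel. t < g u \<longleftrightarrow> u \<in> {\<alpha><..<1}"
        using profile_upper_set[OF g True] .
      have "AE \<omega> in M. t < g (U \<omega>) \<longleftrightarrow> U \<omega> \<in> {\<alpha><..<1}"
        by (rule uniform_AE[OF U]) (use \<alpha>(3) in eventually_elim, auto)
      then have "(\<integral>\<^sup>+\<omega>. ennreal (h (V \<omega>)) * indicator {\<omega>. 0 \<le> t \<and> t < g (U \<omega>)} \<omega> \<partial>M)
        = (\<integral>\<^sup>+\<omega>. ennreal (h (V \<omega>)) * indicator {\<alpha><..<1} (U \<omega>) \<partial>M)"
        by (intro nn_integral_cong_AE, eventually_elim) (use True in \<open>auto simp: indicator_def\<close>)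
      also have "\<dots> \<le> tail_integral h \<alpha>"
      proof (cases "\<alpha> < 1")
        case True
        have "(\<integral>\<^sup>+\<omega>. ennreal (h (V \<omega>)) * indicator {\<alpha><..<1} (U \<omega>) \<partial>M) \<le> (\<integral>\<^sup>+\<omega>. ennreal (h (V \<omega>)) * indicator {\<alpha><..} (U \<omega>) \<partial>M)"
          by (intro nn_integral_mono) (auto simp: indicator_def)
        then show ?thesis using uniform_tail_le[OF U V h \<alpha>(1) True] by auto
      qed auto
      finally show ?thesis unfolding upper_set_integral[OF \<alpha>(1) True \<alpha>(3)] .
    qed (auto simp: indicator_def)
  qed
  finally show ?thesis .
qed

section \<open>Ranks, quantiles and comonotone uniform variables\<close>

text \<open>Let \<open>A\<close> be the set of points of rank at most \<open>u\<close>, and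
  \<open>r\<close> the supremum of the ranks on \<open>A\<close>. Lower sets of points whose ranks
  approach \<open>r\<close> form a chain, so their union has measure at most \<open>r\<close>. What
  remains of \<open>A\<close> lies above all these points, and there every lower section is null;
  since the order is total, Fubini makes this remainder null as well.\<close>

lemma rank_le:
  assumes total: "\<And>x y. le x y \<or> le y x" and trans: "\<And>x y z. le x y \<Longrightarrow> le y z \<Longrightarrow> le x z"
    and [measurable]: "Measurable.pred (M \<Otimes>\<^sub>M M) (\<lambda>(x, y). le x y)"
    and [measurable]: "(\<lambda>x. measure M {y\<in>space M. le y x}) \<in> borel_measurable M"
    and "0 \<le> u"
  shows "measure M {x\<in>space M. measure M {y\<in>space M. le y x} \<le> u} \<le> u"
proof -
  interpret pair_sigma_finite M M ..
  define R where "R x = measure M {y\<in>space M. le y x}" for x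
  have [measurable]: "R \<in> borel_measurable M" unfolding R_def by simp
  define A where "A = {x\<in>space M. R x \<le> u}"
  have [measurable]: "A \<in> sets M" unfolding A_def by measurable
  have meas_le: "{y\<in>space M. le y x} \<in> sets M" if "x \<in> space M" for x
    using measurable_compose[OF measurable_Pair2'[OF that] assms(3)] by (simp add: pred_def)
  show ?thesis
  proof (cases "A = {}")
    case True
    then have "measure M A \<le> u" using \<open>0 \<le> u\<close> by simp
    then show ?thesis unfolding A_def R_def .
  next
    case False
    define r where "r = (SUP x\<in>A. R x)"
    have bdd: "bdd_above (R ` A)" by (rule bdd_aboveI[of _ u]) (auto simp: A_def)
    have R_r: "R x \<le> r" if "x \<in> A" for x unfolding r_def using bdd that by (rule cSUP_upper2) simp
    have "r \<le> u" unfolding r_def using False by (rule cSUP_least) (auto simp: A_def)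
    have "\<exists>x\<in>A. r - 1 / real (Suc n) < R x" for n
      using less_cSUP_iff[OF False bdd, of "r - 1 / real (Suc n)"] unfolding r_def[symmetric] by auto
    \<comment> \<open>The supremum need not be attained, and a point of maximal rank need not exist;
      a sequence replaces it.\<close>
    then obtain a where a: "\<And>n. a n \<in> A" "\<And>n. r - 1 / real (Suc n) < R (a n)" by metis
    define L where "L n = {y\<in>space M. le y (a n)}" for n
    have a_sp: "a n \<in> space M" for n using a(1) by (auto simp: A_def)
    have [measurable]: "L n \<in> sets M" for n unfolding L_def by (rule meas_le[OF a_sp])
    have chain: "L m \<subseteq> L n \<or> L n \<subseteq> L m" for m n
      unfolding L_def using total[of "a m" "a n"] trans by blast
    have fin: "\<exists>k\<le>n. (\<Union>i\<le>n. L i) = L k" for n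
    proof (induction n)
      case (Suc n)
      then obtain k where k: "k \<le> n" "(\<Union>i\<le>n. L i) = L k" by auto
      have "(\<Union>i\<le>Suc n. L i) = L k \<union> L (Suc n)" using k by (simp add: atMost_Suc Un_commute)
      then show ?case using chain[of k "Suc n"] k(1)
        by (metis le_SucI order_refl subset_Un_eq sup.absorb_iff1)
    qed auto
    have "measure M (\<Union>n. L n) \<le> r"
    proof (rule LIMSEQ_le_const2)
      have "(\<lambda>n. measure M (\<Union>i\<le>n. L i)) \<longlonglongrightarrow> measure M (\<Union>n. \<Union>i\<le>n. L i)"
        by (rule finite_Lim_measure_incseq) (auto simp: incseq_def, fastforce)
      also have "(\<Union>n. \<Union>i\<le>n. L i) = (\<Union>n. L n)" by auto
      finally show "(\<lambda>n. measure M (\<Union>i\<le>n. L i)) \<longlonglongrightarrow> measure M (\<Union>n. L n)" .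
      show "\<exists>N. \<forall>n\<ge>N. measure M (\<Union>i\<le>n. L i) \<le> r"
        using fin R_r[OF a(1)] unfolding R_def L_def by metis
    qed
    moreover
    define B where "B = A - (\<Union>n. L n)"
    have [measurable]: "B \<in> sets M" unfolding B_def by auto
    have sec: "AE y in M. \<not> (y \<in> B \<and> le y x)" if "x \<in> B" for x
    proof -
      have x: "x \<in> space M" "x \<in> A" using that by (auto simp: B_def A_def)
      have [measurable]: "{y\<in>space M. le y x} \<in> sets M" by (rule meas_le[OF x(1)])
      define D where "D = {y\<in>space M. le y x} \<inter> B"
      have [measurable]: "D \<in> sets M" unfolding D_def by auto
      have "measure M D \<le> 1 / real (Suc n)" for n
      proof -
        \<comment> \<open>A point of \<open>B\<close> lies above every \<open>a n\<close>, so its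
          lower set contains \<open>L n\<close>, whose measure is already within
          \<open>1 / (n + 1)\<close> of \<open>r\<close>. Only that much is left for
          \<open>D\<close>.\<close>
        have "le (a n) x" using that x total[of x "a n"] unfolding B_def L_def by blast
        then have "L n \<subseteq> {y\<in>space M. le y x}" unfolding L_def using trans by blast
        moreover have "D \<inter> L n = {}" unfolding D_def B_def by auto
        ultimately have "measure M D + measure M (L n) \<le> R x"
          unfolding R_def by (subst finite_measure_Union[symmetric]) (auto intro!: finite_measure_mono simp: D_def)
        then show ?thesis using R_r[OF x(2)] a(2)[of n] unfolding R_def L_def[symmetric] by simp
      qed
      then have "measure M D \<le> 0"
        by (metis nle_le not_le reals_Archimedean inverse_eq_divide)
      then have "measure M D = 0" by (simp add: measure_le_0_iff)
      then have "emeasure M D = 0" by (simp add: emeasure_eq_measure)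
      then have "AE y in M. y \<notin> D" by (intro AE_not_in null_setsI) auto
      with AE_space show ?thesis by eventually_elim (auto simp: D_def)
    qed
    \<comment> \<open>The relation on \<open>B\<close> has null sections in one variable, and by
      Fubini in the other. Totality covers \<open>B \<times> B\<close> by the relation and its
      converse, so that almost every section of \<open>B \<times> B\<close> is null.\<close>
    have sec': "AE x in M. AE y in M. \<not> (x \<in> B \<and> y \<in> B \<and> le y x)"
      by (rule AE_I2, rename_tac x, case_tac "x \<in> B") (use sec in auto)
    then have "AE y in M. AE x in M. \<not> (x \<in> B \<and> y \<in> B \<and> le y x)"
      by (subst (asm) AE_commute) auto
    with sec' have "AE x in M. x \<in> B \<longrightarrow> (AE y in M. y \<notin> B)"
    proof eventually_elim
      case (elim x)
      show ?case
      proof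
        assume "x \<in> B"
        from elim show "AE y in M. y \<notin> B" by eventually_elim (use total \<open>x \<in> B\<close> in blast)
      qed
    qed
    then have "AE y in M. y \<notin> B"
      by (cases "AE y in M. y \<notin> B") auto
    then have "emeasure M B = 0" by (subst (asm) AE_iff_measurable[OF \<open>B \<in> sets M\<close>]) (auto simp: B_def A_def)
    then have "measure M B = 0" by (simp add: measure_def)
    moreover have "measure M A \<le> measure M (\<Union>n. L n) + measure M B"
      by (rule order.trans[OF finite_measure_mono measure_Un_le]) (auto simp: B_def)
    ultimately show ?thesis using \<open>r \<le> u\<close> unfolding A_def R_def by linarith
  qed
qed

text \<open>Ties being negligible, the bound of the previous lemma for the order and for its reverse
  pins down the distribution of the rank.\<close>

lemma uniform_rank:
  assumes total: "\<And>x y. le x y \<or> le y x" and trans: "\<And>x y z. le x y \<Longrightarrow> le y z \<Longrightarrow> le x z"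
    and [measurable]: "Measurable.pred (M \<Otimes>\<^sub>M M) (\<lambda>(x, y). le x y)"
    and ties: "\<And>x. x \<in> space M \<Longrightarrow> measure M {y\<in>space M. le x y \<and> le y x} = 0"
  shows "(\<lambda>x. measure M {y\<in>space M. le y x}) \<in> uniform_rvs M"
proof -
  let ?R = "\<lambda>x. measure M {y\<in>space M. le y x}" and ?S = "\<lambda>x. measure M {y\<in>space M. le x y}"
  have R [measurable]: "?R \<in> borel_measurable M" by measurable
  have S [measurable]: "?S \<in> borel_measurable M" by measurable
  have m: "{y\<in>space M. le y x} \<in> sets M" "{y\<in>space M. le x y} \<in> sets M" if "x \<in> space M" for x
    using measurable_compose[OF measurable_Pair2'[OF that] assms(3)]
      measurable_compose[OF measurable_Pair1'[OF that] assms(3)] by (simp_all add: pred_def)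
  have RS: "?S x = 1 - ?R x" if x: "x \<in> space M" for x
  proof -
    note [measurable] = m[OF x]
    have "?S x + ?R x = measure M ({y\<in>space M. le x y} \<union> {y\<in>space M. le y x}) + measure M ({y\<in>space M. le x y} \<inter> {y\<in>space M. le y x})"
      by (subst measure_Un3) (auto simp: fmeasurable_eq_sets)
    also have "{y\<in>space M. le x y} \<union> {y\<in>space M. le y x} = space M" using total by auto
    also have "{y\<in>space M. le x y} \<inter> {y\<in>space M. le y x} = {y\<in>space M. le x y \<and> le y x}" by auto
    finally show ?thesis using ties[OF x] by (simp add: prob_space)
  qed
  have "measure M {x\<in>space M. ?R x \<le> u} = u" if u: "0 \<le> u" "u \<le> 1" for u
  proof (rule antisym)
    show "measure M {x\<in>space M. ?R x \<le> u} \<le> u"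
      by (rule rank_le[OF total trans]) (use u in auto)
    have *: "measure M {x\<in>space M. ?S x \<le> v} \<le> v" if "0 \<le> v" for v
    proof (rule rank_le[where le = "\<lambda>x y. le y x"])
      show "Measurable.pred (M \<Otimes>\<^sub>M M) (\<lambda>(x, y). le y x)"
        using measurable_compose[OF measurable_pair_swap' assms(3)] by (simp add: split_beta' comp_def)
    qed (use total that in \<open>auto intro: trans\<close>)
    show "u \<le> measure M {x\<in>space M. ?R x \<le> u}"
    proof -
      have "1 - measure M {x\<in>space M. ?R x \<le> u} = measure M {x\<in>space M. \<not> ?R x \<le> u}"
        by (rule prob_neg[symmetric]) measurable
      also have "\<dots> \<le> measure M {x\<in>space M. ?S x \<le> 1 - u}"
        by (rule finite_measure_mono) (auto simp: RS)
      also have "\<dots> \<le> 1 - u" using * u by auto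
      finally show ?thesis by simp
    qed
  qed
  then show ?thesis unfolding uniform_rvs_def by (auto simp: prob_le_1)
qed

text \<open>The Galois connection between a distribution function and its generalised inverse;
  right-continuity makes the infimum attained. The order properties of \<open>quantile\<close> below
  all follow from it.\<close>

lemma quantile_le_iff:
  assumes [measurable]: "W \<in> borel_measurable M" and u: "0 < u" "u < 1"
  shows "quantile M W u \<le> t \<longleftrightarrow> u \<le> measure M {\<omega>\<in>space M. W \<omega> \<le> t}"
proof -
  interpret D: real_distribution "distr M borel W" by (rule real_distribution_distr) simp
  interpret D: cdf_distribution "distr M borel W" by unfold_locales
  have "cdf (distr M borel W) t = measure M {\<omega>\<in>space M. W \<omega> \<le> t}" for t
    unfolding cdf_def by (subst measure_distr) (auto intro!: arg_cong[where f = "measure M"])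
  then show ?thesis using D.pseudoinverse[OF u, of t] unfolding quantile_def by simp
qed

lemma quantile_mono:
  assumes [measurable]: "W \<in> borel_measurable M" and u: "0 < u" "u \<le> v" "v < 1"
  shows "quantile M W u \<le> quantile M W v"
  using quantile_le_iff[of W v "quantile M W v"] quantile_le_iff[of W u "quantile M W v"] u by simp

lemma quantile_nonneg:
  assumes [measurable]: "W \<in> borel_measurable M" and "AE \<omega> in M. 0 \<le> W \<omega>" and u: "0 < u" "u < 1"
  shows "0 \<le> quantile M W u"
proof (rule ccontr)
  assume neg: "\<not> 0 \<le> quantile M W u"
  have "AE \<omega> in M. \<not> W \<omega> \<le> quantile M W u" using assms(2) by eventually_elim (use neg in auto)
  then have "measure M {\<omega>\<in>space M. W \<omega> \<le> quantile M W u} = 0" by (subst prob_Collect_eq_0) auto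
  then show False using quantile_le_iff[OF assms(1) u, of "quantile M W u"] u by simp
qed

lemma profile_quantile:
  assumes "W \<in> borel_measurable M" "AE \<omega> in M. 0 \<le> W \<omega>"
  shows "profile (clip (quantile M W))"
  using assms by (intro profile_clip monotone_onI) (auto intro: quantile_mono quantile_nonneg)

lemma uniform_null:
  assumes "U \<in> uniform_rvs M" shows "measure M {\<omega>\<in>space M. U \<omega> = c} = 0"
proof -
  note [measurable] = uniform_measurable[OF assms]
  have "AE \<omega> in M. U \<omega> \<noteq> c" by (rule uniform_AE[OF assms]) (use AE_lborel_singleton[of c] in eventually_elim, auto)
  then show ?thesis by (simp add: AE_iff_null measure_eq_0_null_sets)
qed

text \<open>The witness is the rank with respect to the lexicographic order of \<open>(W, V)\<close>, where \<open>V\<close> is any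
  uniform variable; \<open>V\<close> need not be independent of \<open>W\<close>.\<close>

lemma comonotone_uniform:
  assumes W [measurable]: "W \<in> borel_measurable M" and V: "V \<in> uniform_rvs M"
  obtains U where "U \<in> uniform_rvs M" "AE \<omega> in M. W \<omega> = quantile M W (U \<omega>)"
proof -
  note [measurable] = uniform_measurable[OF V]
  define le where "le y x \<longleftrightarrow> W y < W x \<or> W y = W x \<and> V y \<le> V x" for x y
  define U where "U x = measure M {y\<in>space M. le y x}" for x
  have U: "U \<in> uniform_rvs M"
    unfolding U_def
  proof (rule uniform_rank)
    show "Measurable.pred (M \<Otimes>\<^sub>M M) (\<lambda>(x, y). le x y)" unfolding le_def by measurable
    show "measure M {y\<in>space M. le x y \<and> le y x} = 0" if "x \<in> space M" for x
    proof -
      have "measure M {y\<in>space M. le x y \<and> le y x} \<le> measure M {y\<in>space M. V y = V x}"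
        by (rule finite_measure_mono) (auto simp: le_def)
      then show ?thesis using uniform_null[OF V] by (simp add: measure_le_0_iff)
    qed
  qed (auto simp: le_def)
  note [measurable] = uniform_measurable[OF U]
  let ?F = "\<lambda>t. measure M {\<omega>\<in>space M. W \<omega> \<le> t}"
  \<comment> \<open>Every point below \<open>\<omega>\<close> in the lexicographic order has a value
    of \<open>W\<close> at most \<open>W \<omega>\<close>, so the rank is at most the distribution
    function at \<open>W \<omega>\<close>.\<close>
  have le: "AE \<omega> in M. quantile M W (U \<omega>) \<le> W \<omega>"
    using uniform_interior[OF U] AE_space
  proof eventually_elim
    case (elim \<omega>)
    have "U \<omega> \<le> ?F (W \<omega>)" unfolding U_def by (rule finite_measure_mono) (auto simp: le_def)
    then show ?case using quantile_le_iff[OF W, of "U \<omega>" "W \<omega>"] elim by simp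
  qed
  have "AE \<omega> in M. U \<omega> \<noteq> c" for c
    by (rule uniform_AE[OF U]) (use AE_lborel_singleton[of c] in eventually_elim, auto)
  \<comment> \<open>If the quantile were strictly below \<open>W \<omega>\<close>, a rational
    \<open>t\<close> between them would force \<open>U \<omega> = ?F t\<close>. A uniform variable
    avoids these countably many values almost surely.\<close>
  then have "AE \<omega> in M. \<forall>t\<in>\<rat>. U \<omega> \<noteq> ?F t"
    by (subst AE_ball_countable) (auto intro: countable_rat)
  with uniform_interior[OF U] AE_space have "AE \<omega> in M. W \<omega> \<le> quantile M W (U \<omega>)"
  proof eventually_elim
    case (elim \<omega>)
    show ?case
    proof (rule ccontr)
      assume "\<not> W \<omega> \<le> quantile M W (U \<omega>)"
      then obtain t where t: "t \<in> \<rat>" "quantile M W (U \<omega>) < t" "t < W \<omega>"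
        using Rats_dense_in_real[of "quantile M W (U \<omega>)" "W \<omega>"] by (auto simp: not_le)
      have "U \<omega> \<le> ?F t"
        by (rule quantile_le_iff[THEN iffD1, OF W]) (use elim(1) t(2) in simp_all)
      moreover have "?F t \<le> U \<omega>" unfolding U_def
      proof (rule finite_measure_mono)
        show "{y \<in> space M. W y \<le> t} \<subseteq> {y \<in> space M. le y \<omega>}" unfolding le_def using t(3) by auto
        have "Measurable.pred M (\<lambda>y. le y \<omega>)" unfolding le_def by measurable
        then show "{y \<in> space M. le y \<omega>} \<in> sets M" by (simp add: pred_def)
      qed
      ultimately have "U \<omega> = ?F t" by (rule antisym)
      with elim(3) t(1) show False by blast
    qed
  qed
  with le have "AE \<omega> in M. W \<omega> = quantile M W (U \<omega>)" by eventually_elim auto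
  with U show thesis by (rule that)
qed

end

section \<open>The modular behind the sigma norm\<close>

lemma ennroot_mono: "0 < r \<Longrightarrow> x \<le> y \<Longrightarrow> ennroot r x \<le> ennroot r y"
  unfolding ennroot_def by (auto simp: top_unique less_top intro!: ennreal_leI powr_mono2 enn2real_mono)

lemma ennroot_powr: "0 < r \<Longrightarrow> 0 \<le> c \<Longrightarrow> ennroot r (ennreal (c powr r)) = ennreal c"
  unfolding ennroot_def by (simp add: powr_powr)

lemma ennroot_less_top: "ennroot r x < top \<longleftrightarrow> x < top"
  unfolding ennroot_def by (simp add: less_top)

lemma ennroot_le_imp:
  assumes "0 < r" "0 \<le> c" "ennroot r x \<le> ennreal c" shows "x \<le> ennreal (c powr r)"
proof -
  have "x \<noteq> \<infinity>" using assms unfolding ennroot_def by (auto simp: top_unique)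
  then obtain y where y: "x = ennreal y" "0 \<le> y" by (cases x) auto
  have "y powr (1 / r) \<le> c" using assms y unfolding ennroot_def by (auto simp: ennreal_le_iff)
  then have "(y powr (1 / r)) powr r \<le> c powr r" using assms by (intro powr_mono2) auto
  then show ?thesis using y assms by (simp add: powr_powr ennreal_leI)
qed

lemma ennroot_le_iff:
  assumes "0 < r" "0 \<le> c" shows "ennroot r x \<le> ennreal c \<longleftrightarrow> x \<le> ennreal (c powr r)"
  using assms ennroot_le_imp[OF assms] ennroot_mono[of r x "ennreal (c powr r)"] by (auto simp: ennroot_powr)

text \<open>The supremum inside \<open>sigma_norm\<close> before the root is taken. Integral
  estimates and limits are carried out on it, and \<open>ennroot_le_iff\<close> translates them into
  norm bounds.\<close>

definition modular :: "'w measure \<Rightarrow> (real \<Rightarrow> real) \<Rightarrow> real \<Rightarrow> ('w \<Rightarrow> 'b::real_normed_vector) \<Rightarrow> ennreal" where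
  "modular M \<sigma> r Y = (SUP U\<in>uniform_rvs M. \<integral>\<^sup>+\<omega>. ennreal (\<sigma> (U \<omega>) * norm (Y \<omega>) powr r) \<partial>M)"

lemma sigma_norm_modular: "sigma_norm M \<sigma> r Y = ennroot r (modular M \<sigma> r Y)"
  unfolding sigma_norm_def modular_def ..

locale distorted_prob = prob_space M for M :: "'w measure" +
  fixes \<sigma> :: "real \<Rightarrow> real"
  assumes uniform_nonempty: "uniform_rvs M \<noteq> {}" and distortion: "distortion \<sigma>"
begin

abbreviation s where "s \<equiv> clip \<sigma>"

lemma profile_s: "profile s"
  using distortion unfolding distortion_def
  by (intro profile_clip) (auto intro: monotone_on_subset)

lemma s_measurable [measurable]: "s \<in> borel_measurable borel"
  by (rule profile_measurable[OF profile_s])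

lemma s_nonneg [simp]: "0 \<le> s u"
  by (rule profile_nonneg[OF profile_s])

lemma tail_s_0: "tail_integral s 0 = 1"
proof -
  have "tail_integral s 0 = (\<integral>\<^sup>+u\<in>{0..<1}. ennreal (\<sigma> u) \<partial>lborel)"
    unfolding tail_integral_def using AE_lborel_singleton[of 0]
    by (intro nn_integral_cong_AE, eventually_elim) (auto simp: clip_def indicator_def)
  then show ?thesis using distortion by (simp add: distortion_def)
qed

lemma tail_s_le_1: "0 \<le> \<alpha> \<Longrightarrow> tail_integral s \<alpha> \<le> 1"
  unfolding tail_s_0[symmetric] tail_integral_def by (intro nn_integral_mono) (auto simp: indicator_def)

text \<open>A nondecreasing function of mean 1 has tail averages of at least 1: if
  \<open>s \<alpha> \<ge> 1\<close>, then \<open>s \<ge> 1\<close> to the right of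
  \<open>\<alpha>\<close>; otherwise the part left of \<open>\<alpha>\<close> takes at most
  \<open>\<alpha>\<close> from the total mass 1.\<close>

lemma tail_s_ge:
  assumes \<alpha>: "0 \<le> \<alpha>" "\<alpha> < 1" shows "ennreal (1 - \<alpha>) \<le> tail_integral s \<alpha>"
proof (cases "\<alpha> = 0 \<or> 1 \<le> s \<alpha>")
  case True
  then show ?thesis
  proof
    assume "1 \<le> s \<alpha>"
    then have pos: "0 < \<alpha>" using \<alpha> by (cases "\<alpha> = 0") (auto simp: clip_def)
    have "1 \<le> s u" if "\<alpha> < u" "u < 1" for u
      using \<open>1 \<le> s \<alpha>\<close> profile_mono[OF profile_s pos _ that(2)] that by fastforce
    then have "tail_integral (\<lambda>_. 1) \<alpha> \<le> tail_integral s \<alpha>" by (rule tail_integral_mono)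
    then show ?thesis using \<alpha> by (simp add: tail_integral_def)
  qed (simp add: tail_s_0)
next
  case False
  then have pos: "0 < \<alpha>" using \<alpha> by auto
  have le: "s u \<le> 1" if "0 < u" "u \<le> \<alpha>" for u
    using profile_mono[OF profile_s that \<alpha>(2)] False by auto
  have "1 = tail_integral s 0" by (simp add: tail_s_0)
  also have "\<dots> = (\<integral>\<^sup>+u. ennreal (s u) * indicator {0<..\<alpha>} u + ennreal (s u) * indicator {\<alpha><..<1} u \<partial>lborel)"
    unfolding tail_integral_def by (rule nn_integral_cong) (use pos \<alpha> in \<open>auto simp: indicator_def\<close>)
  also have "\<dots> = (\<integral>\<^sup>+u. ennreal (s u) * indicator {0<..\<alpha>} u \<partial>lborel) + tail_integral s \<alpha>"
    unfolding tail_integral_def by (rule nn_integral_add) auto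
  also have "(\<integral>\<^sup>+u. ennreal (s u) * indicator {0<..\<alpha>} u \<partial>lborel) \<le> (\<integral>\<^sup>+u. indicator {0<..\<alpha>} u \<partial>lborel)"
    using le by (intro nn_integral_mono) (auto simp: indicator_def)
  also have "\<dots> = ennreal \<alpha>" using pos by simp
  finally have 1: "1 \<le> ennreal \<alpha> + tail_integral s \<alpha>" by (simp add: add_right_mono)
  obtain T where T: "tail_integral s \<alpha> = ennreal T" "0 \<le> T"
    using tail_s_le_1[OF \<alpha>(1)] by (cases "tail_integral s \<alpha>") (auto simp: top_unique)
  show ?thesis using 1 unfolding T(1) using T(2) \<alpha>
    by (simp flip: ennreal_plus ennreal_1 add: ennreal_le_iff)
qed

lemma tail_s_pos: "0 \<le> \<alpha> \<Longrightarrow> \<alpha> < 1 \<Longrightarrow> 0 < tail_integral s \<alpha>"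
  using order.strict_trans2[OF _ tail_s_ge, of 0 \<alpha>] by (simp add: ennreal_less_zero_iff)

lemma AE_s:
  assumes "U \<in> uniform_rvs M" shows "AE \<omega> in M. \<sigma> (U \<omega>) = s (U \<omega>)"
  using uniform_interior[OF assms] by eventually_elim (auto simp: clip_def)

lemma modular_s:
  "modular M \<sigma> r Y = (SUP U\<in>uniform_rvs M. \<integral>\<^sup>+\<omega>. ennreal (s (U \<omega>) * norm (Y \<omega>) powr r) \<partial>M)"
  unfolding modular_def
proof (rule SUP_cong[OF refl])
  fix U assume "U \<in> uniform_rvs M"
  show "(\<integral>\<^sup>+\<omega>. ennreal (\<sigma> (U \<omega>) * norm (Y \<omega>) powr r) \<partial>M) = (\<integral>\<^sup>+\<omega>. ennreal (s (U \<omega>) * norm (Y \<omega>) powr r) \<partial>M)"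
    using AE_s[OF \<open>U \<in> uniform_rvs M\<close>] by (intro nn_integral_cong_AE, eventually_elim) simp
qed

lemma modular_mono:
  assumes "0 \<le> r" "AE \<omega> in M. norm (Y \<omega>) \<le> norm (Y' \<omega>)"
  shows "modular M \<sigma> r Y \<le> modular M \<sigma> r Y'"
  unfolding modular_s
proof (rule SUP_mono', rule nn_integral_mono_AE)
  fix U :: "'w \<Rightarrow> real"
  show "AE \<omega> in M. ennreal (s (U \<omega>) * norm (Y \<omega>) powr r) \<le> ennreal (s (U \<omega>) * norm (Y' \<omega>) powr r)"
    using assms(2) by eventually_elim (use assms(1) in \<open>auto intro!: ennreal_leI mult_left_mono powr_mono2\<close>)
qed

lemma modular_cong:
  assumes "0 \<le> r" "AE \<omega> in M. norm (Y \<omega>) = norm (Y' \<omega>)"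
  shows "modular M \<sigma> r Y = modular M \<sigma> r Y'"
  by (intro antisym modular_mono[OF assms(1)]; use assms(2) in eventually_elim) auto

lemma modular_cmult:
  assumes [measurable]: "(\<lambda>\<omega>. norm (Y \<omega>)) \<in> borel_measurable M" and "0 \<le> c"
    and eq: "AE \<omega> in M. norm (Y' \<omega>) = c * norm (Y \<omega>)"
  shows "modular M \<sigma> r Y' = ennreal (c powr r) * modular M \<sigma> r Y"
  unfolding modular_s
proof (subst SUP_mult_left_ennreal, rule SUP_cong[OF refl])
  fix U assume U: "U \<in> uniform_rvs M"
  note [measurable] = uniform_measurable[OF U]
  have "(\<integral>\<^sup>+\<omega>. ennreal (s (U \<omega>) * norm (Y' \<omega>) powr r) \<partial>M) = (\<integral>\<^sup>+\<omega>. ennreal (c powr r) * ennreal (s (U \<omega>) * norm (Y \<omega>) powr r) \<partial>M)"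
    using eq by (intro nn_integral_cong_AE, eventually_elim)
      (use \<open>0 \<le> c\<close> in \<open>simp add: powr_mult ennreal_mult ac_simps\<close>)
  also have "\<dots> = ennreal (c powr r) * (\<integral>\<^sup>+\<omega>. ennreal (s (U \<omega>) * norm (Y \<omega>) powr r) \<partial>M)"
    by (rule nn_integral_cmult) measurable
  finally show "(\<integral>\<^sup>+\<omega>. ennreal (s (U \<omega>) * norm (Y' \<omega>) powr r) \<partial>M) = \<dots>" .
qed

text \<open>The sum is at most twice the larger of the two norms, and a power of a maximum is at
  most the sum of the powers. The resulting factor \<open>2 powr r\<close> is harmless where
  finiteness is at stake.\<close>

lemma modular_add:
  assumes [measurable]: "(\<lambda>\<omega>. norm (Y \<omega>)) \<in> borel_measurable M" "(\<lambda>\<omega>. norm (Y' \<omega>)) \<in> borel_measurable M"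
    and "0 \<le> r" and le: "AE \<omega> in M. norm (Y'' \<omega>) \<le> norm (Y \<omega>) + norm (Y' \<omega>)"
  shows "modular M \<sigma> r Y'' \<le> ennreal (2 powr r) * (modular M \<sigma> r Y + modular M \<sigma> r Y')"
  unfolding modular_s[of r Y'']
proof (rule SUP_least)
  fix U assume U: "U \<in> uniform_rvs M"
  note [measurable] = uniform_measurable[OF U]
  have "(\<integral>\<^sup>+\<omega>. ennreal (s (U \<omega>) * norm (Y'' \<omega>) powr r) \<partial>M) \<le>
    (\<integral>\<^sup>+\<omega>. ennreal (2 powr r) * (ennreal (s (U \<omega>) * norm (Y \<omega>) powr r) + ennreal (s (U \<omega>) * norm (Y' \<omega>) powr r)) \<partial>M)"
  proof (rule nn_integral_mono_AE)
    show "AE \<omega> in M. ennreal (s (U \<omega>) * norm (Y'' \<omega>) powr r) \<le>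
      ennreal (2 powr r) * (ennreal (s (U \<omega>) * norm (Y \<omega>) powr r) + ennreal (s (U \<omega>) * norm (Y' \<omega>) powr r))"
      using le
    proof eventually_elim
      case (elim \<omega>)
      have "norm (Y'' \<omega>) powr r \<le> (2 * max (norm (Y \<omega>)) (norm (Y' \<omega>))) powr r"
        using elim \<open>0 \<le> r\<close> by (intro powr_mono2) auto
      also have "\<dots> = 2 powr r * max (norm (Y \<omega>)) (norm (Y' \<omega>)) powr r"
        by (simp add: powr_mult)
      also have "max (norm (Y \<omega>)) (norm (Y' \<omega>)) powr r \<le> norm (Y \<omega>) powr r + norm (Y' \<omega>) powr r"
        by (auto simp: max_def)
      finally have "s (U \<omega>) * norm (Y'' \<omega>) powr r \<le> 2 powr r * (s (U \<omega>) * norm (Y \<omega>) powr r + s (U \<omega>) * norm (Y' \<omega>) powr r)"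
        using mult_left_mono[OF _ s_nonneg[of "U \<omega>"]] by (fastforce simp: algebra_simps)
      then have "ennreal (s (U \<omega>) * norm (Y'' \<omega>) powr r) \<le> ennreal (2 powr r * (s (U \<omega>) * norm (Y \<omega>) powr r + s (U \<omega>) * norm (Y' \<omega>) powr r))"
        by (rule ennreal_leI)
      then show ?case by (simp add: ennreal_mult ennreal_plus)
    qed
  qed
  also have "\<dots> = ennreal (2 powr r) * ((\<integral>\<^sup>+\<omega>. ennreal (s (U \<omega>) * norm (Y \<omega>) powr r) \<partial>M) + (\<integral>\<^sup>+\<omega>. ennreal (s (U \<omega>) * norm (Y' \<omega>) powr r) \<partial>M))"
    by (simp add: nn_integral_cmult nn_integral_add)
  also have "\<dots> \<le> ennreal (2 powr r) * (modular M \<sigma> r Y + modular M \<sigma> r Y')"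
    unfolding modular_s using U by (intro mult_left_mono add_mono SUP_upper) auto
  finally show "(\<integral>\<^sup>+\<omega>. ennreal (s (U \<omega>) * norm (Y'' \<omega>) powr r) \<partial>M) \<le> \<dots>" .
qed

text \<open>Hardy-Littlewood bounds the integral for every competing uniform variable, and the
  variable \<open>U\<close> that carries \<open>Y\<close> attains the bound. The supremum thus
  becomes an integral over the unit interval.\<close>

lemma modular_profile:
  assumes "0 \<le> r" and U: "U \<in> uniform_rvs M" and g: "profile g" and eq: "AE \<omega> in M. norm (Y \<omega>) = g (U \<omega>)"
  shows "modular M \<sigma> r Y = tail_integral (\<lambda>u. s u * g u powr r) 0"
proof -
  have gr: "profile (\<lambda>u. g u powr r)" by (rule profile_powr[OF assms(1) g])
  have *: "(\<integral>\<^sup>+\<omega>. ennreal (s (V \<omega>) * norm (Y \<omega>) powr r) \<partial>M) = (\<integral>\<^sup>+\<omega>. ennreal (s (V \<omega>) * g (U \<omega>) powr r) \<partial>M)" for V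
    using eq by (intro nn_integral_cong_AE, eventually_elim) simp
  show ?thesis unfolding modular_s *
  proof (rule antisym[OF SUP_least SUP_upper2[OF U]])
    show "(\<integral>\<^sup>+\<omega>. ennreal (s (V \<omega>) * g (U \<omega>) powr r) \<partial>M) \<le> tail_integral (\<lambda>u. s u * g u powr r) 0"
      if "V \<in> uniform_rvs M" for V
      by (rule Hardy_Littlewood_uniform[OF U that gr profile_s])
    show "tail_integral (\<lambda>u. s u * g u powr r) 0 \<le> (\<integral>\<^sup>+\<omega>. ennreal (s (U \<omega>) * g (U \<omega>) powr r) \<partial>M)"
      using uniform_tail_0[OF U profile_mult[OF profile_s gr]] by simp
  qed
qed

lemma profile_rep:
  assumes [measurable]: "W \<in> borel_measurable M" and "AE \<omega> in M. 0 \<le> W \<omega>"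
  obtains U where "U \<in> uniform_rvs M" "AE \<omega> in M. W \<omega> = clip (quantile M W) (U \<omega>)"
proof -
  obtain V where "V \<in> uniform_rvs M" using uniform_nonempty by auto
  then obtain U where U: "U \<in> uniform_rvs M" "AE \<omega> in M. W \<omega> = quantile M W (U \<omega>)"
    by (rule comonotone_uniform[OF assms(1)])
  have "AE \<omega> in M. W \<omega> = clip (quantile M W) (U \<omega>)"
    using uniform_interior[OF U(1)] U(2) by eventually_elim (auto simp: clip_def)
  with U(1) show thesis by (rule that)
qed

text \<open>By \<open>tail_s_ge\<close> the tails of \<open>s\<close> dominate those of the constant
  1; tested against the rearranged power of the norm, this is the embedding into the ordinary
  \<open>L^r\<close>.\<close>

lemma nn_integral_le_modular:
  assumes [measurable]: "(\<lambda>\<omega>. norm (Y \<omega>)) \<in> borel_measurable M" and "0 \<le> r"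
  shows "(\<integral>\<^sup>+\<omega>. ennreal (norm (Y \<omega>) powr r) \<partial>M) \<le> modular M \<sigma> r Y"
proof -
  let ?g = "clip (quantile M (\<lambda>\<omega>. norm (Y \<omega>)))"
  have g: "profile ?g" by (rule profile_quantile) auto
  obtain U where U: "U \<in> uniform_rvs M" "AE \<omega> in M. norm (Y \<omega>) = ?g (U \<omega>)"
    by (rule profile_rep[of "\<lambda>\<omega>. norm (Y \<omega>)"]) auto
  have gr: "profile (\<lambda>u. ?g u powr r)" by (rule profile_powr[OF assms(2) g])
  have "(\<integral>\<^sup>+\<omega>. ennreal (norm (Y \<omega>) powr r) \<partial>M) = (\<integral>\<^sup>+\<omega>. ennreal (?g (U \<omega>) powr r) \<partial>M)"
    using U(2) by (intro nn_integral_cong_AE, eventually_elim) simp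
  also have "\<dots> = tail_integral (\<lambda>u. 1 * ?g u powr r) 0" using uniform_tail_0[OF U(1) gr] by simp
  also have "\<dots> \<le> tail_integral (\<lambda>u. s u * ?g u powr r) 0"
    by (rule tail_dominance[OF _ _ gr]) (auto simp: tail_integral_def[of "\<lambda>_. 1"] tail_s_ge)
  also have "\<dots> = modular M \<sigma> r Y" by (rule modular_profile[OF assms(2) U(1) g U(2), symmetric])
  finally show ?thesis .
qed

lemma modular_le_1:
  assumes "0 \<le> r" "AE \<omega> in M. norm (Y \<omega>) \<le> 1" shows "modular M \<sigma> r Y \<le> 1"
proof -
  have "modular M \<sigma> r Y \<le> modular M \<sigma> r (\<lambda>_. 1::real)" using assms by (intro modular_mono) auto
  also have "\<dots> \<le> 1"
    unfolding modular_s
  proof (rule SUP_least)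
    fix U assume "U \<in> uniform_rvs M"
    then show "(\<integral>\<^sup>+\<omega>. ennreal (s (U \<omega>) * norm (1::real) powr r) \<partial>M) \<le> 1"
      using uniform_tail_0[OF _ profile_s] tail_s_0 by simp
  qed
  finally show ?thesis .
qed

section \<open>The scalar dual norm\<close>

text \<open>The norm of \<open>W\<close> in the associate (Koethe dual) space of the scalar space,
  with the unit ball written by means of the modular, since norm and modular are at most 1
  simultaneously. Monotone convergence later admits all measurable test functions; simple ones allow
  vector-valued tests that are again simple.\<close>

definition dual_sup :: "real \<Rightarrow> ('w \<Rightarrow> real) \<Rightarrow> ennreal" where
  "dual_sup p W = (SUP f\<in>{f. simple_function M f \<and> (\<forall>\<omega>. 0 \<le> f \<omega>) \<and> modular M \<sigma> p f \<le> 1}. \<integral>\<^sup>+\<omega>. ennreal (W \<omega> * f \<omega>) \<partial>M)"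

lemma dual_sup_bound_simple:
  fixes f :: "'w \<Rightarrow> real"
  assumes [measurable]: "W \<in> borel_measurable M" and p: "0 < p" and f: "simple_function M f" "\<And>\<omega>. 0 \<le> f \<omega>"
    and c: "0 < c" "modular M \<sigma> p f \<le> ennreal (c powr p)"
  shows "(\<integral>\<^sup>+\<omega>. ennreal (W \<omega> * f \<omega>) \<partial>M) \<le> ennreal c * dual_sup p W"
proof -
  have [measurable]: "f \<in> borel_measurable M" using f(1) by (rule borel_measurable_simple_function)
  let ?f = "\<lambda>\<omega>. inverse c * f \<omega>"
  have "modular M \<sigma> p ?f = ennreal ((inverse c) powr p) * modular M \<sigma> p f"
    using c f by (intro modular_cmult) (auto simp: abs_mult)
  also have "\<dots> \<le> ennreal ((inverse c) powr p) * ennreal (c powr p)"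
    by (rule mult_left_mono[OF c(2)]) simp
  also have "\<dots> = 1" using c by (simp add: powr_mult[symmetric] flip: ennreal_mult)
  finally have "(\<integral>\<^sup>+\<omega>. ennreal (W \<omega> * ?f \<omega>) \<partial>M) \<le> dual_sup p W"
    unfolding dual_sup_def using f c by (intro SUP_upper) (auto intro!: simple_function_compose1[of _ _ "\<lambda>x. inverse c * x"])
  then have "ennreal c * (\<integral>\<^sup>+\<omega>. ennreal (W \<omega> * ?f \<omega>) \<partial>M) \<le> ennreal c * dual_sup p W"
    by (rule mult_left_mono) simp
  also have "ennreal c * (\<integral>\<^sup>+\<omega>. ennreal (W \<omega> * ?f \<omega>) \<partial>M) = (\<integral>\<^sup>+\<omega>. ennreal c * ennreal (W \<omega> * ?f \<omega>) \<partial>M)"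
    by (rule nn_integral_cmult[symmetric]) measurable
  also have "\<dots> = (\<integral>\<^sup>+\<omega>. ennreal (W \<omega> * f \<omega>) \<partial>M)"
    using c by (intro nn_integral_cong) (simp add: field_simps flip: ennreal_mult')
  finally show ?thesis .
qed

lemma nonneg_simple_approx:
  fixes f :: "'w \<Rightarrow> real"
  assumes [measurable]: "f \<in> borel_measurable M" and f: "\<And>\<omega>. 0 \<le> f \<omega>"
  obtains F where "\<And>i. simple_function M (F i)" "\<And>i \<omega>. 0 \<le> F i \<omega>" "\<And>i \<omega>. F i \<omega> \<le> f \<omega>" "incseq F"
    "\<And>\<omega>. (\<lambda>i. F i \<omega>) \<longlonglongrightarrow> f \<omega>"
proof -
  have "(\<lambda>\<omega>. ennreal (f \<omega>)) \<in> borel_measurable M" by measurable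
  then obtain g where g: "\<And>i. simple_function M (g i)" "incseq g" "\<And>i \<omega>. g i \<omega> < top"
    "\<And>\<omega>. (SUP i. g i \<omega>) = ennreal (f \<omega>)"
    using borel_measurable_implies_simple_function_sequence'[of "\<lambda>\<omega>. ennreal (f \<omega>)" M] by blast
  define F where "F i \<omega> = enn2real (g i \<omega>)" for i \<omega>
  have gF: "g i \<omega> = ennreal (F i \<omega>)" for i \<omega> using g(3)[of i \<omega>] by (simp add: F_def)
  show thesis
  proof (rule that[of F])
    show "simple_function M (F i)" for i
      unfolding F_def[abs_def] using g(1) by (rule simple_function_compose1)
    show "0 \<le> F i \<omega>" for i \<omega> by (simp add: F_def)
    show "F i \<omega> \<le> f \<omega>" for i \<omega>
      using SUP_upper[of i UNIV "\<lambda>i. g i \<omega>"] f[of \<omega>] unfolding g(4) by (simp add: gF)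
    show "incseq F" using g(2,3) by (auto simp: incseq_def le_fun_def F_def intro!: enn2real_mono)
    fix \<omega>
    have "(\<lambda>i. g i \<omega>) \<longlonglongrightarrow> ennreal (f \<omega>)"
      unfolding g(4)[symmetric] using g(2) by (intro LIMSEQ_SUP) (auto simp: incseq_def le_fun_def)
    then show "(\<lambda>i. F i \<omega>) \<longlonglongrightarrow> f \<omega>" unfolding gF using f by (simp add: F_def)
  qed
qed

text \<open>Simple functions increasing to \<open>f\<close> inherit its modular bound, so monotone
  convergence extends this form of Hoelder's inequality beyond simple functions. A free positive
  \<open>c\<close> in place of the norm avoids dividing by a norm that may vanish.\<close>

lemma dual_sup_bound:
  fixes f :: "'w \<Rightarrow> real"
  assumes [measurable]: "W \<in> borel_measurable M" "f \<in> borel_measurable M"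
    and W: "\<And>\<omega>. 0 \<le> W \<omega>" and f: "\<And>\<omega>. 0 \<le> f \<omega>" and p: "0 < p"
    and c: "0 < c" "modular M \<sigma> p f \<le> ennreal (c powr p)"
  shows "(\<integral>\<^sup>+\<omega>. ennreal (W \<omega> * f \<omega>) \<partial>M) \<le> ennreal c * dual_sup p W"
proof -
  obtain F where F: "\<And>i. simple_function M (F i)" "\<And>i \<omega>. 0 \<le> F i \<omega>" "\<And>i \<omega>. F i \<omega> \<le> f \<omega>" "incseq F"
    "\<And>\<omega>. (\<lambda>i. F i \<omega>) \<longlonglongrightarrow> f \<omega>" by (rule nonneg_simple_approx[OF assms(2) f]) blast
  note [measurable] = borel_measurable_simple_function[OF F(1)]
  have "(\<lambda>i. \<integral>\<^sup>+\<omega>. ennreal (W \<omega> * F i \<omega>) \<partial>M) \<longlonglongrightarrow> (\<integral>\<^sup>+\<omega>. ennreal (W \<omega> * f \<omega>) \<partial>M)"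
    using F(4,5) W by (intro nn_integral_LIMSEQ)
      (auto simp: incseq_def le_fun_def intro!: ennreal_leI mult_left_mono tendsto_ennrealI tendsto_mult_left)
  moreover have "(\<integral>\<^sup>+\<omega>. ennreal (W \<omega> * F i \<omega>) \<partial>M) \<le> ennreal c * dual_sup p W" for i
  proof (rule dual_sup_bound_simple[OF assms(1) p F(1) F(2) c(1)])
    show "modular M \<sigma> p (F i) \<le> ennreal (c powr p)"
      by (rule order.trans[OF modular_mono c(2)]) (use p F(2,3) f in \<open>auto intro: order.trans\<close>)
  qed
  ultimately show ?thesis by (intro LIMSEQ_le_const2) auto
qed

lemma nn_integral_le_dual_sup:
  assumes "W \<in> borel_measurable M" "0 < p"
  shows "(\<integral>\<^sup>+\<omega>. ennreal (W \<omega>) \<partial>M) \<le> dual_sup p W"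
  using dual_sup_bound_simple[OF assms, of "\<lambda>_. 1" 1] modular_le_1[of p "\<lambda>_. 1::real"] assms(2) by simp

text \<open>The quotient at \<open>\<alpha>\<close> is a pairing of \<open>W\<close> with the
  indicator of the event that \<open>U\<close> exceeds \<open>\<alpha>\<close>, divided by the
  modular of that indicator. Conversely, quotients bounded by \<open>K\<close> say that the tails of
  \<open>w\<close> are dominated by those of \<open>K * s\<close>, and tail dominance carries over
  to every profile.\<close>

lemma sigma_star_norm_infinity:
  fixes Z :: "'w \<Rightarrow> 'k::{real_normed_field, euclidean_space}"
  assumes [measurable]: "Z \<in> borel_measurable M"
  shows "sigma_star_norm M \<sigma> \<infinity> Z = dual_sup 1 (\<lambda>\<omega>. norm (Z \<omega>))"
proof -
  define W where "W = (\<lambda>\<omega>. norm (Z \<omega>))"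
  have [measurable]: "W \<in> borel_measurable M" unfolding W_def by measurable
  have W0: "0 \<le> W \<omega>" for \<omega> by (simp add: W_def)
  define w where "w = clip (quantile M W)"
  have w: "profile w" unfolding w_def by (rule profile_quantile) (auto simp: W0)
  note [measurable] = profile_measurable[OF w]
  obtain U where U: "U \<in> uniform_rvs M" "AE \<omega> in M. W \<omega> = w (U \<omega>)"
    unfolding w_def by (rule profile_rep[of W]) (auto simp: W0)
  note [measurable] = uniform_measurable[OF U(1)]
  have eq: "sigma_star_norm M \<sigma> \<infinity> Z = (SUP \<alpha>\<in>{0..<1}. tail_integral w \<alpha> / tail_integral s \<alpha>)"
    unfolding sigma_star_norm_def W_def[symmetric] w_def by (auto intro!: SUP_cong simp: tail_integral_clip)
  show ?thesis unfolding W_def[symmetric]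
  proof (rule antisym)
    show "sigma_star_norm M \<sigma> \<infinity> Z \<le> dual_sup 1 W"
      unfolding eq
    proof (rule SUP_least)
      fix \<alpha> :: real assume "\<alpha> \<in> {0..<1}"
      then have \<alpha>: "0 \<le> \<alpha>" "\<alpha> < 1" by auto
      obtain S where S: "tail_integral s \<alpha> = ennreal S" "0 < S"
        using tail_s_le_1[OF \<alpha>(1)] tail_s_pos[OF \<alpha>] by (cases "tail_integral s \<alpha>") (auto simp: top_unique)
      let ?h = "\<lambda>u. indicat_real {\<alpha><..<1} u"
      let ?f = "\<lambda>\<omega>. indicat_real {\<alpha><..<1} (U \<omega>)"
      have h: "profile ?h" by (rule profileI) (use \<alpha> in \<open>auto simp: indicator_def\<close>)
      have "modular M \<sigma> 1 ?f = tail_integral (\<lambda>u. s u * ?h u powr 1) 0"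
        by (rule modular_profile[OF _ U(1) h]) auto
      also have "\<dots> = ennreal S"
        unfolding S(1)[symmetric] tail_integral_def using \<alpha> by (intro nn_integral_cong) (auto simp: indicator_def)
      finally have "(\<integral>\<^sup>+\<omega>. ennreal (W \<omega> * ?f \<omega>) \<partial>M) \<le> ennreal S * dual_sup 1 W"
        using S(2) by (intro dual_sup_bound[OF _ _ W0]) auto
      moreover have "(\<integral>\<^sup>+\<omega>. ennreal (W \<omega> * ?f \<omega>) \<partial>M) = (\<integral>\<^sup>+\<omega>. ennreal (w (U \<omega>) * ?h (U \<omega>)) \<partial>M)"
        using U(2) by (intro nn_integral_cong_AE, eventually_elim) simp
      moreover have "\<dots> = tail_integral w \<alpha>"
        unfolding uniform_tail_0[OF U(1) profile_mult[OF w h]]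
        unfolding tail_integral_def using \<alpha> by (intro nn_integral_cong) (auto simp: indicator_def)
      ultimately show "tail_integral w \<alpha> / tail_integral s \<alpha> \<le> dual_sup 1 W"
        unfolding S(1) using S(2) by (intro divide_le_posI_ennreal) auto
    qed
  next
    show "dual_sup 1 W \<le> sigma_star_norm M \<sigma> \<infinity> Z"
    proof (cases "sigma_star_norm M \<sigma> \<infinity> Z")
      case (real K)
      show ?thesis unfolding dual_sup_def
      proof (rule SUP_least, safe)
        fix f :: "'w \<Rightarrow> real" assume f: "simple_function M f" "\<forall>\<omega>. 0 \<le> f \<omega>" "modular M \<sigma> 1 f \<le> 1"
        have [measurable]: "f \<in> borel_measurable M" using f(1) by (rule borel_measurable_simple_function)
        define g where "g = clip (quantile M f)"
        have g: "profile g" unfolding g_def by (rule profile_quantile) (auto simp: f)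
        note [measurable] = profile_measurable[OF g]
        obtain V where V: "V \<in> uniform_rvs M" "AE \<omega> in M. f \<omega> = g (V \<omega>)"
          unfolding g_def by (rule profile_rep[of f]) (auto simp: f)
        have "(\<integral>\<^sup>+\<omega>. ennreal (W \<omega> * f \<omega>) \<partial>M) = (\<integral>\<^sup>+\<omega>. ennreal (w (U \<omega>) * g (V \<omega>)) \<partial>M)"
          using U(2) V(2) by (intro nn_integral_cong_AE, eventually_elim) simp
        also have "\<dots> \<le> tail_integral (\<lambda>u. w u * g u) 0" by (rule Hardy_Littlewood_uniform[OF V(1) U(1) g w])
        also have "\<dots> \<le> tail_integral (\<lambda>u. (K * s u) * g u) 0"
        proof (rule tail_dominance[OF _ _ g])
          fix \<alpha> :: real assume \<alpha>: "0 \<le> \<alpha>" "\<alpha> < 1"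
          have "tail_integral w \<alpha> / tail_integral s \<alpha> \<le> ennreal K"
            unfolding real(2)[symmetric] eq by (rule SUP_upper) (use \<alpha> in auto)
          moreover obtain S where S: "tail_integral s \<alpha> = ennreal S" "0 < S"
            using tail_s_le_1[OF \<alpha>(1)] tail_s_pos[OF \<alpha>] by (cases "tail_integral s \<alpha>") (auto simp: top_unique)
          ultimately have "tail_integral w \<alpha> \<le> ennreal K * tail_integral s \<alpha>"
            using mult_right_mono[of "tail_integral w \<alpha> / ennreal S" "ennreal K" "ennreal S"]
            by (simp add: ennreal_divide_times ennreal_mult_divide_eq ennreal_times_divide)
          also have "\<dots> = tail_integral (\<lambda>u. K * s u) \<alpha>"
            unfolding tail_integral_def
            by (subst nn_integral_cmult[symmetric]) (auto simp: ennreal_mult real(1) ac_simps)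
          finally show "tail_integral w \<alpha> \<le> tail_integral (\<lambda>u. K * s u) \<alpha>" .
        qed auto
        also have "\<dots> = ennreal K * tail_integral (\<lambda>u. s u * g u powr 1) 0"
          unfolding tail_integral_def
          by (subst nn_integral_cmult[symmetric])
            (auto simp: ennreal_mult real(1) ac_simps profile_nonneg[OF g] powr_one)
        also have "tail_integral (\<lambda>u. s u * g u powr 1) 0 = modular M \<sigma> 1 f"
          by (rule modular_profile[OF _ V(1) g, symmetric]) (use V(2) f(2) in auto)
        also have "ennreal K * modular M \<sigma> 1 f \<le> ennreal K * 1"
          using f(3) by (intro mult_left_mono) auto
        finally show "(\<integral>\<^sup>+\<omega>. ennreal (W \<omega> * f \<omega>) \<partial>M) \<le> sigma_star_norm M \<sigma> \<infinity> Z" unfolding real(2) by simp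
      qed
    qed simp
  qed
qed

lemma quantile_cong_AE:
  assumes [measurable]: "W \<in> borel_measurable M" "W' \<in> borel_measurable M" and eq: "AE \<omega> in M. W \<omega> = W' \<omega>"
  shows "quantile M W = quantile M W'"
proof -
  have "measure M {\<omega>\<in>space M. W \<omega> \<le> t} = measure M {\<omega>\<in>space M. W' \<omega> \<le> t}" for t
    by (rule measure_eq_AE) (use eq in \<open>auto elim: eventually_mono\<close>)
  then show ?thesis unfolding quantile_def by simp
qed

text \<open>Measurability of the distortion is known only through \<open>s\<close>, inside the open
  interval. A uniform variable takes values in the closed interval, so the two endpoint values have
  to be patched in by hand.\<close>

lemma sigma_comp_measurable:
  assumes V: "V \<in> uniform_rvs M" shows "(\<lambda>\<omega>. \<sigma> (V \<omega>)) \<in> borel_measurable M"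
proof -
  note [measurable] = uniform_measurable[OF V]
  have "(\<lambda>\<omega>. if V \<omega> = 0 then \<sigma> 0 else if V \<omega> = 1 then \<sigma> 1 else s (V \<omega>)) \<in> borel_measurable M" by measurable
  then show ?thesis
  proof (rule measurable_cong[THEN iffD1, rotated])
    fix \<omega> assume "\<omega> \<in> space M"
    then have "V \<omega> \<in> {0..1}" using V by (simp add: uniform_rvs_def)
    then show "(if V \<omega> = 0 then \<sigma> 0 else if V \<omega> = 1 then \<sigma> 1 else s (V \<omega>)) = \<sigma> (V \<omega>)"
      by (auto simp: clip_def)
  qed
qed

text \<open>The inequality between the values at risk says that the tails of \<open>w\<close> are
  dominated by those of \<open>w'\<close>, so any pairing with \<open>w\<close> is bounded by one
  with \<open>w'\<close>. Evaluated at \<open>U'\<close>, the latter is an integral with weight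
  \<open>s (V \<omega>)\<close> of \<open>norm (Z' \<omega>)\<close> times a rearrangement of the
  test function, to which Hoelder's inequality with this weight applies.\<close>

lemma dual_sup_le_sigma_norm:
  fixes Z' :: "'w \<Rightarrow> 'k::{real_normed_field, euclidean_space}"
  assumes pq: "1 < p" "1 < q" "1 / p + 1 / q = 1"
    and [measurable]: "W \<in> borel_measurable M" "Z' \<in> borel_measurable M"
    and W0: "\<And>\<omega>. 0 \<le> W \<omega>" and V: "V \<in> uniform_rvs M"
    and dom: "\<And>\<alpha>. \<alpha> \<in> {0..<1} \<Longrightarrow> AVaR M \<alpha> W \<le> AVaR M \<alpha> (\<lambda>\<omega>. \<sigma> (V \<omega>) * norm (Z' \<omega>))"
  shows "dual_sup p W \<le> sigma_norm M \<sigma> q Z'"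
proof -
  note [measurable] = uniform_measurable[OF V]
  define w where "w = clip (quantile M W)"
  have w: "profile w" unfolding w_def by (rule profile_quantile) (auto simp: W0)
  note [measurable] = profile_measurable[OF w]
  obtain U where U: "U \<in> uniform_rvs M" "AE \<omega> in M. W \<omega> = w (U \<omega>)"
    unfolding w_def by (rule profile_rep[of W]) (auto simp: W0)
  define W' where "W' \<omega> = s (V \<omega>) * norm (Z' \<omega>)" for \<omega>
  have [measurable]: "W' \<in> borel_measurable M" unfolding W'_def by measurable
  define w' where "w' = clip (quantile M W')"
  have w': "profile w'" unfolding w'_def by (rule profile_quantile) (auto simp: W'_def)
  note [measurable] = profile_measurable[OF w']
  obtain U' where U': "U' \<in> uniform_rvs M" "AE \<omega> in M. W' \<omega> = w' (U' \<omega>)"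
    unfolding w'_def by (rule profile_rep[of W']) (auto simp: W'_def)
  note [measurable] = uniform_measurable[OF U'(1)]
  have Wq: "quantile M (\<lambda>\<omega>. \<sigma> (V \<omega>) * norm (Z' \<omega>)) = quantile M W'"
    using sigma_comp_measurable[OF V] AE_s[OF V]
    by (intro quantile_cong_AE) (auto simp: W'_def elim: eventually_mono)
  have tails: "tail_integral w \<alpha> \<le> tail_integral w' \<alpha>" if \<alpha>: "0 \<le> \<alpha>" "\<alpha> < 1" for \<alpha>
  proof -
    have "tail_integral w \<alpha> / ennreal (1 - \<alpha>) \<le> tail_integral w' \<alpha> / ennreal (1 - \<alpha>)"
      using dom[of \<alpha>] \<alpha> unfolding AVaR_def Wq w_def w'_def by (simp add: tail_integral_clip)
    then have "tail_integral w \<alpha> / ennreal (1 - \<alpha>) * ennreal (1 - \<alpha>) \<le> tail_integral w' \<alpha> / ennreal (1 - \<alpha>) * ennreal (1 - \<alpha>)"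
      by (rule mult_right_mono) simp
    then show ?thesis using \<alpha> by (simp add: ennreal_divide_times ennreal_mult_divide_eq ennreal_times_divide)
  qed
  have main: "dual_sup p W \<le> ennreal c" if c: "0 < c" "modular M \<sigma> q Z' \<le> ennreal (c powr q)" for c
    unfolding dual_sup_def
  proof (rule SUP_least, safe)
    fix f :: "'w \<Rightarrow> real" assume f: "simple_function M f" "\<forall>\<omega>. 0 \<le> f \<omega>" "modular M \<sigma> p f \<le> 1"
    have [measurable]: "f \<in> borel_measurable M" using f(1) by (rule borel_measurable_simple_function)
    define g where "g = clip (quantile M f)"
    have g: "profile g" unfolding g_def by (rule profile_quantile) (auto simp: f)
    note [measurable] = profile_measurable[OF g]
    have g0: "0 \<le> g u" for u by (rule profile_nonneg[OF g])
    obtain Vf where Vf: "Vf \<in> uniform_rvs M" "AE \<omega> in M. f \<omega> = g (Vf \<omega>)"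
      unfolding g_def by (rule profile_rep[of f]) (auto simp: f)
    have gp: "profile (\<lambda>u. g u powr p)" using pq by (intro profile_powr[OF _ g]) auto
    have 1: "(\<integral>\<^sup>+\<omega>. ennreal (s (V \<omega>) * g (U' \<omega>) powr p) \<partial>M) \<le> 1"
    proof -
      have "(\<integral>\<^sup>+\<omega>. ennreal (s (V \<omega>) * g (U' \<omega>) powr p) \<partial>M) \<le> tail_integral (\<lambda>u. s u * g u powr p) 0"
        by (rule Hardy_Littlewood_uniform[OF U'(1) V gp profile_s])
      also have "\<dots> = modular M \<sigma> p f"
        by (rule modular_profile[OF _ Vf(1) g, symmetric]) (use pq Vf(2) f(2) in auto)
      finally show ?thesis using f(3) by simp
    qed
    have 2: "(\<integral>\<^sup>+\<omega>. ennreal (s (V \<omega>) * norm (Z' \<omega>) powr q) \<partial>M) \<le> ennreal (c powr q)"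
      using c(2) SUP_upper[OF V, of "\<lambda>V. \<integral>\<^sup>+\<omega>. ennreal (s (V \<omega>) * norm (Z' \<omega>) powr q) \<partial>M"]
      unfolding modular_s by (rule order.trans[rotated])
    have "(\<integral>\<^sup>+\<omega>. ennreal (W \<omega> * f \<omega>) \<partial>M) = (\<integral>\<^sup>+\<omega>. ennreal (w (U \<omega>) * g (Vf \<omega>)) \<partial>M)"
      using U(2) Vf(2) by (intro nn_integral_cong_AE, eventually_elim) simp
    also have "\<dots> \<le> tail_integral (\<lambda>u. w u * g u) 0" by (rule Hardy_Littlewood_uniform[OF Vf(1) U(1) g w])
    also have "\<dots> \<le> tail_integral (\<lambda>u. w' u * g u) 0" by (rule tail_dominance[OF _ _ g tails]) auto
    also have "\<dots> = (\<integral>\<^sup>+\<omega>. ennreal (w' (U' \<omega>) * g (U' \<omega>)) \<partial>M)"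
      using uniform_tail_0[OF U'(1) profile_mult[OF w' g]] by simp
    \<comment> \<open>Young's inequality for \<open>g\<close> and \<open>norm Z' / c\<close>,
      multiplied by \<open>c\<close> and the weight: the two integrals are at most 1 and
      \<open>c powr q\<close>, so the total is \<open>c / p + c / q = c\<close>.\<close>
    also have "\<dots> \<le> (\<integral>\<^sup>+\<omega>. ennreal (c / p) * ennreal (s (V \<omega>) * g (U' \<omega>) powr p) +
        ennreal (c / q / c powr q) * ennreal (s (V \<omega>) * norm (Z' \<omega>) powr q) \<partial>M)"
    proof (rule nn_integral_mono_AE)
      show "AE \<omega> in M. ennreal (w' (U' \<omega>) * g (U' \<omega>)) \<le> ennreal (c / p) * ennreal (s (V \<omega>) * g (U' \<omega>) powr p) +
          ennreal (c / q / c powr q) * ennreal (s (V \<omega>) * norm (Z' \<omega>) powr q)"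
        using U'(2)
      proof eventually_elim
        case (elim \<omega>)
        have "g (U' \<omega>) * (norm (Z' \<omega>) / c) \<le> g (U' \<omega>) powr p / p + (norm (Z' \<omega>) / c) powr q / q"
          by (rule Youngs_inequality) (use pq c g0 in auto)
        also have "(norm (Z' \<omega>) / c) powr q = norm (Z' \<omega>) powr q / c powr q"
          using c by (simp add: powr_divide)
        finally have "s (V \<omega>) * c * (g (U' \<omega>) * (norm (Z' \<omega>) / c)) \<le> s (V \<omega>) * c * (g (U' \<omega>) powr p / p + norm (Z' \<omega>) powr q / c powr q / q)"
          using c by (intro mult_left_mono) auto
        then have "w' (U' \<omega>) * g (U' \<omega>) \<le> c / p * (s (V \<omega>) * g (U' \<omega>) powr p) + c / q / c powr q * (s (V \<omega>) * norm (Z' \<omega>) powr q)"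
          using c unfolding elim[symmetric] W'_def by (simp add: field_simps)
        then have "ennreal (w' (U' \<omega>) * g (U' \<omega>)) \<le> ennreal (c / p * (s (V \<omega>) * g (U' \<omega>) powr p) + c / q / c powr q * (s (V \<omega>) * norm (Z' \<omega>) powr q))"
          by (rule ennreal_leI)
        also have "\<dots> = ennreal (c / p * (s (V \<omega>) * g (U' \<omega>) powr p)) + ennreal (c / q / c powr q * (s (V \<omega>) * norm (Z' \<omega>) powr q))"
          using c pq by (intro ennreal_plus) auto
        also have "\<dots> = ennreal (c / p) * ennreal (s (V \<omega>) * g (U' \<omega>) powr p) +
          ennreal (c / q / c powr q) * ennreal (s (V \<omega>) * norm (Z' \<omega>) powr q)"
          using c pq by (intro arg_cong2[where f = "(+)"] ennreal_mult) auto
        finally show ?case .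
      qed
    qed
    also have "\<dots> = ennreal (c / p) * (\<integral>\<^sup>+\<omega>. ennreal (s (V \<omega>) * g (U' \<omega>) powr p) \<partial>M) +
        ennreal (c / q / c powr q) * (\<integral>\<^sup>+\<omega>. ennreal (s (V \<omega>) * norm (Z' \<omega>) powr q) \<partial>M)"
      by (simp add: nn_integral_add nn_integral_cmult)
    also have "\<dots> \<le> ennreal (c / p) * 1 + ennreal (c / q / c powr q) * ennreal (c powr q)"
      by (intro add_mono mult_left_mono 1 2) auto
    also have "\<dots> = ennreal (c / p + c / q)"
      using c pq by (simp flip: ennreal_mult ennreal_plus)
    also have "c / p + c / q = c" using arg_cong[OF pq(3), of "\<lambda>x. c * x"] by (simp add: algebra_simps)
    finally show "(\<integral>\<^sup>+\<omega>. ennreal (W \<omega> * f \<omega>) \<partial>M) \<le> ennreal c" .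
  qed
  show ?thesis
  proof (cases "sigma_norm M \<sigma> q Z'")
    case (real n)
    \<comment> \<open>\<open>main\<close> requires a positive constant while the norm
      \<open>n\<close> may be 0, hence the additional \<open>e\<close>.\<close>
    have "dual_sup p W \<le> ennreal n + ennreal e" if "0 < e" for e
    proof -
      have "modular M \<sigma> q Z' \<le> ennreal ((n + e) powr q)"
      proof (rule ennroot_le_imp)
        show "ennroot q (modular M \<sigma> q Z') \<le> ennreal (n + e)"
          using real that unfolding sigma_norm_modular by (simp add: ennreal_leI)
      qed (use pq real(1) that in auto)
      then have "dual_sup p W \<le> ennreal (n + e)" by (intro main) (use real(1) that in auto)
      then show ?thesis using real(1) that by (simp add: ennreal_plus)
    qed
    then show ?thesis unfolding real(2) by (rule ennreal_le_epsilon)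
  qed simp
qed

end

section \<open>Level points and step functions\<close>

definition seg :: "(real \<Rightarrow> real) \<Rightarrow> real \<Rightarrow> real \<Rightarrow> ennreal" where
  "seg f a b = (\<integral>\<^sup>+u\<in>{a<..b}. ennreal (f u) \<partial>lborel)"

lemma seg_split:
  assumes [measurable]: "f \<in> borel_measurable borel" and "a \<le> b" "b \<le> c"
  shows "seg f a c = seg f a b + seg f b c"
proof -
  have "seg f a c = (\<integral>\<^sup>+u. ennreal (f u) * indicator {a<..b} u + ennreal (f u) * indicator {b<..c} u \<partial>lborel)"
    unfolding seg_def by (rule nn_integral_cong) (use assms(2,3) in \<open>auto simp: indicator_def\<close>)
  then show ?thesis unfolding seg_def by (simp add: nn_integral_add)
qed

lemma seg_cmult: "f \<in> borel_measurable borel \<Longrightarrow> 0 \<le> c \<Longrightarrow> seg (\<lambda>u. c * f u) a b = ennreal c * seg f a b"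
  unfolding seg_def by (subst nn_integral_cmult[symmetric]) (auto simp: ennreal_mult' ac_simps)

lemma seg_mono: "(\<And>u. a < u \<Longrightarrow> u \<le> b \<Longrightarrow> f u \<le> g u) \<Longrightarrow> seg f a b \<le> seg g a b"
  unfolding seg_def by (intro nn_integral_mono) (auto simp: indicator_def intro!: ennreal_leI)

lemma seg_cong: "(\<And>u. a < u \<Longrightarrow> u \<le> b \<Longrightarrow> f u = g u) \<Longrightarrow> seg f a b = seg g a b"
  by (intro antisym seg_mono) auto

lemma seg_1: "seg f a 1 = tail_integral f a"
  unfolding seg_def tail_integral_def using AE_lborel_singleton[of 1]
  by (intro nn_integral_cong_AE, eventually_elim) (auto simp: indicator_def)

lemma tail_integral_seg:
  "f \<in> borel_measurable borel \<Longrightarrow> a \<le> b \<Longrightarrow> b \<le> 1 \<Longrightarrow> tail_integral f a = seg f a b + tail_integral f b"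
  unfolding seg_1[symmetric] by (rule seg_split)

lemma tail_integral_decreasing: "a \<le> b \<Longrightarrow> tail_integral f b \<le> tail_integral f a"
  unfolding tail_integral_def by (intro nn_integral_mono) (auto simp: indicator_def)

lemma tail_integral_continuous:
  assumes f: "profile f" and fin: "tail_integral f 0 < \<infinity>"
  shows "continuous_on {0..1} (\<lambda>\<alpha>. enn2real (tail_integral f \<alpha>))"
proof -
  note [measurable] = profile_measurable[OF f]
  have int: "integrable lborel f"
  proof (rule integrableI_nonneg)
    have "(\<integral>\<^sup>+u. ennreal (f u) \<partial>lborel) = tail_integral f 0"
      unfolding tail_integral_def using f by (intro nn_integral_cong) (auto simp: profile_def indicator_def)
    then show "(\<integral>\<^sup>+u. ennreal (f u) \<partial>lborel) < \<infinity>" using fin by simp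
  qed (auto simp: profile_nonneg[OF f])
  have eq: "enn2real (tail_integral f \<alpha>) = (\<integral>u. f u * indicator {\<alpha><..<1} u \<partial>lborel)" for \<alpha>
    unfolding tail_integral_def
    by (subst integral_eq_nn_integral)
      (auto simp: profile_nonneg[OF f] indicator_def intro!: arg_cong[where f = enn2real] nn_integral_cong)
  show ?thesis unfolding eq
  proof (rule continuous_on_sequentiallyI)
    fix x :: "nat \<Rightarrow> real" and a assume x: "x \<longlonglongrightarrow> a"
    show "(\<lambda>n. \<integral>u. f u * indicator {x n<..<1} u \<partial>lborel) \<longlonglongrightarrow> (\<integral>u. f u * indicator {a<..<1} u \<partial>lborel)"
    proof (rule integral_dominated_convergence[where w = f])
      show "AE u in lborel. (\<lambda>n. f u * indicator {x n<..<1} u) \<longlonglongrightarrow> f u * indicator {a<..<1} u"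
        using AE_lborel_singleton[of a]
      proof eventually_elim
        case (elim u)
        have "\<forall>\<^sub>F n in sequentially. indicator {x n<..<1} u = (indicator {a<..<1} u :: real)"
        proof (cases "u < a")
          case True
          show ?thesis using order_tendstoD(1)[OF x True] by eventually_elim (use True in \<open>auto simp: indicator_def\<close>)
        next
          case False
          then have "a < u" using elim by auto
          show ?thesis using order_tendstoD(2)[OF x \<open>a < u\<close>] by eventually_elim (use \<open>a < u\<close> in \<open>auto simp: indicator_def\<close>)
        qed
        then show ?case by (intro tendsto_mult_left tendsto_eventually)
      qed
    qed (auto simp: int profile_nonneg[OF f] indicator_def)
  qed
qed

context distorted_prob
begin

text \<open>By \<open>uniform_tail_le\<close> the event that \<open>U\<close> exceeds
  \<open>\<alpha>\<close> collects from \<open>W\<close> at most the upper tail of its quantile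
  function. This is how an explicitly built \<open>k\<close> is compared with an average value at
  risk.\<close>

lemma tail_quantile_ge:
  assumes U: "U \<in> uniform_rvs M" and k: "profile k" and [measurable]: "W \<in> borel_measurable M"
    and eq: "AE \<omega> in M. W \<omega> = k (U \<omega>)" and \<alpha>: "0 \<le> \<alpha>" "\<alpha> < 1"
  shows "tail_integral k \<alpha> \<le> tail_integral (quantile M W) \<alpha>"
proof -
  have W0: "AE \<omega> in M. 0 \<le> W \<omega>" using eq by eventually_elim (simp add: profile_nonneg[OF k])
  let ?w = "clip (quantile M W)"
  have w: "profile ?w" by (rule profile_quantile) (auto simp: W0)
  obtain V where V: "V \<in> uniform_rvs M" "AE \<omega> in M. W \<omega> = ?w (V \<omega>)"
    by (rule profile_rep[of W]) (auto simp: W0)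
  have "tail_integral k \<alpha> = (\<integral>\<^sup>+\<omega>. ennreal (k (U \<omega>)) * indicator {\<alpha><..} (U \<omega>) \<partial>M)"
    by (rule uniform_tail[OF U k \<alpha>(1), symmetric])
  also have "\<dots> = (\<integral>\<^sup>+\<omega>. ennreal (?w (V \<omega>)) * indicator {\<alpha><..} (U \<omega>) \<partial>M)"
    using eq V(2) by (intro nn_integral_cong_AE, eventually_elim) simp
  also have "\<dots> \<le> tail_integral ?w \<alpha>" by (rule uniform_tail_le[OF U V(1) w \<alpha>])
  finally show ?thesis using \<alpha> by (simp add: tail_integral_clip)
qed

text \<open>Each \<open>\<tau> (Suc i)\<close> maximises \<open>a \<mapsto> tail w a - l (Suc i) * tail s a\<close> over \<open>[\<tau> i, 1]\<close>.\<close>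

lemma level_points:
  assumes w: "profile w" and fin: "tail_integral w 0 < \<infinity>" and l: "\<And>i. 0 \<le> l i"
  obtains \<tau> :: "nat \<Rightarrow> real" where "\<And>i. 0 \<le> \<tau> i" "\<And>i. \<tau> i \<le> 1" "\<And>i. \<tau> i \<le> \<tau> (Suc i)"
    "\<And>a. 0 \<le> a \<Longrightarrow> a \<le> \<tau> 0 \<Longrightarrow> seg w a (\<tau> 0) \<le> ennreal (l 0) * seg s a (\<tau> 0)"
    "\<And>i a. \<tau> i \<le> a \<Longrightarrow> a \<le> \<tau> (Suc i) \<Longrightarrow> seg w a (\<tau> (Suc i)) \<le> ennreal (l (Suc i)) * seg s a (\<tau> (Suc i))"
    "\<And>i b. \<tau> i \<le> b \<Longrightarrow> b \<le> 1 \<Longrightarrow> ennreal (l i) * seg s (\<tau> i) b \<le> seg w (\<tau> i) b"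
proof -
  note [measurable] = profile_measurable[OF w]
  \<comment> \<open>The excess of the tail of \<open>w\<close> over a line of slope \<open>c\<close>
    in the tail of \<open>s\<close>; its maximisers are the contact points of that slope with the
    concave majorant.\<close>
  define D where "D c a = enn2real (tail_integral w a) - c * enn2real (tail_integral s a)" for c a
  have cont: "continuous_on {0..1} (D c)" for c
    unfolding D_def[abs_def] using tail_s_0
    by (intro continuous_intros tail_integral_continuous[OF w fin] tail_integral_continuous[OF profile_s]) simp
  have ex: "\<exists>x\<in>{t..1}. \<forall>y\<in>{t..1}. D c y \<le> D c x" if "0 \<le> t" "t \<le> 1" for c t
    by (rule continuous_attains_sup) (use that in \<open>auto intro: continuous_on_subset[OF cont]\<close>)
  define pick where "pick c t = (SOME x. x \<in> {t..1} \<and> (\<forall>y\<in>{t..1}. D c y \<le> D c x))" for c t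
  have pick: "pick c t \<in> {t..1}" "\<And>y. y \<in> {t..1} \<Longrightarrow> D c y \<le> D c (pick c t)" if "0 \<le> t" "t \<le> 1" for c t
  proof -
    have "pick c t \<in> {t..1} \<and> (\<forall>y\<in>{t..1}. D c y \<le> D c (pick c t))"
      unfolding pick_def by (rule someI_ex) (use ex[OF that] in blast)
    then show "pick c t \<in> {t..1}" "\<And>y. y \<in> {t..1} \<Longrightarrow> D c y \<le> D c (pick c t)" by auto
  qed
  \<comment> \<open>Several maximisers may exist. Starting each search at the previous point makes
    \<open>\<tau>\<close> increasing whichever of them is chosen.\<close>
  define \<tau> where "\<tau> = rec_nat (pick (l 0) 0) (\<lambda>i t. pick (l (Suc i)) t)"
  have t0: "\<tau> 0 = pick (l 0) 0" and tS: "\<tau> (Suc i) = pick (l (Suc i)) (\<tau> i)" for i by (simp_all add: \<tau>_def)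
  have rng: "0 \<le> \<tau> i \<and> \<tau> i \<le> 1" for i
  proof (induction i)
    case 0 show ?case using pick(1)[of 0 "l 0"] by (simp add: t0)
  next
    case (Suc i) then show ?case using pick(1)[of "\<tau> i" "l (Suc i)"] by (auto simp: tS)
  qed
  have inc: "\<tau> i \<le> \<tau> (Suc i)" for i using pick(1)[of "\<tau> i" "l (Suc i)"] rng[of i] by (auto simp: tS)
  have max0: "D (l 0) y \<le> D (l 0) (\<tau> 0)" if "0 \<le> y" "y \<le> 1" for y
    using pick(2)[of 0 y "l 0"] that by (simp add: t0)
  have maxS: "D (l (Suc i)) y \<le> D (l (Suc i)) (\<tau> (Suc i))" if "\<tau> i \<le> y" "y \<le> 1" for y i
    using pick(2)[of "\<tau> i" y "l (Suc i)"] that rng[of i] by (simp add: tS)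
  \<comment> \<open>The first search runs over \<open>[0, 1]\<close> and the later ones over
    \<open>[\<tau> (i - 1), 1]\<close>; both contain everything to the right of
    \<open>\<tau> i\<close>.\<close>
  have max: "D (l i) y \<le> D (l i) (\<tau> i)" if "\<tau> i \<le> y" "y \<le> 1" for y i
    using max0[of y] maxS[of "i - 1" y] that rng[of i] inc[of "i - 1"] by (cases i) auto
  have real_split: "\<exists>x\<ge>0. seg f a b = ennreal x \<and> enn2real (tail_integral f a) = x + enn2real (tail_integral f b)"
    if "0 \<le> a" "a \<le> b" "b \<le> 1" "profile f" "tail_integral f 0 < \<infinity>" for f a b
  proof -
    have split: "tail_integral f a = seg f a b + tail_integral f b"
      by (rule tail_integral_seg) (use that profile_measurable in auto)
    moreover have "tail_integral f a < \<infinity>" using tail_integral_decreasing[OF that(1), of f] that(5) by simp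
    ultimately obtain x y where "seg f a b = ennreal x" "tail_integral f b = ennreal y" "0 \<le> x" "0 \<le> y"
      by (cases "seg f a b"; cases "tail_integral f b") auto
    then show ?thesis using split by (auto simp flip: ennreal_plus)
  qed
  have sfin: "tail_integral s 0 < \<infinity>" by (simp add: tail_s_0)
  \<comment> \<open>\<open>D c a \<le> D c b\<close> rearranges to a comparison of the masses
    between \<open>a\<close> and \<open>b\<close>. Thus maximality at the right end bounds
    \<open>w\<close> from above on segments ending there, and maximality at the left end, used in
    \<open>ge\<close>, bounds it from below.\<close>
  have le: "seg w a b \<le> ennreal c * seg s a b" if ab: "0 \<le> a" "a \<le> b" "b \<le> 1" "0 \<le> c" "D c a \<le> D c b" for a b c
  proof -
    obtain x y where "0 \<le> x" "seg w a b = ennreal x" "enn2real (tail_integral w a) = x + enn2real (tail_integral w b)"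
      "0 \<le> y" "seg s a b = ennreal y" "enn2real (tail_integral s a) = y + enn2real (tail_integral s b)"
      using real_split[OF ab(1-3) w fin] real_split[OF ab(1-3) profile_s sfin] by auto
    then show ?thesis using ab(4,5) unfolding D_def by (auto simp: algebra_simps simp flip: ennreal_mult intro!: ennreal_leI)
  qed
  have ge: "ennreal c * seg s a b \<le> seg w a b" if ab: "0 \<le> a" "a \<le> b" "b \<le> 1" "0 \<le> c" "D c b \<le> D c a" for a b c
  proof -
    obtain x y where "0 \<le> x" "seg w a b = ennreal x" "enn2real (tail_integral w a) = x + enn2real (tail_integral w b)"
      "0 \<le> y" "seg s a b = ennreal y" "enn2real (tail_integral s a) = y + enn2real (tail_integral s b)"
      using real_split[OF ab(1-3) w fin] real_split[OF ab(1-3) profile_s sfin] by auto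
    then show ?thesis using ab(4,5) unfolding D_def by (auto simp: algebra_simps simp flip: ennreal_mult intro!: ennreal_leI)
  qed
  show thesis
  proof (rule that[of \<tau>])
    show "seg w a (\<tau> 0) \<le> ennreal (l 0) * seg s a (\<tau> 0)" if "0 \<le> a" "a \<le> \<tau> 0" for a
      using rng[of 0] that l by (intro le max0) auto
    show "seg w a (\<tau> (Suc i)) \<le> ennreal (l (Suc i)) * seg s a (\<tau> (Suc i))" if "\<tau> i \<le> a" "a \<le> \<tau> (Suc i)" for i a
      using rng[of i] rng[of "Suc i"] that l by (intro le maxS) auto
    show "ennreal (l i) * seg s (\<tau> i) b \<le> seg w (\<tau> i) b" if "\<tau> i \<le> b" "b \<le> 1" for i b
      using rng[of i] that l by (intro ge max) auto
  qed (use rng inc in auto)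
qed

end

text \<open>The value is \<open>c i\<close> for the last \<open>i \<le> n\<close> with
  \<open>\<tau> i < u\<close>, and 0 if there is none. The strict inequality matches the half-open
  segments of \<open>seg\<close>.\<close>

primrec stair :: "(nat \<Rightarrow> real) \<Rightarrow> (nat \<Rightarrow> real) \<Rightarrow> nat \<Rightarrow> real \<Rightarrow> real" where
  "stair \<tau> c 0 u = (if \<tau> 0 < u then c 0 else 0)"
| "stair \<tau> c (Suc n) u = (if \<tau> (Suc n) < u then c (Suc n) else stair \<tau> c n u)"

lemma stair_bounds: "(\<And>i. 0 \<le> c i) \<Longrightarrow> incseq c \<Longrightarrow> 0 \<le> stair \<tau> c n u \<and> stair \<tau> c n u \<le> c n"
proof (induction n)
  case (Suc n) then show ?case using incseq_SucD[of c n] by (auto intro: order.trans)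
qed auto

lemma stair_mono_level: "(\<And>i. 0 \<le> c i) \<Longrightarrow> incseq c \<Longrightarrow> stair \<tau> c n u \<le> stair \<tau> c (Suc n) u"
  using stair_bounds[of c \<tau> n u] incseq_SucD[of c n] by auto

lemma stair_mono: "(\<And>i. 0 \<le> c i) \<Longrightarrow> incseq c \<Longrightarrow> u \<le> v \<Longrightarrow> stair \<tau> c n u \<le> stair \<tau> c n v"
proof (induction n)
  case (Suc n) then show ?case using stair_bounds[of c \<tau> n u] incseq_SucD[of c n] by (auto intro: order.trans)
qed auto

lemma stair_measurable [measurable]: "stair \<tau> c n \<in> borel_measurable borel"
proof (induction n)
  case 0 show ?case by (simp add: stair.simps(1)[abs_def])
next
  case (Suc n) note [measurable] = Suc show ?case by (simp add: stair.simps(2)[abs_def])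
qed

lemma stair_comp: "h 0 = 0 \<Longrightarrow> h (stair \<tau> c n u) = stair \<tau> (\<lambda>i. h (c i)) n u"
  by (induction n) auto

text \<open>Points of index above \<open>n\<close> lie to the right of \<open>u\<close> and cannot
  affect the value there. Hence the step functions are eventually constant at every \<open>u\<close>
  that \<open>\<tau>\<close> reaches.\<close>

lemma stair_stable: "incseq \<tau> \<Longrightarrow> u \<le> \<tau> n \<Longrightarrow> n \<le> k \<Longrightarrow> stair \<tau> c k u = stair \<tau> c n u"
proof (induction k)
  case (Suc k)
  show ?case
  proof (cases "n = Suc k")
    case False
    then show ?thesis using Suc incseqD[OF Suc.prems(1,3)] by auto
  qed simp
qed simp

text \<open>Beyond the last point the step function is constant, so that \<open>ge\<close> may be
  multiplied by its value. The induction cuts at the last point \<open>\<tau> (Suc n)\<close>, up to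
  which the shorter step function is in force; this is why the upper end \<open>t\<close> is
  arbitrary.\<close>

lemma stair_integral_ge:
  assumes [measurable]: "w \<in> borel_measurable borel" "z \<in> borel_measurable borel"
    and tau: "\<And>i. 0 \<le> \<tau> i" "\<And>i. \<tau> i \<le> \<tau> (Suc i)" and l: "\<And>i. 0 \<le> l i" and c: "\<And>i. 0 \<le> c i"
    and ge: "\<And>i b. \<tau> i \<le> b \<Longrightarrow> b \<le> 1 \<Longrightarrow> ennreal (l i) * seg z (\<tau> i) b \<le> seg w (\<tau> i) b"
    and t: "\<tau> n \<le> t" "t \<le> 1"
  shows "seg (\<lambda>u. z u * stair \<tau> (\<lambda>i. l i * c i) n u) 0 t \<le> seg (\<lambda>u. w u * stair \<tau> c n u) 0 t"
proof -
  have piece: "seg (\<lambda>u. z u * stair \<tau> (\<lambda>i. l i * c i) n u) (\<tau> n) b \<le> seg (\<lambda>u. w u * stair \<tau> c n u) (\<tau> n) b"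
    if "\<tau> n \<le> b" "b \<le> 1" for b n
  proof -
    have e: "stair \<tau> d n u = d n" if "\<tau> n < u" for d u using that by (cases n) auto
    have "seg (\<lambda>u. z u * stair \<tau> (\<lambda>i. l i * c i) n u) (\<tau> n) b = seg (\<lambda>u. (c n * l n) * z u) (\<tau> n) b"
      by (rule seg_cong) (simp add: e)
    also have "\<dots> = ennreal (c n) * (ennreal (l n) * seg z (\<tau> n) b)"
      using l c by (subst seg_cmult) (auto simp: ennreal_mult mult.assoc)
    also have "\<dots> \<le> ennreal (c n) * seg w (\<tau> n) b" by (intro mult_left_mono ge that) auto
    also have "\<dots> = seg (\<lambda>u. c n * w u) (\<tau> n) b" using c by (subst seg_cmult) auto
    also have "\<dots> = seg (\<lambda>u. w u * stair \<tau> c n u) (\<tau> n) b" by (rule seg_cong) (simp add: e)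
    finally show ?thesis .
  qed
  show ?thesis using t
  proof (induction n arbitrary: t)
    case 0
    have "seg (\<lambda>u. z u * stair \<tau> (\<lambda>i. l i * c i) 0 u) 0 (\<tau> 0) = seg (\<lambda>u. 0) 0 (\<tau> 0)" by (rule seg_cong) simp
    then have z: "seg (\<lambda>u. z u * stair \<tau> (\<lambda>i. l i * c i) 0 u) 0 (\<tau> 0) = 0" by (simp add: seg_def)
    have "seg (\<lambda>u. z u * stair \<tau> (\<lambda>i. l i * c i) 0 u) 0 t = seg (\<lambda>u. z u * stair \<tau> (\<lambda>i. l i * c i) 0 u) (\<tau> 0) t"
      using z by (subst seg_split[of _ 0 "\<tau> 0" t]) (use 0 tau in auto)
    also have "\<dots> \<le> seg (\<lambda>u. w u * stair \<tau> c 0 u) (\<tau> 0) t" by (rule piece[OF 0])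
    also have "\<dots> \<le> seg (\<lambda>u. w u * stair \<tau> c 0 u) 0 t"
      unfolding seg_def using tau(1)[of 0] by (intro nn_integral_mono) (auto simp: indicator_def)
    finally show ?case .
  next
    case (Suc n)
    have e: "seg (\<lambda>u. f u * stair \<tau> d (Suc n) u) 0 (\<tau> (Suc n)) = seg (\<lambda>u. f u * stair \<tau> d n u) 0 (\<tau> (Suc n))" for f d
      by (rule seg_cong) simp
    have sp: "seg (\<lambda>u. f u * stair \<tau> d (Suc n) u) 0 t =
        seg (\<lambda>u. f u * stair \<tau> d n u) 0 (\<tau> (Suc n)) + seg (\<lambda>u. f u * stair \<tau> d (Suc n) u) (\<tau> (Suc n)) t"
      if [measurable]: "f \<in> borel_measurable borel" for f d
      unfolding e[symmetric] by (rule seg_split[OF _ tau(1) Suc.prems(1)]) measurable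
    show ?case unfolding sp[OF assms(1)] sp[OF assms(2)]
      by (intro add_mono piece Suc.IH Suc.prems tau(2)) (use Suc.prems in linarith)
  qed
qed

context distorted_prob
begin

text \<open>Let \<open>I\<close> be the weighted integral of the \<open>q\<close>-th power of the
  step function. Its power of exponent \<open>q - 1\<close> is the extremal test function: its
  modular is again \<open>I\<close>, and its pairing with \<open>W\<close> is at least
  \<open>I\<close> by \<open>ge\<close>. Hence \<open>I \<le> N * I powr (1 / p)\<close>, which
  amounts to \<open>I \<le> N powr q\<close>.\<close>

lemma stair_modular_le:
  assumes pq: "1 < p" "1 < q" "1 / p + 1 / q = 1"
    and [measurable]: "W \<in> borel_measurable M" and W0: "\<And>\<omega>. 0 \<le> W \<omega>"
    and U: "U \<in> uniform_rvs M" "AE \<omega> in M. W \<omega> = w (U \<omega>)" and w: "profile w"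
    and N: "dual_sup p W = ennreal N" "0 \<le> N"
    and tau: "\<And>i. 0 \<le> \<tau> i" "\<And>i. \<tau> i \<le> 1" "\<And>i. \<tau> i \<le> \<tau> (Suc i)" and l: "\<And>i. 0 \<le> l i" "incseq l"
    and ge: "\<And>i b. \<tau> i \<le> b \<Longrightarrow> b \<le> 1 \<Longrightarrow> ennreal (l i) * seg s (\<tau> i) b \<le> seg w (\<tau> i) b"
  shows "tail_integral (\<lambda>u. s u * stair \<tau> l n u powr q) 0 \<le> ennreal (N powr q)"
proof -
  note [measurable] = profile_measurable[OF w] uniform_measurable[OF U(1)]
  \<comment> \<open>Both \<open>l i * c i\<close> and \<open>c i powr p\<close> equal
    \<open>l i powr q\<close>, so the lower bound for the pairing and the modular of the test
    function are the same integral.\<close>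
  define c where "c i = l i powr (q - 1)" for i
  have c0: "0 \<le> c i" for i by (simp add: c_def)
  have cinc: "incseq c" unfolding c_def using l pq by (auto simp: incseq_def intro!: powr_mono2)
  have qp: "(q - 1) * p = q"
    using pq by (simp add: field_simps)
  have lc: "l i * c i = l i powr q" for i
    using l(1)[of i] powr_add[of "l i" 1 "q - 1"] by (cases "l i = 0") (auto simp: c_def)
  have cp: "c i powr p = l i powr q" for i by (simp add: c_def powr_powr qp)
  define g where "g = clip (stair \<tau> c n)"
  have g: "profile g"
    unfolding g_def using stair_bounds[OF c0 cinc] stair_mono[OF c0 cinc]
    by (intro profile_clip) (auto intro: monotone_onI)
  note [measurable] = profile_measurable[OF g]
  define I where "I = tail_integral (\<lambda>u. s u * stair \<tau> l n u powr q) 0"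
  have powq: "stair \<tau> l n u powr q = stair \<tau> (\<lambda>i. l i powr q) n u" for u
    by (rule stair_comp[of "\<lambda>x. x powr q"]) simp
  have mod: "modular M \<sigma> p (\<lambda>\<omega>. g (U \<omega>)) = I"
  proof -
    have "modular M \<sigma> p (\<lambda>\<omega>. g (U \<omega>)) = tail_integral (\<lambda>u. s u * g u powr p) 0"
      by (rule modular_profile[OF _ U(1) g]) (use pq in \<open>auto simp: profile_nonneg[OF g]\<close>)
    also have "\<dots> = I" unfolding I_def powq cp[symmetric]
      unfolding g_def stair_comp[of "\<lambda>x. x powr p" \<tau> c n, simplified, symmetric]
      by (rule tail_integral_cong) (simp add: clip_def)
    finally show ?thesis .
  qed
  \<comment> \<open>Finiteness must be known before a power of \<open>I\<close> is cancelled; it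
    holds because finitely many steps give a bounded function.\<close>
  have "I \<le> modular M \<sigma> p (\<lambda>_. c n)"
    unfolding mod[symmetric] using pq stair_bounds[OF c0 cinc, of \<tau> n] c0[of n]
    by (intro modular_mono) (auto simp: g_def clip_def)
  also have "\<dots> = ennreal (c n powr p) * modular M \<sigma> p (\<lambda>_. 1::real)"
    using c0[of n] by (intro modular_cmult) auto
  also have "\<dots> \<le> ennreal (c n powr p) * 1"
    using pq by (intro mult_left_mono modular_le_1) auto
  finally have "I < \<infinity>" by (simp add: less_top[symmetric] top_unique) (metis ennreal_neq_top top_unique)
  then obtain J where J: "I = ennreal J" "0 \<le> J" by (cases I) auto
  have "I = seg (\<lambda>u. s u * stair \<tau> (\<lambda>i. l i * c i) n u) 0 1"
    unfolding I_def seg_1 powq lc ..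
  also have "\<dots> \<le> seg (\<lambda>u. w u * stair \<tau> c n u) 0 1"
    by (rule stair_integral_ge) (use tau l(1) c0 ge in auto)
  also have "\<dots> = tail_integral (\<lambda>u. w u * g u) 0"
    unfolding seg_1 by (rule tail_integral_cong) (simp add: g_def clip_def)
  also have "\<dots> = (\<integral>\<^sup>+\<omega>. ennreal (W \<omega> * g (U \<omega>)) \<partial>M)"
    unfolding uniform_tail_0[OF U(1) profile_mult[OF w g], symmetric]
    using U(2) by (intro nn_integral_cong_AE, eventually_elim) simp
  finally have le: "I \<le> (\<integral>\<^sup>+\<omega>. ennreal (W \<omega> * g (U \<omega>)) \<partial>M)" .
  have "J \<le> N powr q"
  proof (cases "J = 0")
    case False
    then have Jpos: "0 < J" using J by simp
    have "(\<integral>\<^sup>+\<omega>. ennreal (W \<omega> * g (U \<omega>)) \<partial>M) \<le> ennreal (J powr (1 / p)) * dual_sup p W"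
      using Jpos pq by (intro dual_sup_bound W0 profile_nonneg[OF g]) (auto simp: mod J powr_powr)
    with le have "ennreal J \<le> ennreal (J powr (1 / p)) * ennreal N"
      unfolding J N by (rule order.trans)
    then have "J \<le> J powr (1 / p) * N"
      using N(2) by (simp flip: ennreal_mult add: ennreal_le_iff)
    moreover have "J = J powr (1 / p) * J powr (1 / q)"
      using Jpos pq(3) by (simp flip: powr_add)
    ultimately have "J powr (1 / p) * J powr (1 / q) \<le> J powr (1 / p) * N" by linarith
    then have "J powr (1 / q) \<le> N" using Jpos by simp
    then have "(J powr (1 / q)) powr q \<le> N powr q" using pq by (intro powr_mono2) auto
    then show ?thesis using Jpos pq by (simp add: powr_powr)
  qed simp
  then show ?thesis unfolding I_def[symmetric] J by (rule ennreal_leI)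
qed

text \<open>Two step functions on the same points are involved: \<open>V\<close>, with value
  \<open>l n\<close> right of \<open>\<tau> n\<close>, obeys the norm bound, while dominating the
  tails of \<open>w\<close> takes the next level there. Geometric levels make the larger function
  \<open>1 + e\<close> times the smaller one. Since such levels cannot start at 0, the part below
  the first level costs another \<open>e\<close>.\<close>

lemma sigma_star_norm_le_dual_sup_eps:
  fixes Z :: "'w \<Rightarrow> 'k::{real_normed_field, euclidean_space}"
  assumes pq: "1 < p" "1 < q" "1 / p + 1 / q = 1"
    and [measurable]: "Z \<in> borel_measurable M"
    and N: "dual_sup p (\<lambda>\<omega>. norm (Z \<omega>)) = ennreal N" "0 \<le> N" and e: "0 < e"
  shows "sigma_star_norm M \<sigma> (ennreal q) Z \<le> ennreal ((e powr q + (1 + e) powr q * N powr q) powr (1 / q))"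
proof -
  define W where "W = (\<lambda>\<omega>. norm (Z \<omega>))"
  have [measurable]: "W \<in> borel_measurable M" unfolding W_def by measurable
  have W0: "0 \<le> W \<omega>" for \<omega> by (simp add: W_def)
  define w where "w = clip (quantile M W)"
  have w: "profile w" unfolding w_def by (rule profile_quantile) (auto simp: W0)
  note [measurable] = profile_measurable[OF w]
  obtain U where U: "U \<in> uniform_rvs M" "AE \<omega> in M. W \<omega> = w (U \<omega>)"
    unfolding w_def by (rule profile_rep[of W]) (auto simp: W0)
  note [measurable] = uniform_measurable[OF U(1)]
  have fin: "tail_integral w 0 < \<infinity>"
  proof -
    have "tail_integral w 0 = (\<integral>\<^sup>+\<omega>. ennreal (W \<omega>) \<partial>M)"
      unfolding uniform_tail_0[OF U(1) w, symmetric]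
      using U(2) by (intro nn_integral_cong_AE, eventually_elim) simp
    also have "\<dots> \<le> dual_sup p W" using pq by (intro nn_integral_le_dual_sup) auto
    finally show ?thesis using N unfolding W_def by (auto simp: less_top[symmetric] top_unique)
  qed
  define l where "l i = e * (1 + e) ^ i" for i :: nat
  have l0: "0 \<le> l i" for i using e by (simp add: l_def)
  have lS: "l (Suc i) = (1 + e) * l i" for i by (simp add: l_def)
  have linc: "incseq l" by (rule incseq_SucI) (use l0 e in \<open>simp add: lS algebra_simps\<close>)
  obtain \<tau> :: "nat \<Rightarrow> real" where tau: "\<And>i. 0 \<le> \<tau> i" "\<And>i. \<tau> i \<le> 1" "\<And>i. \<tau> i \<le> \<tau> (Suc i)"
    and le0: "\<And>a. 0 \<le> a \<Longrightarrow> a \<le> \<tau> 0 \<Longrightarrow> seg w a (\<tau> 0) \<le> ennreal (l 0) * seg s a (\<tau> 0)"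
    and leS: "\<And>i a. \<tau> i \<le> a \<Longrightarrow> a \<le> \<tau> (Suc i) \<Longrightarrow> seg w a (\<tau> (Suc i)) \<le> ennreal (l (Suc i)) * seg s a (\<tau> (Suc i))"
    and ge: "\<And>i b. \<tau> i \<le> b \<Longrightarrow> b \<le> 1 \<Longrightarrow> ennreal (l i) * seg s (\<tau> i) b \<le> seg w (\<tau> i) b"
    by (rule level_points[OF w fin, of l, OF l0]) blast
  have tinc: "incseq \<tau>" by (rule incseq_SucI) (rule tau(3))
  \<comment> \<open>\<open>ge\<close> with upper end 1 and \<open>tail_s_ge\<close> give
    \<open>l i * (1 - \<tau> i) \<le> tail_integral w 0\<close>, and the levels are
    unbounded.\<close>
  have lim: "\<tau> \<longlonglongrightarrow> 1"
  proof -
    obtain C where C: "tail_integral w 0 = ennreal C" "0 \<le> C" using fin by (cases "tail_integral w 0") auto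
    have bd: "1 - C / l i \<le> \<tau> i" for i
    proof (cases "\<tau> i < 1")
      case True
      have lpos: "0 < l i" using e by (simp add: l_def)
      have "ennreal (l i * (1 - \<tau> i)) = ennreal (l i) * ennreal (1 - \<tau> i)"
        using lpos tau(2)[of i] by (intro ennreal_mult) auto
      also have "\<dots> \<le> ennreal (l i) * tail_integral s (\<tau> i)"
        by (intro mult_left_mono tail_s_ge tau(1) True) simp
      also have "\<dots> \<le> tail_integral w (\<tau> i)" using ge[of i 1] tau(2) by (simp add: seg_1)
      also have "\<dots> \<le> ennreal C" unfolding C(1)[symmetric] by (rule tail_integral_decreasing[OF tau(1)])
      finally have "l i * (1 - \<tau> i) \<le> C" using C(2) by (simp add: ennreal_le_iff)
      then show ?thesis using lpos by (simp add: field_simps)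
    next
      case False
      then show ?thesis using divide_nonneg_nonneg[OF C(2) l0[of i]] by linarith
    qed
    have "(\<lambda>i. C / e * inverse ((1 + e) ^ i)) \<longlonglongrightarrow> C / e * 0"
      using e by (intro tendsto_mult_left LIMSEQ_inverse_realpow_zero) simp
    then have "(\<lambda>i. 1 - C / l i) \<longlonglongrightarrow> 1 - C / e * 0"
      by (intro tendsto_diff tendsto_const) (simp add: l_def field_simps)
    then have "(\<lambda>i. 1 - C / l i) \<longlonglongrightarrow> 1" by simp
    then show ?thesis
      by (rule tendsto_sandwich[rotated 2, OF _ tendsto_const]) (auto intro!: always_eventually bd tau)
  qed
  have reach: "\<exists>n. u \<le> \<tau> n" if "u < 1" for u
    using order_tendstoD(1)[OF lim that] by (auto simp: eventually_sequentially intro: less_imp_le)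
  \<comment> \<open>The pointwise limit of the finite step functions; by stability any index
    \<open>n\<close> with \<open>u \<le> \<tau> n\<close> gives the same value.\<close>
  define V where "V u = stair \<tau> l (LEAST n. u \<le> \<tau> n) u" for u
  have V_eq: "V u = stair \<tau> l n u" if "u \<le> \<tau> n" for u n
    unfolding V_def by (rule stair_stable[OF tinc, symmetric]) (use that in \<open>auto intro: LeastI Least_le\<close>)
  have V0: "0 \<le> V u" for u unfolding V_def using stair_bounds[OF l0 linc] by auto
  have V_mono: "V u \<le> V v" if uv: "u \<le> v" "v < 1" for u v
  proof -
    obtain n where "v \<le> \<tau> n" using reach uv by blast
    then show ?thesis using V_eq[of v n] V_eq[of u n] uv stair_mono[OF l0 linc uv(1)] by simp
  qed
  have V_ge: "l n \<le> V u" if u: "\<tau> n < u" "u < 1" for u n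
  proof -
    obtain m where m: "u \<le> \<tau> m" using reach u by blast
    then have "n \<le> m" using u tinc by (metis incseqD linorder_not_le nle_le order.strict_trans2)
    have "l n = stair \<tau> l n u" using u by (cases n) auto
    also have "\<dots> \<le> stair \<tau> l m u"
      by (rule lift_Suc_mono_le[where f = "\<lambda>n. stair \<tau> l n u"])
        (use stair_mono_level[OF l0 linc] \<open>n \<le> m\<close> in auto)
    finally show ?thesis using V_eq[OF m] by simp
  qed
  \<comment> \<open>The factor \<open>1 + e\<close> lifts \<open>l n\<close> to
    \<open>l (Suc n)\<close>, the level that bounds \<open>w\<close> on segments ending at
    \<open>\<tau> (Suc n)\<close>. The maximum with \<open>e = l 0\<close> covers the stretch left
    of \<open>\<tau> 0\<close>, where \<open>V\<close> is 0.\<close>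
  define v where "v u = clip (\<lambda>u. max e ((1 + e) * V u)) u" for u
  have v: "profile v" unfolding v_def[abs_def]
  proof (rule profile_clip)
    show "mono_on {0<..<1} (\<lambda>u. max e ((1 + e) * V u))"
      using V_mono e by (intro monotone_onI max.mono mult_left_mono) auto
  qed (use e in auto)
  note [measurable] = profile_measurable[OF v]
  have sv: "profile (\<lambda>u. s u * v u)" by (rule profile_mult[OF profile_s v])
  note [measurable] = profile_measurable[OF sv]
  have v_ge: "l (Suc n) \<le> v u" if "\<tau> n < u" "u < 1" for n u
    using V_ge[OF that] that tau(1)[of n] e by (simp add: lS v_def clip_def max.coboundedI2)
  have seg_le: "seg w a (\<tau> n) \<le> seg (\<lambda>u. s u * v u) a (\<tau> n)" if "0 \<le> a" "a \<le> \<tau> n" for a n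
    using that
  proof (induction n)
    case 0
    have "seg w a (\<tau> 0) \<le> seg (\<lambda>u. l 0 * s u) a (\<tau> 0)" using le0[OF 0] l0 by (simp add: seg_cmult)
    also have "\<dots> \<le> seg (\<lambda>u. s u * v u) a (\<tau> 0)"
    proof (rule seg_mono)
      fix u assume u: "a < u" "u \<le> \<tau> 0"
      show "l 0 * s u \<le> s u * v u"
      proof (cases "u < 1")
        case True
        then have "l 0 \<le> v u" using u 0 by (simp add: l_def v_def clip_def)
        then show ?thesis using mult_right_mono[OF _ s_nonneg] by (metis mult.commute)
      qed (auto simp: clip_def)
    qed
    finally show ?case .
  next
    case (Suc n)
    have top: "seg w b (\<tau> (Suc n)) \<le> seg (\<lambda>u. s u * v u) b (\<tau> (Suc n))" if b: "\<tau> n \<le> b" "b \<le> \<tau> (Suc n)" for b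
    proof -
      have "seg w b (\<tau> (Suc n)) \<le> seg (\<lambda>u. l (Suc n) * s u) b (\<tau> (Suc n))" using leS[OF b] l0 by (simp add: seg_cmult)
      also have "\<dots> \<le> seg (\<lambda>u. s u * v u) b (\<tau> (Suc n))"
      proof (rule seg_mono)
        fix u assume u: "b < u" "u \<le> \<tau> (Suc n)"
        show "l (Suc n) * s u \<le> s u * v u"
        proof (cases "u < 1")
          case True
          then have "l (Suc n) \<le> v u" using u b by (intro v_ge) auto
          then show ?thesis using mult_right_mono[OF _ s_nonneg] by (metis mult.commute)
        qed (auto simp: clip_def)
      qed
      finally show ?thesis .
    qed
    show ?case
    proof (cases "a \<le> \<tau> n")
      case True
      have "seg w a (\<tau> (Suc n)) = seg w a (\<tau> n) + seg w (\<tau> n) (\<tau> (Suc n))"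
        by (rule seg_split[OF _ True tau(3)]) measurable
      also have "\<dots> \<le> seg (\<lambda>u. s u * v u) a (\<tau> n) + seg (\<lambda>u. s u * v u) (\<tau> n) (\<tau> (Suc n))"
        by (intro add_mono Suc.IH Suc.prems(1) True top) (use tau in auto)
      also have "\<dots> = seg (\<lambda>u. s u * v u) a (\<tau> (Suc n))"
        by (rule seg_split[OF _ True tau(3), symmetric]) measurable
      finally show ?thesis .
    qed (use top Suc.prems in auto)
  qed
  \<comment> \<open>\<open>seg_le\<close> compares segments ending at some \<open>\<tau> i\<close>;
    the remaining tail of \<open>w\<close> beyond \<open>\<tau> i\<close> tends to 0.\<close>
  have tails: "tail_integral w \<alpha> \<le> tail_integral (\<lambda>u. s u * v u) \<alpha>" if \<alpha>: "0 \<le> \<alpha>" "\<alpha> < 1" for \<alpha>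
  proof (rule ennreal_le_epsilon)
    fix d :: real assume d: "0 < d"
    have "(\<lambda>i. enn2real (tail_integral w (\<tau> i))) \<longlonglongrightarrow> enn2real (tail_integral w 1)"
      by (rule continuous_on_tendsto_compose[OF tail_integral_continuous[OF w fin] lim]) (use tau in auto)
    then have "(\<lambda>i. enn2real (tail_integral w (\<tau> i))) \<longlonglongrightarrow> 0" by (simp add: tail_integral_ge1)
    from order_tendstoD(2)[OF this d] order_tendstoD(1)[OF lim \<alpha>(2)]
    have "\<forall>\<^sub>F i in sequentially. enn2real (tail_integral w (\<tau> i)) < d \<and> \<alpha> < \<tau> i" by eventually_elim auto
    then obtain i where i: "enn2real (tail_integral w (\<tau> i)) < d" "\<alpha> < \<tau> i"
      using eventually_happens'[OF sequentially_bot] by blast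
    have "tail_integral w (\<tau> i) < \<infinity>" using tail_integral_decreasing[OF tau(1), of w i] fin by simp
    then have ti: "tail_integral w (\<tau> i) \<le> ennreal d"
      using ennreal_leI[OF less_imp_le[OF i(1)]] by simp
    have "tail_integral w \<alpha> = seg w \<alpha> (\<tau> i) + tail_integral w (\<tau> i)"
      by (rule tail_integral_seg) (use i tau in auto)
    also have "\<dots> \<le> seg (\<lambda>u. s u * v u) \<alpha> (\<tau> i) + ennreal d"
      using i \<alpha> by (intro add_mono seg_le ti) auto
    also have "seg (\<lambda>u. s u * v u) \<alpha> (\<tau> i) \<le> tail_integral (\<lambda>u. s u * v u) \<alpha>"
      by (subst tail_integral_seg[of _ \<alpha> "\<tau> i"]) (use i tau in auto)
    finally show "tail_integral w \<alpha> \<le> tail_integral (\<lambda>u. s u * v u) \<alpha> + ennreal d" by (simp add: add_right_mono)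
  qed
  have norm_Vq: "tail_integral (\<lambda>u. s u * V u powr q) 0 \<le> ennreal (N powr q)"
  proof -
    have "(\<lambda>n. \<integral>\<^sup>+u. ennreal (s u * stair \<tau> l n u powr q) * indicator {0<..<1} u \<partial>lborel) \<longlonglongrightarrow>
      (\<integral>\<^sup>+u. ennreal (s u * V u powr q) * indicator {0<..<1} u \<partial>lborel)"
    proof (rule nn_integral_LIMSEQ)
      show "incseq (\<lambda>n u. ennreal (s u * stair \<tau> l n u powr q) * indicator {0<..<1} u)"
        using stair_bounds[OF l0 linc] stair_mono_level[OF l0 linc] pq
        by (intro incseq_SucI le_funI mult_right_mono ennreal_leI mult_left_mono powr_mono2) (auto simp del: stair.simps)
      show "(\<lambda>n. ennreal (s u * stair \<tau> l n u powr q) * indicator {0<..<1} u) \<longlonglongrightarrow> ennreal (s u * V u powr q) * indicator {0<..<1} u" for u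
      proof (cases "u < 1")
        case True
        then obtain m where "u \<le> \<tau> m" using reach by blast
        then have "stair \<tau> l n u = V u" if "m \<le> n" for n using stair_stable[OF tinc _ that] V_eq by metis
        then show ?thesis by (intro tendsto_eventually eventually_sequentiallyI[of m]) simp
      qed auto
    qed measurable
    moreover have "(\<integral>\<^sup>+u. ennreal (s u * stair \<tau> l n u powr q) * indicator {0<..<1} u \<partial>lborel) \<le> ennreal (N powr q)" for n
      using stair_modular_le[OF pq _ W0 U w _ N(2) tau l0 linc ge, of n] N(1)
      unfolding W_def[symmetric] tail_integral_def by simp
    ultimately show ?thesis unfolding tail_integral_def by (intro LIMSEQ_le_const2) auto
  qed
  define K where "K = e powr q + (1 + e) powr q * N powr q"
  have mod_v: "tail_integral (\<lambda>u. s u * v u powr q) 0 \<le> ennreal K"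
  proof -
    have V_meas: "(\<lambda>u. V u * indicator {0<..<1} u) \<in> borel_measurable borel"
    proof -
      have "profile (clip V)" by (rule profile_clip) (use V0 V_mono in \<open>auto intro!: monotone_onI\<close>)
      also have "clip V = (\<lambda>u. V u * indicator {0<..<1} u)" by (auto simp: clip_def indicator_def)
      finally show ?thesis by (rule profile_measurable)
    qed
    \<comment> \<open>The power of the maximum in \<open>v\<close> is at most the sum of the two
      powers. The indicator next to \<open>V\<close> serves measurability, as \<open>V\<close> is
      monotone only below 1.\<close>
    have pointwise: "ennreal (s u * v u powr q) * indicator {0<..<1} u \<le>
       ennreal (e powr q) * (ennreal (s u) * indicator {0<..<1} u) + ennreal ((1 + e) powr q) * (ennreal (s u * (V u * indicator {0<..<1} u) powr q) * indicator {0<..<1} u)" for u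
    proof (cases "u \<in> {0<..<1}")
      case True
      have "v u powr q \<le> e powr q + (1 + e) powr q * V u powr q"
        using True e V0[of u] by (auto simp: v_def clip_def max_def powr_mult)
      then have "s u * v u powr q \<le> s u * (e powr q + (1 + e) powr q * V u powr q)"
        by (intro mult_left_mono) auto
      then have "ennreal (s u * v u powr q) \<le> ennreal (e powr q * s u + (1 + e) powr q * (s u * V u powr q))"
        by (intro ennreal_leI) (simp add: algebra_simps)
      also have "\<dots> = ennreal (e powr q) * ennreal (s u) + ennreal ((1 + e) powr q) * ennreal (s u * V u powr q)"
        by (subst ennreal_plus) (auto simp: ennreal_mult)
      finally show ?thesis using True by simp
    qed simp
    have "tail_integral (\<lambda>u. s u * v u powr q) 0 \<le> ennreal (e powr q) * tail_integral s 0 +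
      ennreal ((1 + e) powr q) * tail_integral (\<lambda>u. s u * (V u * indicator {0<..<1} u) powr q) 0"
    proof -
      note [measurable] = V_meas
      have "tail_integral (\<lambda>u. s u * v u powr q) 0 \<le> (\<integral>\<^sup>+u. ennreal (e powr q) * (ennreal (s u) * indicator {0<..<1} u) +
          ennreal ((1 + e) powr q) * (ennreal (s u * (V u * indicator {0<..<1} u) powr q) * indicator {0<..<1} u) \<partial>lborel)"
        unfolding tail_integral_def by (intro nn_integral_mono pointwise)
      also have "\<dots> = ennreal (e powr q) * tail_integral s 0 +
          ennreal ((1 + e) powr q) * tail_integral (\<lambda>u. s u * (V u * indicator {0<..<1} u) powr q) 0"
        unfolding tail_integral_def by (subst nn_integral_add; (subst nn_integral_cmult)?; simp?) (simp add: nn_integral_cmult)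
      finally show ?thesis .
    qed
    also have "tail_integral (\<lambda>u. s u * (V u * indicator {0<..<1} u) powr q) 0 = tail_integral (\<lambda>u. s u * V u powr q) 0"
      by (rule tail_integral_cong) simp
    also have "ennreal (e powr q) * tail_integral s 0 + ennreal ((1 + e) powr q) * tail_integral (\<lambda>u. s u * V u powr q) 0
       \<le> ennreal (e powr q) * 1 + ennreal ((1 + e) powr q) * ennreal (N powr q)"
      by (intro add_mono mult_left_mono norm_Vq) (auto simp: tail_s_0)
    also have "\<dots> = ennreal K" unfolding K_def by (simp add: ennreal_plus ennreal_mult)
    finally show ?thesis .
  qed
  \<comment> \<open>The witness runs along the same \<open>U\<close> that rearranges
    \<open>W\<close>, so its product with the distortion is almost surely the profile
    \<open>s u * v u\<close> evaluated at \<open>U\<close>.\<close>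
  define Z' where "Z' \<omega> = (of_real (v (U \<omega>)) :: 'k)" for \<omega>
  have [measurable]: "Z' \<in> borel_measurable M"
    unfolding Z'_def by (rule measurable_compose[of "\<lambda>\<omega>. v (U \<omega>)" M borel of_real]) (auto intro!: borel_measurable_continuous_onI continuous_intros)
  have normZ': "norm (Z' \<omega>) = v (U \<omega>)" for \<omega> by (simp add: Z'_def profile_nonneg[OF v])
  have "sigma_star_norm M \<sigma> (ennreal q) Z \<le> sigma_norm M \<sigma> q Z'"
  proof -
    have "AVaR M \<alpha> (\<lambda>\<omega>. norm (Z \<omega>)) \<le> AVaR M \<alpha> (\<lambda>\<omega>. \<sigma> (U \<omega>) * norm (Z' \<omega>))" if "\<alpha> \<in> {0..<1}" for \<alpha>
    proof -
      have \<alpha>: "0 \<le> \<alpha>" "\<alpha> < 1" using that by auto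
      have "tail_integral (\<lambda>u. s u * v u) \<alpha> \<le> tail_integral (quantile M (\<lambda>\<omega>. \<sigma> (U \<omega>) * norm (Z' \<omega>))) \<alpha>"
      proof (rule tail_quantile_ge[OF U(1) sv _ _ \<alpha>])
        show "AE \<omega> in M. \<sigma> (U \<omega>) * norm (Z' \<omega>) = s (U \<omega>) * v (U \<omega>)"
          using AE_s[OF U(1)] by eventually_elim (simp add: normZ')
      qed (use sigma_comp_measurable[OF U(1)] in measurable)
      with tails[OF \<alpha>] have "tail_integral (quantile M W) \<alpha> \<le> tail_integral (quantile M (\<lambda>\<omega>. \<sigma> (U \<omega>) * norm (Z' \<omega>))) \<alpha>"
        unfolding w_def tail_integral_clip[OF \<alpha>(1)] by (rule order.trans)
      then show ?thesis unfolding AVaR_def W_def by (rule divide_right_mono_ennreal)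
    qed
    moreover have "Z' \<in> borel_measurable M" by measurable
    ultimately show ?thesis
      unfolding sigma_star_norm_def using U(1) pq by (auto intro!: INF_lower2[of Z'] bexI[of _ U])
  qed
  also have "\<dots> \<le> ennroot q (ennreal K)"
    unfolding sigma_norm_modular
  proof (rule ennroot_mono)
    show "modular M \<sigma> q Z' \<le> ennreal K"
      using mod_v pq by (subst modular_profile[OF _ U(1) v]) (auto simp: normZ')
  qed (use pq in simp)
  also have "\<dots> = ennreal (K powr (1 / q))"
    using powr_ge_zero[of e q] by (simp add: ennroot_def K_def del: ennreal_plus)
  finally show ?thesis unfolding K_def .
qed

text \<open>The case \<open>p = 1\<close> forces \<open>q = \<infinity>\<close>. Otherwise
  \<open>q\<close> is a real number above 1, and the upper bound with parameter \<open>e\<close>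
  tends to \<open>N\<close> as \<open>e\<close> decreases to 0.\<close>

theorem sigma_star_norm_eq_dual_sup:
  fixes Z :: "'w \<Rightarrow> 'k::{real_normed_field, euclidean_space}"
  assumes p: "1 \<le> p" and pq: "inverse (ennreal p) + inverse q = 1" and [measurable]: "Z \<in> borel_measurable M"
  shows "sigma_star_norm M \<sigma> q Z = dual_sup p (\<lambda>\<omega>. norm (Z \<omega>))"
proof (cases "p = 1")
  case True
  then have "1 + inverse q = 1 + 0" using pq by simp
  then have "inverse q = 0" by (subst (asm) ennreal_add_left_cancel) simp
  then have "q = \<infinity>" by simp
  then show ?thesis using True sigma_star_norm_infinity[OF assms(3)] by simp
next
  case False
  then have p1: "1 < p" using p by simp
  have inv: "inverse (ennreal p) = ennreal (1 / p)" using p1 by (simp add: inverse_ennreal inverse_eq_divide)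
  have "q \<noteq> \<infinity>" "q \<noteq> 0"
    using pq p1 unfolding inv by (auto simp: ennreal_eq_1)
  then obtain r where r: "q = ennreal r" "0 < r" by (cases q) (auto simp: less_le)
  have "ennreal (1 / p + 1 / r) = 1"
    using pq r p1 unfolding inv by (simp add: inverse_ennreal inverse_eq_divide ennreal_plus)
  then have eq: "1 / p + 1 / r = 1" by simp
  then have "1 / r < 1" using p1 by (smt (verit) zero_less_divide_1_iff)
  then have r1: "1 < r" using r by simp
  show ?thesis
  proof (rule antisym)
    show "sigma_star_norm M \<sigma> q Z \<le> dual_sup p (\<lambda>\<omega>. norm (Z \<omega>))"
    proof (cases "dual_sup p (\<lambda>\<omega>. norm (Z \<omega>))")
      case (real N)
      define h where "h e = (e powr r + (1 + e) powr r * N powr r) powr (1 / r)" for e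
      have "(h \<longlongrightarrow> (0 powr r + (1 + 0) powr r * N powr r) powr (1 / r)) (at_right 0)"
        unfolding h_def using r1 real(1)
        by (intro tendsto_intros tendsto_powr')
          (auto intro!: eventually_at_right_less[THEN eventually_mono] always_eventually tendsto_powr' simp: eventually_at_filter)
      then have "(h \<longlongrightarrow> N) (at_right 0)" using r1 real(1) by (simp add: powr_powr)
      then have "((\<lambda>e. ennreal (h e)) \<longlongrightarrow> ennreal N) (at_right 0)" by (rule tendsto_ennrealI)
      moreover have "\<forall>\<^sub>F e in at_right 0. sigma_star_norm M \<sigma> q Z \<le> ennreal (h e)"
        using eventually_at_right_less[of 0]
      proof eventually_elim
        case (elim e)
        show ?case unfolding r h_def
          by (rule sigma_star_norm_le_dual_sup_eps[OF p1 r1 eq _ real(2,1) elim]) measurable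
      qed
      ultimately show ?thesis unfolding real(2) by (intro tendsto_lowerbound) auto
    qed simp
  next
    show "dual_sup p (\<lambda>\<omega>. norm (Z \<omega>)) \<le> sigma_star_norm M \<sigma> q Z"
      unfolding sigma_star_norm_def using \<open>q \<noteq> \<infinity>\<close> r
      by (auto intro!: INF_greatest dual_sup_le_sigma_norm[OF p1 r1 eq])
  qed
qed

end

section \<open>Strongly measurable functions\<close>

text \<open>Composing the simple approximations pointwise gives the closure properties used below.
  Borel measurability would be a poor substitute: without second countability it may fail for
  sums.\<close>

lemma strongly_measurable_compose2:
  assumes f: "strongly_measurable M S f" and g: "strongly_measurable M T g"
    and into: "\<And>x y. x \<in> S \<Longrightarrow> y \<in> T \<Longrightarrow> h x y \<in> R"
    and cont: "\<And>x y a b. x \<longlonglongrightarrow> a \<Longrightarrow> y \<longlonglongrightarrow> b \<Longrightarrow> (\<lambda>n::nat. h (x n) (y n)) \<longlonglongrightarrow> h a b"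
  shows "strongly_measurable M R (\<lambda>\<omega>. h (f \<omega>) (g \<omega>))"
proof -
  obtain s where s: "\<And>i::nat. simple_into M S (s i)" "\<And>\<omega>. \<omega> \<in> space M \<Longrightarrow> (\<lambda>i. s i \<omega>) \<longlonglongrightarrow> f \<omega>"
    using f unfolding strongly_measurable_def by auto
  obtain t where t: "\<And>i::nat. simple_into M T (t i)" "\<And>\<omega>. \<omega> \<in> space M \<Longrightarrow> (\<lambda>i. t i \<omega>) \<longlonglongrightarrow> g \<omega>"
    using g unfolding strongly_measurable_def by auto
  have "simple_into M R (\<lambda>\<omega>. h (s i \<omega>) (t i \<omega>))" for i
    using s(1)[of i] t(1)[of i] into unfolding simple_into_def by (auto intro: simple_function_compose2)
  moreover have "(\<lambda>\<omega>. h (f \<omega>) (g \<omega>)) \<in> space M \<rightarrow> R"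
    using f g into unfolding strongly_measurable_def by auto
  ultimately show ?thesis unfolding strongly_measurable_def using cont[OF s(2) t(2)]
    by (intro conjI exI[of _ "\<lambda>i \<omega>. h (s i \<omega>) (t i \<omega>)"]) auto
qed

lemma strongly_measurable_compose:
  assumes f: "strongly_measurable M S f" and into: "\<And>x. x \<in> S \<Longrightarrow> h x \<in> R"
    and cont: "\<And>x a. x \<longlonglongrightarrow> a \<Longrightarrow> (\<lambda>n::nat. h (x n)) \<longlonglongrightarrow> h a"
  shows "strongly_measurable M R (\<lambda>\<omega>. h (f \<omega>))"
  using strongly_measurable_compose2[OF f f, of "\<lambda>x y. h x" R] into cont by auto

lemma strongly_measurable_simple:
  "simple_function M s \<Longrightarrow> s \<in> space M \<rightarrow> S \<Longrightarrow> strongly_measurable M S s"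
  unfolding strongly_measurable_def simple_into_def by auto

lemma strongly_measurable_imp_borel: "strongly_measurable M S f \<Longrightarrow> f \<in> borel_measurable M"
proof -
  assume "strongly_measurable M S f"
  then obtain s where s: "\<forall>i::nat. simple_function M (s i)" "\<forall>\<omega>\<in>space M. (\<lambda>i. s i \<omega>) \<longlonglongrightarrow> f \<omega>"
    unfolding strongly_measurable_def simple_into_def by blast
  show ?thesis
    by (rule borel_measurable_LIMSEQ_metric[of s]) (use s in \<open>auto intro: borel_measurable_simple_function\<close>)
qed

lemma borel_imp_strongly_measurable:
  fixes f :: "'w \<Rightarrow> 'b::{real_normed_vector, second_countable_topology}"
  assumes "f \<in> borel_measurable M" shows "strongly_measurable M UNIV f"
  using borel_measurable_implies_sequence_metric[OF assms, of 0]
  unfolding strongly_measurable_def simple_into_def by auto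

lemma strongly_measurable_norm: "strongly_measurable M S f \<Longrightarrow> (\<lambda>\<omega>. norm (f \<omega>)) \<in> borel_measurable M"
  by (rule measurable_compose[OF strongly_measurable_imp_borel borel_measurable_norm])

lemma strongly_measurable_norm_diff:
  assumes "strongly_measurable M S f" "strongly_measurable M T g"
  shows "(\<lambda>\<omega>. norm (f \<omega> - g \<omega>)) \<in> borel_measurable M"
  by (rule strongly_measurable_norm[OF strongly_measurable_compose2[OF assms, of "\<lambda>x y. x - y" UNIV]])
    (auto intro: tendsto_diff)

lemma strongly_measurable_approx:
  assumes f: "strongly_measurable M S f" and "0 \<in> S"
  obtains s where "\<And>i::nat. simple_into M S (s i)" "\<And>\<omega>. \<omega> \<in> space M \<Longrightarrow> (\<lambda>i. s i \<omega>) \<longlonglongrightarrow> f \<omega>"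
    "\<And>i \<omega>. \<omega> \<in> space M \<Longrightarrow> norm (s i \<omega>) \<le> 2 * norm (f \<omega>)"
proof -
  obtain s where s: "\<And>i::nat. simple_into M S (s i)" "\<And>\<omega>. \<omega> \<in> space M \<Longrightarrow> (\<lambda>i. s i \<omega>) \<longlonglongrightarrow> f \<omega>"
    using f unfolding strongly_measurable_def by auto
  note [measurable] = strongly_measurable_norm[OF f]
  have [measurable]: "(\<lambda>\<omega>. norm (s i \<omega>)) \<in> borel_measurable M" for i
    using s(1)[of i] unfolding simple_into_def
    by (intro measurable_compose[OF borel_measurable_simple_function borel_measurable_norm]) auto
  \<comment> \<open>Approximants that are too large are replaced by 0. The factor 2 leaves room:
    where \<open>f \<omega>\<close> is not 0, the norms converge to a value below
    \<open>2 * norm (f \<omega>)\<close>, so the cut-off eventually stops acting.\<close>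
  define t where "t i \<omega> = (if norm (s i \<omega>) \<le> 2 * norm (f \<omega>) then s i \<omega> else 0)" for i \<omega>
  show thesis
  proof (rule that[of t])
    show "simple_into M S (t i)" for i
      using s(1)[of i] \<open>0 \<in> S\<close> unfolding simple_into_def t_def
      by (auto intro!: simple_function_If simple_function_const)
    show "norm (t i \<omega>) \<le> 2 * norm (f \<omega>)" for i \<omega> by (simp add: t_def)
    fix \<omega> assume \<omega>: "\<omega> \<in> space M"
    show "(\<lambda>i. t i \<omega>) \<longlonglongrightarrow> f \<omega>"
    proof (cases "f \<omega> = 0")
      case True
      then have "t i \<omega> = 0" for i by (simp add: t_def)
      then show ?thesis using True by simp
    next
      case False
      have "(\<lambda>i. norm (s i \<omega>)) \<longlonglongrightarrow> norm (f \<omega>)" using s(2)[OF \<omega>] by (rule tendsto_norm)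
      then have "\<forall>\<^sub>F i in sequentially. norm (s i \<omega>) < 2 * norm (f \<omega>)"
        by (rule order_tendstoD(2)) (use False in simp)
      then have "\<forall>\<^sub>F i in sequentially. t i \<omega> = s i \<omega>" by eventually_elim (simp add: t_def)
      then show ?thesis using s(2)[OF \<omega>] by (simp add: tendsto_cong)
    qed
  qed
qed

lemma nn_integral_approx_tendsto_0:
  assumes [measurable]: "\<And>i. (\<lambda>\<omega>. norm (f \<omega> - s i \<omega>)) \<in> borel_measurable M" "(\<lambda>\<omega>. norm (f \<omega>)) \<in> borel_measurable M"
    and lim: "\<And>\<omega>. \<omega> \<in> space M \<Longrightarrow> (\<lambda>i. s i \<omega>) \<longlonglongrightarrow> f \<omega>"
    and bd: "\<And>i \<omega>. \<omega> \<in> space M \<Longrightarrow> norm (s i \<omega>) \<le> 2 * norm (f \<omega>)"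
    and fin: "(\<integral>\<^sup>+\<omega>. ennreal (norm (f \<omega>)) \<partial>M) < \<infinity>"
  shows "(\<lambda>i. \<integral>\<^sup>+\<omega>. ennreal (norm (f \<omega> - s i \<omega>)) \<partial>M) \<longlonglongrightarrow> 0"
proof -
  have "(\<lambda>i. \<integral>\<^sup>+\<omega>. ennreal (norm (f \<omega> - s i \<omega>)) \<partial>M) \<longlonglongrightarrow> (\<integral>\<^sup>+\<omega>. 0 \<partial>M)"
  proof (rule nn_integral_dominated_convergence[where w = "\<lambda>\<omega>. 3 * ennreal (norm (f \<omega>))"])
    show "AE \<omega> in M. ennreal (norm (f \<omega> - s i \<omega>)) \<le> 3 * ennreal (norm (f \<omega>))" for i
      using AE_space
    proof eventually_elim
      case (elim \<omega>)
      have "norm (f \<omega> - s i \<omega>) \<le> 3 * norm (f \<omega>)"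
        using norm_triangle_ineq4[of "f \<omega>" "s i \<omega>"] bd[OF elim, of i] by simp
      then have "ennreal (norm (f \<omega> - s i \<omega>)) \<le> ennreal (3 * norm (f \<omega>))" by (rule ennreal_leI)
      then show ?case by (simp add: ennreal_mult)
    qed
    show "(\<integral>\<^sup>+\<omega>. 3 * ennreal (norm (f \<omega>)) \<partial>M) < \<infinity>"
      using fin by (simp add: nn_integral_cmult ennreal_mult_less_top)
    show "AE \<omega> in M. (\<lambda>i. ennreal (norm (f \<omega> - s i \<omega>))) \<longlonglongrightarrow> 0"
      using AE_space
    proof eventually_elim
      case (elim \<omega>)
      have "(\<lambda>i. norm (f \<omega> - s i \<omega>)) \<longlonglongrightarrow> norm (f \<omega> - f \<omega>)"
        by (intro tendsto_norm tendsto_diff tendsto_const lim elim)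
      then show ?case by (metis diff_self ennreal_0 norm_zero tendsto_ennrealI)
    qed
  qed auto
  then show ?thesis by simp
qed

lemma (in finite_measure) simple_bochner_integrable_finite:
  "simple_function M s \<Longrightarrow> Bochner_Integration.simple_bochner_integrable M s"
  by (auto intro!: simple_bochner_integrable.intros)

lemma simple_bochner_integral_mem:
  assumes "simple_into M S s" and S: "0 \<in> S" "\<And>x y. x \<in> S \<Longrightarrow> y \<in> S \<Longrightarrow> x + y \<in> S" "\<And>r x. x \<in> S \<Longrightarrow> r *\<^sub>R x \<in> S"
  shows "Bochner_Integration.simple_bochner_integral M s \<in> S"
proof -
  have "(\<Sum>y\<in>A. measure M {x\<in>space M. s x = y} *\<^sub>R y) \<in> S" if "finite A" "A \<subseteq> S" for A
    using that S by induction auto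
  then show ?thesis using assms(1) unfolding simple_bochner_integral_def simple_into_def simple_function_def by auto
qed

text \<open>The integrals of dominated simple approximations differ by at most the sum of their
  \<open>L^1\<close> distances to \<open>f\<close>, hence converge; a closed subspace contains the
  limit.\<close>

lemma (in finite_measure) bochner_integral_exists:
  fixes f :: "'a \<Rightarrow> 'b::banach"
  assumes f: "strongly_measurable M S f" and fin: "(\<integral>\<^sup>+\<omega>. ennreal (norm (f \<omega>)) \<partial>M) < \<infinity>"
    and S: "0 \<in> S" "\<And>x y. x \<in> S \<Longrightarrow> y \<in> S \<Longrightarrow> x + y \<in> S" "\<And>r x. x \<in> S \<Longrightarrow> r *\<^sub>R x \<in> S" "closed S"
  shows "\<exists>x\<in>S. has_bochner_integral_into M S f x"
proof -
  obtain s where s: "\<And>i::nat. simple_into M S (s i)" "\<And>\<omega>. \<omega> \<in> space M \<Longrightarrow> (\<lambda>i. s i \<omega>) \<longlonglongrightarrow> f \<omega>"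
    "\<And>i \<omega>. \<omega> \<in> space M \<Longrightarrow> norm (s i \<omega>) \<le> 2 * norm (f \<omega>)" by (rule strongly_measurable_approx[OF f S(1)]) blast
  have sm: "strongly_measurable M S (s i)" for i
    using s(1)[of i] by (auto simp: simple_into_def intro: strongly_measurable_simple)
  note [measurable] = strongly_measurable_norm_diff[OF f sm] strongly_measurable_norm[OF f]
  have lim: "(\<lambda>i. \<integral>\<^sup>+\<omega>. ennreal (norm (f \<omega> - s i \<omega>)) \<partial>M) \<longlonglongrightarrow> 0"
    by (rule nn_integral_approx_tendsto_0[OF _ _ s(2,3) fin]) auto
  have sb: "Bochner_Integration.simple_bochner_integrable M (s i)" for i
    using s(1)[of i] by (intro simple_bochner_integrable_finite) (simp add: simple_into_def)
  let ?I = "\<lambda>i. Bochner_Integration.simple_bochner_integral M (s i)"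
  have "Cauchy ?I"
  proof (rule metric_CauchyI)
    fix e :: real assume "0 < e"
    then have "0 < ennreal (e / 2)" by simp
    from order_tendstoD(2)[OF lim this] obtain N where N: "\<And>n. N \<le> n \<Longrightarrow> (\<integral>\<^sup>+\<omega>. ennreal (norm (f \<omega> - s n \<omega>)) \<partial>M) < ennreal (e / 2)"
      by (auto simp: eventually_sequentially)
    have "dist (?I m) (?I n) < e" if "N \<le> m" "N \<le> n" for m n
    proof -
      have "ennreal (norm (?I m - ?I n)) = ennreal (norm (Bochner_Integration.simple_bochner_integral M (\<lambda>\<omega>. s m \<omega> - s n \<omega>)))"
        by (subst simple_bochner_integral_diff[OF sb sb]) simp
      also have "\<dots> \<le> ennreal (Bochner_Integration.simple_bochner_integral M (\<lambda>\<omega>. norm (s m \<omega> - s n \<omega>)))"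
        by (rule ennreal_leI, rule simple_bochner_integral_norm_bound, rule simple_bochner_integrable_compose2[OF _ sb sb]) simp
      also have "\<dots> = (\<integral>\<^sup>+\<omega>. ennreal (norm (s m \<omega> - s n \<omega>)) \<partial>M)"
        by (rule simple_bochner_integral_eq_nn_integral)
          (rule simple_bochner_integrable_compose2[where p = "\<lambda>x y. norm (x - y)", OF _ sb sb], auto)
      also have "\<dots> \<le> (\<integral>\<^sup>+\<omega>. ennreal (norm (f \<omega> - s m \<omega>)) + ennreal (norm (f \<omega> - s n \<omega>)) \<partial>M)"
      proof (rule nn_integral_mono)
        fix \<omega>
        have "norm (s m \<omega> - s n \<omega>) \<le> norm (f \<omega> - s m \<omega>) + norm (f \<omega> - s n \<omega>)"
          using norm_triangle_ineq4[of "f \<omega> - s n \<omega>" "f \<omega> - s m \<omega>"] by simp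
        then show "ennreal (norm (s m \<omega> - s n \<omega>)) \<le> ennreal (norm (f \<omega> - s m \<omega>)) + ennreal (norm (f \<omega> - s n \<omega>))"
          by (simp flip: ennreal_plus add: ennreal_leI)
      qed
      also have "\<dots> = (\<integral>\<^sup>+\<omega>. ennreal (norm (f \<omega> - s m \<omega>)) \<partial>M) + (\<integral>\<^sup>+\<omega>. ennreal (norm (f \<omega> - s n \<omega>)) \<partial>M)"
        by (rule nn_integral_add) auto
      also have "\<dots> < ennreal (e / 2) + ennreal (e / 2)" by (intro add_strict_mono N that)
      also have "\<dots> = ennreal e" using \<open>0 < e\<close> by (simp flip: ennreal_plus)
      finally show ?thesis by (simp add: dist_norm ennreal_less_iff)
    qed
    then show "\<exists>N. \<forall>m\<ge>N. \<forall>n\<ge>N. dist (?I m) (?I n) < e" by blast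
  qed
  then obtain x where x: "?I \<longlonglongrightarrow> x" using Cauchy_convergent convergent_def by blast
  have "x \<in> S"
    by (rule closed_sequentially[OF S(4) _ x]) (rule simple_bochner_integral_mem[OF s(1) S(1-3)])
  moreover have "has_bochner_integral_into M S f x"
    unfolding has_bochner_integral_into_def using f s(1) sb lim x by blast
  ultimately show ?thesis ..
qed

text \<open>The bridge to scalar integrals: applied to the evaluation at a vector, it reduces
  identities in the dual to scalar ones.\<close>

lemma has_bochner_integral_into_linear:
  fixes T :: "'b::real_normed_vector \<Rightarrow> 'k::{real_normed_field, euclidean_space}"
  assumes f: "has_bochner_integral_into M S f x" and T: "bounded_linear T"
  shows "has_bochner_integral M (\<lambda>\<omega>. T (f \<omega>)) (T x)"
proof -
  interpret T: bounded_linear T by fact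
  obtain s where sm: "strongly_measurable M S f" and s: "\<And>i::nat. simple_into M S (s i)" "\<And>i. Bochner_Integration.simple_bochner_integrable M (s i)"
    "(\<lambda>i. \<integral>\<^sup>+\<omega>. ennreal (norm (f \<omega> - s i \<omega>)) \<partial>M) \<longlonglongrightarrow> 0"
    "(\<lambda>i. Bochner_Integration.simple_bochner_integral M (s i)) \<longlonglongrightarrow> x"
    using f unfolding has_bochner_integral_into_def by blast
  obtain K where K: "0 < K" "\<And>x. norm (T x) \<le> norm x * K" using T.pos_bounded by blast
  have meas: "(\<lambda>\<omega>. norm (f \<omega> - s i \<omega>)) \<in> borel_measurable M" for i
    by (rule strongly_measurable_norm_diff[OF sm strongly_measurable_simple[of _ _ S]])
      (use s(1)[of i] in \<open>auto simp: simple_into_def\<close>)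
  show ?thesis
  proof (rule has_bochner_integral.intros)
    show "(\<lambda>\<omega>. T (f \<omega>)) \<in> borel_measurable M"
      by (rule strongly_measurable_imp_borel[OF strongly_measurable_compose[OF sm, where R = UNIV]]) (auto intro: T.tendsto)
    show "Bochner_Integration.simple_bochner_integrable M (\<lambda>\<omega>. T (s i \<omega>))" for i
      using simple_bochner_integrable_compose2[where p = "\<lambda>x y. T x", OF _ s(2) s(2)] by (simp add: T.zero)
    show "(\<lambda>i. Bochner_Integration.simple_bochner_integral M (\<lambda>\<omega>. T (s i \<omega>))) \<longlonglongrightarrow> T x"
      using T.tendsto[OF s(4)] by (simp add: simple_bochner_integral_linear[OF T.linear_axioms s(2)])
    show "(\<lambda>i. \<integral>\<^sup>+\<omega>. ennreal (norm (T (f \<omega>) - T (s i \<omega>))) \<partial>M) \<longlonglongrightarrow> 0"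
    proof (rule tendsto_sandwich[OF _ _ tendsto_const])
      have "(\<lambda>i. ennreal K * (\<integral>\<^sup>+\<omega>. ennreal (norm (f \<omega> - s i \<omega>)) \<partial>M)) \<longlonglongrightarrow> ennreal K * 0"
        by (intro ennreal_tendsto_cmult s(3)) simp
      then show "(\<lambda>i. ennreal K * (\<integral>\<^sup>+\<omega>. ennreal (norm (f \<omega> - s i \<omega>)) \<partial>M)) \<longlonglongrightarrow> 0" by simp
      show "\<forall>\<^sub>F i in sequentially. (\<integral>\<^sup>+\<omega>. ennreal (norm (T (f \<omega>) - T (s i \<omega>))) \<partial>M) \<le> ennreal K * (\<integral>\<^sup>+\<omega>. ennreal (norm (f \<omega> - s i \<omega>)) \<partial>M)"
      proof (intro always_eventually allI)
        fix i
        have "(\<integral>\<^sup>+\<omega>. ennreal (norm (T (f \<omega>) - T (s i \<omega>))) \<partial>M) \<le> (\<integral>\<^sup>+\<omega>. ennreal K * ennreal (norm (f \<omega> - s i \<omega>)) \<partial>M)"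
          using K by (intro nn_integral_mono) (auto simp: T.diff[symmetric] mult.commute simp flip: ennreal_mult intro!: ennreal_leI)
        also have "\<dots> = ennreal K * (\<integral>\<^sup>+\<omega>. ennreal (norm (f \<omega> - s i \<omega>)) \<partial>M)"
          by (rule nn_integral_cmult) (use meas in measurable)
        finally show "(\<integral>\<^sup>+\<omega>. ennreal (norm (T (f \<omega>) - T (s i \<omega>))) \<partial>M) \<le> \<dots>" .
      qed
    qed auto
  qed
qed

section \<open>Almost-everywhere classes and representatives\<close>

lemma ae_class_self: "f \<in> V \<Longrightarrow> f \<in> ae_class M V f"
  unfolding ae_class_def by simp

lemma ae_rep_class:
  assumes "f \<in> V" shows "ae_rep (ae_class M V f) \<in> V" "AE \<omega> in M. ae_rep (ae_class M V f) \<omega> = f \<omega>"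
proof -
  have "ae_rep (ae_class M V f) \<in> ae_class M V f"
    unfolding ae_rep_def using ae_class_self[OF assms, of M]
    by (rule someI[of "\<lambda>g. g \<in> ae_class M V f"])
  then show "ae_rep (ae_class M V f) \<in> V" "AE \<omega> in M. ae_rep (ae_class M V f) \<omega> = f \<omega>"
    unfolding ae_class_def by auto
qed

lemma ae_class_eqI: "AE \<omega> in M. f \<omega> = g \<omega> \<Longrightarrow> ae_class M V f = ae_class M V g"
  unfolding ae_class_def by (auto elim!: AE_mp)

lemma ae_class_rep: "A \<in> ae_class M V ` V \<Longrightarrow> ae_class M V (ae_rep A) = A"
  by (auto intro!: ae_class_eqI ae_rep_class(2))

lemma ae_rep_mem: "A \<in> ae_class M V ` V \<Longrightarrow> ae_rep A \<in> V"
  by (auto intro!: ae_rep_class(1))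

section \<open>The vector-valued spaces\<close>

locale lp_dual = distorted_prob M \<sigma> + banach_over sc
  for M :: "'w measure" and \<sigma> and sc :: "'k::{real_normed_field, euclidean_space} \<Rightarrow> 'x::banach \<Rightarrow> 'x" +
  fixes p :: real and q :: ennreal
  assumes p_ge_1: "1 \<le> p" and conjugate: "inverse (ennreal p) + inverse q = 1"
begin

abbreviation "DS \<equiv> dual_space sc"
abbreviation "LS \<equiv> (L_sigma_fun M \<sigma> p :: ('w \<Rightarrow> 'x) set)"
abbreviation "LST \<equiv> L_star_fun M \<sigma> q sc"
abbreviation nrm :: "('w \<Rightarrow> 'x) \<Rightarrow> real" where "nrm Y \<equiv> enn2real (sigma_norm M \<sigma> p Y)"
abbreviation dnrm :: "('w \<Rightarrow> 'x \<Rightarrow>\<^sub>L 'k) \<Rightarrow> ennreal" where "dnrm Z \<equiv> dual_sup p (\<lambda>\<omega>. norm (Z \<omega>))"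

lemma p_pos: "0 < p" "0 \<le> p" using p_ge_1 by auto

lemma DS_0: "0 \<in> DS" and DS_add: "f \<in> DS \<Longrightarrow> g \<in> DS \<Longrightarrow> f + g \<in> DS"
  and DS_scaleR: "f \<in> DS \<Longrightarrow> r *\<^sub>R f \<in> DS"
  by (auto simp: dual_space_def blinfun.add_left blinfun.scaleR_left algebra_simps)

lemma DS_apply: "f \<in> DS \<Longrightarrow> blinfun_apply f (sc c x) = c * blinfun_apply f x"
  by (simp add: dual_space_def)

lemma DS_closed: "closed DS"
proof (unfold closed_sequential_limits, intro allI impI, elim conjE)
  fix f l assume f: "\<forall>n. f n \<in> DS" and l: "f \<longlonglongrightarrow> l"
  have lim: "(\<lambda>n. blinfun_apply (f n) x) \<longlonglongrightarrow> blinfun_apply l x" for x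
    by (intro tendsto_intros l)
  have "blinfun_apply l (sc c x) = c * blinfun_apply l x" for c x
  proof (rule LIMSEQ_unique[OF lim])
    show "(\<lambda>n. blinfun_apply (f n) (sc c x)) \<longlonglongrightarrow> c * blinfun_apply l x"
      using tendsto_mult_left[OF lim, of c x] f by (simp add: DS_apply)
  qed
  then show "l \<in> DS" by (simp add: dual_space_def)
qed

lemma dual_scale_apply: "blinfun_apply (dual_scale c f) x = c * blinfun_apply f x"
proof -
  have "bounded_linear (\<lambda>x. c * blinfun_apply f x)"
    by (rule bounded_linear_compose[OF bounded_linear_mult_right blinfun.bounded_linear_right])
  then show ?thesis unfolding dual_scale_def by (simp add: bounded_linear_Blinfun_apply)
qed

lemma dual_scale_mem: "f \<in> DS \<Longrightarrow> dual_scale c f \<in> DS"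
  by (simp add: dual_space_def dual_scale_apply)

lemma norm_dual_scale_le: "norm (dual_scale c f) \<le> norm c * norm f"
  by (rule norm_blinfun_bound)
    (auto simp: dual_scale_apply norm_mult mult.assoc intro!: mult_left_mono norm_blinfun)

lemma tendsto_dual_scale: "f \<longlonglongrightarrow> l \<Longrightarrow> (\<lambda>n. dual_scale c (f n)) \<longlonglongrightarrow> dual_scale c l"
proof (rule LIM_zero_cancel)
  assume "f \<longlonglongrightarrow> l"
  then have lim: "(\<lambda>n. norm c * norm (f n - l)) \<longlonglongrightarrow> 0"
    by (intro tendsto_mult_right_zero tendsto_norm_zero LIM_zero)
  have diff: "dual_scale c (f n) - dual_scale c l = dual_scale c (f n - l)" for n
    by (rule blinfun_eqI) (simp add: dual_scale_apply blinfun.diff_left right_diff_distrib)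
  show "(\<lambda>n. dual_scale c (f n) - dual_scale c l) \<longlonglongrightarrow> 0"
    by (rule Lim_null_comparison[OF always_eventually lim]) (simp add: diff norm_dual_scale_le)
qed

lemma tendsto_sc: "x \<longlonglongrightarrow> l \<Longrightarrow> (\<lambda>n. sc c (x n)) \<longlonglongrightarrow> sc c l"
proof (rule LIM_zero_cancel, rule tendsto_norm_zero_cancel)
  assume "x \<longlonglongrightarrow> l"
  then have "(\<lambda>n. norm c * norm (x n - l)) \<longlonglongrightarrow> 0"
    by (intro tendsto_mult_right_zero tendsto_norm_zero LIM_zero)
  then show "(\<lambda>n. norm (sc c (x n) - sc c l)) \<longlonglongrightarrow> 0"
    by (simp add: scale_right_diff_distrib[symmetric] norm_scale)
qed

lemma mem_LS: "Y \<in> LS \<longleftrightarrow> strongly_measurable M UNIV Y \<and> modular M \<sigma> p Y < \<infinity>"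
  unfolding L_sigma_fun_def by (simp add: sigma_norm_modular ennroot_less_top)

lemma LS_meas: "Y \<in> LS \<Longrightarrow> strongly_measurable M UNIV Y"
  by (simp add: mem_LS)

lemma L_star_norm_eq:
  assumes "strongly_measurable M DS Z" shows "L_star_norm M \<sigma> q Z = dnrm Z"
proof -
  have "(\<lambda>\<omega>. of_real (norm (Z \<omega>)) :: 'k) \<in> borel_measurable M"
    by (rule measurable_compose[OF strongly_measurable_norm[OF assms]])
      (auto intro!: borel_measurable_continuous_onI continuous_intros)
  from sigma_star_norm_eq_dual_sup[OF p_ge_1 conjugate this] show ?thesis
    unfolding L_star_norm_def by simp
qed

lemma mem_LST: "Z \<in> LST \<longleftrightarrow> strongly_measurable M DS Z \<and> dnrm Z < \<infinity>"
  unfolding L_star_fun_def using L_star_norm_eq by auto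

lemma LST_meas: "Z \<in> LST \<Longrightarrow> strongly_measurable M DS Z"
  by (simp add: mem_LST)

lemma LS_add: assumes "Y \<in> LS" "Y' \<in> LS" shows "(\<lambda>\<omega>. Y \<omega> + Y' \<omega>) \<in> LS"
proof -
  have "strongly_measurable M UNIV (\<lambda>\<omega>. Y \<omega> + Y' \<omega>)"
    by (rule strongly_measurable_compose2[OF LS_meas[OF assms(1)] LS_meas[OF assms(2)]]) (auto intro: tendsto_add)
  moreover have "modular M \<sigma> p (\<lambda>\<omega>. Y \<omega> + Y' \<omega>) \<le> ennreal (2 powr p) * (modular M \<sigma> p Y + modular M \<sigma> p Y')"
    using p_pos by (intro modular_add strongly_measurable_norm[OF LS_meas] assms) (auto intro: norm_triangle_ineq)
  moreover have "\<dots> < \<infinity>" using assms by (simp add: mem_LS ennreal_mult_less_top)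
  ultimately show ?thesis by (simp add: mem_LS order.strict_trans1)
qed

lemma LS_scale: assumes "Y \<in> LS" shows "(\<lambda>\<omega>. sc c (Y \<omega>)) \<in> LS"
proof -
  have "strongly_measurable M UNIV (\<lambda>\<omega>. sc c (Y \<omega>))"
    by (rule strongly_measurable_compose[OF LS_meas[OF assms]]) (auto intro: tendsto_sc)
  moreover have "modular M \<sigma> p (\<lambda>\<omega>. sc c (Y \<omega>)) = ennreal (norm c powr p) * modular M \<sigma> p Y"
    by (intro modular_cmult strongly_measurable_norm[OF LS_meas[OF assms]]) (auto simp: norm_scale)
  ultimately show ?thesis using assms by (simp add: mem_LS ennreal_mult_less_top)
qed

lemma LS_scaleR: "Y \<in> LS \<Longrightarrow> (\<lambda>\<omega>. r *\<^sub>R Y \<omega>) \<in> LS"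
  using LS_scale[of Y "of_real r"] by (simp add: scale_of_real)

lemma LS_bounded:
  assumes "strongly_measurable M UNIV Y" "\<And>\<omega>. \<omega> \<in> space M \<Longrightarrow> norm (Y \<omega>) \<le> B" shows "Y \<in> LS"
proof -
  have "modular M \<sigma> p Y \<le> modular M \<sigma> p (\<lambda>_. max B 0 :: real)"
    using p_pos assms(2) by (intro modular_mono) (auto intro!: AE_I2 simp: max.coboundedI1)
  also have "\<dots> = ennreal (max B 0 powr p) * modular M \<sigma> p (\<lambda>_. 1 :: real)"
    by (intro modular_cmult) auto
  also have "\<dots> < \<infinity>"
    using modular_le_1[of p "\<lambda>_. 1 :: real"] p_pos by (auto simp: ennreal_mult_less_top intro: order.strict_trans1)
  finally show ?thesis using assms(1) by (simp add: mem_LS)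
qed

lemma simple_function_bounded:
  assumes "simple_function M (Y :: 'w \<Rightarrow> 'z::real_normed_vector)"
  obtains B where "0 \<le> B" "\<And>\<omega>. \<omega> \<in> space M \<Longrightarrow> norm (Y \<omega>) \<le> B"
proof -
  have "finite (norm ` Y ` space M)" using assms by (simp add: simple_function_def)
  then have "bdd_above (norm ` Y ` space M)" by (rule bdd_above_finite)
  then obtain B where "\<And>\<omega>. \<omega> \<in> space M \<Longrightarrow> norm (Y \<omega>) \<le> B" unfolding bdd_above_def by auto
  then show thesis by (intro that[of "max B 0"]) (auto simp: max.coboundedI1)
qed

lemma LS_simple: "simple_function M Y \<Longrightarrow> Y \<in> LS"
  by (metis LS_bounded UNIV_I Pi_I simple_function_bounded strongly_measurable_simple)

lemma nrm_le_iff: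
  assumes "Y \<in> LS" "0 \<le> c" shows "nrm Y \<le> c \<longleftrightarrow> modular M \<sigma> p Y \<le> ennreal (c powr p)"
proof -
  have "sigma_norm M \<sigma> p Y < \<infinity>" using assms(1) by (simp add: mem_LS sigma_norm_modular ennroot_less_top)
  then have "nrm Y \<le> c \<longleftrightarrow> sigma_norm M \<sigma> p Y \<le> ennreal c"
    using assms(2) by (metis enn2real_leI ennreal_enn2real ennreal_leI infinity_ennreal_def)
  then show ?thesis unfolding sigma_norm_modular using ennroot_le_iff[OF p_pos(1) assms(2)] by simp
qed

lemma nrm_cong: "AE \<omega> in M. Y \<omega> = Y' \<omega> \<Longrightarrow> nrm Y = nrm Y'"
  unfolding sigma_norm_modular using p_pos(2)
  by (subst modular_cong[of p Y Y']) (auto elim: eventually_mono)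

lemma LST_add: assumes "Z \<in> LST" "Z' \<in> LST" shows "(\<lambda>\<omega>. Z \<omega> + Z' \<omega>) \<in> LST"
proof -
  note [measurable] = strongly_measurable_norm[OF LST_meas[OF assms(1)]] strongly_measurable_norm[OF LST_meas[OF assms(2)]]
  have "strongly_measurable M DS (\<lambda>\<omega>. Z \<omega> + Z' \<omega>)"
    by (rule strongly_measurable_compose2[OF LST_meas[OF assms(1)] LST_meas[OF assms(2)]]) (auto intro: tendsto_add DS_add)
  moreover have "dnrm (\<lambda>\<omega>. Z \<omega> + Z' \<omega>) \<le> dnrm Z + dnrm Z'"
    unfolding dual_sup_def[of p "\<lambda>\<omega>. norm (Z \<omega> + Z' \<omega>)"]
  proof (rule SUP_least, safe)
    fix f :: "'w \<Rightarrow> real" assume f: "simple_function M f" "\<forall>\<omega>. 0 \<le> f \<omega>" "modular M \<sigma> p f \<le> 1"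
    note [measurable] = borel_measurable_simple_function[OF f(1)]
    have "(\<integral>\<^sup>+\<omega>. ennreal (norm (Z \<omega> + Z' \<omega>) * f \<omega>) \<partial>M) \<le> (\<integral>\<^sup>+\<omega>. ennreal (norm (Z \<omega>) * f \<omega>) + ennreal (norm (Z' \<omega>) * f \<omega>) \<partial>M)"
      using f(2) by (intro nn_integral_mono)
        (auto simp flip: ennreal_plus distrib_right intro!: ennreal_leI mult_right_mono norm_triangle_ineq)
    also have "\<dots> = (\<integral>\<^sup>+\<omega>. ennreal (norm (Z \<omega>) * f \<omega>) \<partial>M) + (\<integral>\<^sup>+\<omega>. ennreal (norm (Z' \<omega>) * f \<omega>) \<partial>M)"
      by (rule nn_integral_add) auto
    also have "\<dots> \<le> dnrm Z + dnrm Z'"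
      unfolding dual_sup_def using f by (intro add_mono SUP_upper) auto
    finally show "(\<integral>\<^sup>+\<omega>. ennreal (norm (Z \<omega> + Z' \<omega>) * f \<omega>) \<partial>M) \<le> \<dots>" .
  qed
  ultimately show ?thesis using assms by (auto simp: mem_LST order.strict_trans1)
qed

lemma LST_scale: assumes "Z \<in> LST" shows "(\<lambda>\<omega>. dual_scale c (Z \<omega>)) \<in> LST"
proof -
  note [measurable] = strongly_measurable_norm[OF LST_meas[OF assms(1)]]
  have "strongly_measurable M DS (\<lambda>\<omega>. dual_scale c (Z \<omega>))"
    by (rule strongly_measurable_compose[OF LST_meas[OF assms]]) (auto intro: tendsto_dual_scale dual_scale_mem)
  moreover have "dnrm (\<lambda>\<omega>. dual_scale c (Z \<omega>)) \<le> ennreal (norm c) * dnrm Z"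
    unfolding dual_sup_def[of p "\<lambda>\<omega>. norm (dual_scale c (Z \<omega>))"]
  proof (rule SUP_least, safe)
    fix f :: "'w \<Rightarrow> real" assume f: "simple_function M f" "\<forall>\<omega>. 0 \<le> f \<omega>" "modular M \<sigma> p f \<le> 1"
    note [measurable] = borel_measurable_simple_function[OF f(1)]
    have "(\<integral>\<^sup>+\<omega>. ennreal (norm (dual_scale c (Z \<omega>)) * f \<omega>) \<partial>M) \<le> (\<integral>\<^sup>+\<omega>. ennreal (norm c) * ennreal (norm (Z \<omega>) * f \<omega>) \<partial>M)"
      using f(2) by (intro nn_integral_mono)
        (auto simp flip: ennreal_mult mult.assoc intro!: ennreal_leI mult_right_mono norm_dual_scale_le)
    also have "\<dots> = ennreal (norm c) * (\<integral>\<^sup>+\<omega>. ennreal (norm (Z \<omega>) * f \<omega>) \<partial>M)"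
      by (rule nn_integral_cmult) auto
    also have "\<dots> \<le> ennreal (norm c) * dnrm Z"
      unfolding dual_sup_def using f by (intro mult_left_mono SUP_upper) auto
    finally show "(\<integral>\<^sup>+\<omega>. ennreal (norm (dual_scale c (Z \<omega>)) * f \<omega>) \<partial>M) \<le> \<dots>" .
  qed
  moreover have "ennreal (norm c) * dnrm Z < \<infinity>" using assms by (simp add: mem_LST ennreal_mult_less_top)
  ultimately show ?thesis by (simp add: mem_LST order.strict_trans1)
qed

lemma pairing_measurable:
  assumes "strongly_measurable M S Z" "strongly_measurable M T Y"
  shows "(\<lambda>\<omega>. blinfun_apply (Z \<omega>) (Y \<omega>)) \<in> borel_measurable M"
  by (rule strongly_measurable_imp_borel[OF strongly_measurable_compose2[OF assms, of blinfun_apply UNIV]])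
    (auto intro: tendsto_intros)

lemma pairing:
  assumes Z: "Z \<in> LST" and Y: "Y \<in> LS"
  shows "integrable M (\<lambda>\<omega>. blinfun_apply (Z \<omega>) (Y \<omega>))"
    "norm (\<integral>\<omega>. blinfun_apply (Z \<omega>) (Y \<omega>) \<partial>M) \<le> enn2real (dnrm Z) * nrm Y"
proof -
  note [measurable] = pairing_measurable[OF LST_meas[OF Z] LS_meas[OF Y]]
    strongly_measurable_norm[OF LST_meas[OF Z]] strongly_measurable_norm[OF LS_meas[OF Y]]
  obtain N where N: "dnrm Z = ennreal N" "0 \<le> N" using Z by (cases "dnrm Z") (auto simp: mem_LST)
  have le: "(\<integral>\<^sup>+\<omega>. ennreal (norm (blinfun_apply (Z \<omega>) (Y \<omega>))) \<partial>M) \<le> ennreal (c * N)" if c: "0 < c" "nrm Y \<le> c" for c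
  proof -
    have "(\<integral>\<^sup>+\<omega>. ennreal (norm (blinfun_apply (Z \<omega>) (Y \<omega>))) \<partial>M) \<le> (\<integral>\<^sup>+\<omega>. ennreal (norm (Z \<omega>) * norm (Y \<omega>)) \<partial>M)"
      by (intro nn_integral_mono ennreal_leI norm_blinfun)
    also have "\<dots> \<le> ennreal c * dnrm Z"
    proof (rule dual_sup_bound)
      have "modular M \<sigma> p (\<lambda>\<omega>. norm (Y \<omega>)) = modular M \<sigma> p Y" using p_pos by (intro modular_cong) auto
      then show "modular M \<sigma> p (\<lambda>\<omega>. norm (Y \<omega>)) \<le> ennreal (c powr p)"
        using nrm_le_iff[OF Y, of c] c by simp
    qed (use p_pos c in auto)
    finally show ?thesis unfolding N using N(2) c by (simp add: ennreal_mult)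
  qed
  have fin: "(\<integral>\<^sup>+\<omega>. ennreal (norm (blinfun_apply (Z \<omega>) (Y \<omega>))) \<partial>M) < \<infinity>"
    by (rule order.strict_trans1[OF le[of "nrm Y + 1"]]) (auto intro: add_nonneg_pos)
  then show int: "integrable M (\<lambda>\<omega>. blinfun_apply (Z \<omega>) (Y \<omega>))" by (intro integrableI_bounded) auto
  have "norm (\<integral>\<omega>. blinfun_apply (Z \<omega>) (Y \<omega>) \<partial>M) \<le> N * nrm Y + e" if e: "0 < e" for e
  proof -
    \<comment> \<open>\<open>dual_sup_bound\<close> needs a positive constant and
      \<open>nrm Y\<close> may be 0. The increment is chosen so that after multiplication by
      \<open>N\<close> it is at most \<open>e\<close>.\<close>
    have pos: "0 < nrm Y + e / (N + 1)" using N e by (intro add_nonneg_pos) auto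
    have "ennreal (norm (\<integral>\<omega>. blinfun_apply (Z \<omega>) (Y \<omega>) \<partial>M)) \<le> (\<integral>\<^sup>+\<omega>. ennreal (norm (blinfun_apply (Z \<omega>) (Y \<omega>))) \<partial>M)"
      by (rule integral_norm_bound_ennreal[OF int])
    also have "\<dots> \<le> ennreal ((nrm Y + e / (N + 1)) * N)" using N e by (intro le pos) auto
    finally have "norm (\<integral>\<omega>. blinfun_apply (Z \<omega>) (Y \<omega>) \<partial>M) \<le> (nrm Y + e / (N + 1)) * N"
      using pos N(2) by (simp add: ennreal_le_iff)
    also have "\<dots> = N * nrm Y + e * (N / (N + 1))" by (simp add: algebra_simps)
    also have "e * (N / (N + 1)) \<le> e * 1" using N e by (intro mult_left_mono) auto
    finally show ?thesis by (simp only: mult_1_right add_left_mono)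
  qed
  then show "norm (\<integral>\<omega>. blinfun_apply (Z \<omega>) (Y \<omega>) \<partial>M) \<le> enn2real (dnrm Z) * nrm Y"
    unfolding N enn2real_ennreal[OF N(2)] by (rule field_le_epsilon)
qed

text \<open>A nearly norming vector exists by the definition of the operator norm. Linearity over
  the scalar field allows it to be rotated, so that the value becomes real and nonnegative and no
  cancellation occurs when such values are summed or integrated.\<close>

lemma near_norming:
  assumes f: "f \<in> DS" and d: "0 < d" "d < 1"
  shows "\<exists>y r. norm y \<le> 1 \<and> blinfun_apply f y = of_real r \<and> (1 - d) * norm f \<le> r"
proof (cases "f = 0")
  case True
  then show ?thesis by (intro exI[of _ 0]) auto
next
  case False
  have "\<exists>x. (1 - d) * norm f * norm x < norm (blinfun_apply f x)"
  proof (rule ccontr)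
    assume "\<not> ?thesis"
    then have "norm f \<le> (1 - d) * norm f" using d by (intro norm_blinfun_bound) (auto simp: not_less)
    then show False using False d by simp
  qed
  then obtain x where x: "(1 - d) * norm f * norm x < norm (blinfun_apply f x)" by blast
  then have x0: "x \<noteq> 0" by auto
  define y where "y = (1 / norm x) *\<^sub>R x"
  have fy: "(1 - d) * norm f < norm (blinfun_apply f y)"
    using x x0 unfolding y_def by (simp add: blinfun.scaleR_right field_simps)
  then have fy0: "blinfun_apply f y \<noteq> 0" using d by (smt (verit) mult_nonneg_nonneg norm_ge_zero norm_zero)
  \<comment> \<open>A scalar of modulus 1 that turns the value at \<open>y\<close> into its
    modulus.\<close>
  define c where "c = of_real (norm (blinfun_apply f y)) / blinfun_apply f y"
  have "norm (sc c y) \<le> 1" using fy0 x0 by (simp add: norm_scale c_def norm_divide y_def)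
  moreover have "blinfun_apply f (sc c y) = of_real (norm (blinfun_apply f y))"
    using fy0 by (simp add: DS_apply[OF f] c_def)
  ultimately show ?thesis using fy by (intro exI[of _ "sc c y"] exI[of _ "norm (blinfun_apply f y)"]) auto
qed

text \<open>Composing a simple approximation of \<open>Z\<close> with a near-norming selection produces simple
  functions that detect the norm of \<open>Z\<close>.\<close>

lemma dual_sup_le_functional:
  assumes Z: "strongly_measurable M DS Z" and fin: "(\<integral>\<^sup>+\<omega>. ennreal (norm (Z \<omega>)) \<partial>M) < \<infinity>" and C: "0 \<le> C"
    and bd: "\<And>Y :: 'w \<Rightarrow> 'x. simple_function M Y \<Longrightarrow> norm (\<integral>\<omega>. blinfun_apply (Z \<omega>) (Y \<omega>) \<partial>M) \<le> C * nrm Y"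
  shows "dnrm Z \<le> ennreal C"
  unfolding dual_sup_def
proof (rule SUP_least, safe)
  fix f :: "'w \<Rightarrow> real" assume f: "simple_function M f" "\<forall>\<omega>. 0 \<le> f \<omega>" "modular M \<sigma> p f \<le> 1"
  note [measurable] = borel_measurable_simple_function[OF f(1)] strongly_measurable_norm[OF Z]
  obtain B where B: "0 \<le> B" "\<And>\<omega>. \<omega> \<in> space M \<Longrightarrow> norm (f \<omega>) \<le> B" by (rule simple_function_bounded[OF f(1)]) blast
  have fB: "f \<omega> \<le> B" if "\<omega> \<in> space M" for \<omega> using B(2)[OF that] f(2) by simp
  have intZ: "integrable M (\<lambda>\<omega>. norm (Z \<omega>))" using fin by (intro integrableI_nonneg) auto
  obtain s where s: "\<And>i::nat. simple_into M DS (s i)" "\<And>\<omega>. \<omega> \<in> space M \<Longrightarrow> (\<lambda>i. s i \<omega>) \<longlonglongrightarrow> Z \<omega>"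
    "\<And>i \<omega>. \<omega> \<in> space M \<Longrightarrow> norm (s i \<omega>) \<le> 2 * norm (Z \<omega>)" by (rule strongly_measurable_approx[OF Z DS_0]) blast
  have ssf: "simple_function M (s i)" and sDS: "\<And>\<omega>. \<omega> \<in> space M \<Longrightarrow> s i \<omega> \<in> DS" for i
    using s(1)[of i] by (auto simp: simple_into_def)
  have ssm: "strongly_measurable M DS (s i)" for i by (rule strongly_measurable_simple[OF ssf]) (use sDS in auto)
  note [measurable] = strongly_measurable_norm_diff[OF Z ssm] strongly_measurable_norm[OF ssm]
  have intZf: "integrable M (\<lambda>\<omega>. norm (Z \<omega>) * f \<omega>)"
    by (rule Bochner_Integration.integrable_bound[OF integrable_mult_right[OF intZ, of B]])
      (auto intro!: AE_I2 simp: abs_mult f(2) fB B(1) mult.commute[of B] intro: mult_left_mono)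
  have intsf: "integrable M (\<lambda>\<omega>. norm (s i \<omega>) * f \<omega>)" for i
    by (rule Bochner_Integration.integrable_bound[OF integrable_mult_right[OF intZf, of 2]])
      (use s(3) f(2) in \<open>auto intro!: AE_I2 mult_right_mono simp: abs_mult simp flip: mult.assoc\<close>)
  have intdf: "integrable M (\<lambda>\<omega>. norm (Z \<omega> - s i \<omega>) * f \<omega>)" for i
  proof (rule Bochner_Integration.integrable_bound[OF integrable_mult_right[OF intZf, of 3]])
    show "AE \<omega> in M. norm (norm (Z \<omega> - s i \<omega>) * f \<omega>) \<le> norm (3 * (norm (Z \<omega>) * f \<omega>))"
    proof (rule AE_I2)
      fix \<omega> assume "\<omega> \<in> space M"
      then have "norm (Z \<omega> - s i \<omega>) \<le> 3 * norm (Z \<omega>)"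
        using norm_triangle_ineq4[of "Z \<omega>" "s i \<omega>"] s(3)[of \<omega> i] by simp
      then show "norm (norm (Z \<omega> - s i \<omega>) * f \<omega>) \<le> norm (3 * (norm (Z \<omega>) * f \<omega>))"
        using f(2) by (simp add: abs_mult mult_right_mono flip: mult.assoc)
    qed
  qed measurable
  have main: "(1 - d) * (\<integral>\<omega>. norm (Z \<omega>) * f \<omega> \<partial>M) \<le> C" if d: "0 < d" "d < 1" for d
  proof -
    have "\<exists>y. \<forall>g. g \<in> DS \<longrightarrow> norm (y g) \<le> 1 \<and> (\<exists>r. blinfun_apply g (y g) = of_real r \<and> (1 - d) * norm g \<le> r)"
      using near_norming[OF _ d] by (intro choice) blast
    then obtain y where y: "\<And>g. g \<in> DS \<Longrightarrow> norm (y g) \<le> 1"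
      "\<And>g. g \<in> DS \<Longrightarrow> \<exists>r. blinfun_apply g (y g) = of_real r \<and> (1 - d) * norm g \<le> r" by blast
    have step: "(1 - d) * (\<integral>\<omega>. norm (s i \<omega>) * f \<omega> \<partial>M) \<le> C + (\<integral>\<omega>. norm (Z \<omega> - s i \<omega>) * f \<omega> \<partial>M)" for i
    proof -
      \<comment> \<open>The selection \<open>y\<close> is arbitrary and has no measurability; since
        \<open>s i\<close> takes finitely many values, its composition with \<open>y\<close> is
        nevertheless simple.\<close>
      define Y where "Y \<omega> = f \<omega> *\<^sub>R y (s i \<omega>)" for \<omega>
      have Ysf: "simple_function M Y"
        unfolding Y_def by (rule simple_function_compose2[OF f(1) ssf[of i], of "\<lambda>a g. a *\<^sub>R y g"])
      have normY: "norm (Y \<omega>) \<le> f \<omega>" if "\<omega> \<in> space M" for \<omega>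
        using y(1)[OF sDS[OF that]] f(2) by (simp add: Y_def mult_left_le)
      have "modular M \<sigma> p Y \<le> modular M \<sigma> p f"
        using p_pos normY f(2) by (intro modular_mono) (auto intro!: AE_I2)
      then have "nrm Y \<le> 1" using nrm_le_iff[OF LS_simple[OF Ysf], of 1] f(3) by auto
      then have 1: "norm (\<integral>\<omega>. blinfun_apply (Z \<omega>) (Y \<omega>) \<partial>M) \<le> C"
        using bd[OF Ysf] C by (meson mult_left_le order.trans)
      define r where "r \<omega> = norm (blinfun_apply (s i \<omega>) (y (s i \<omega>)))" for \<omega>
      have r: "blinfun_apply (s i \<omega>) (y (s i \<omega>)) = of_real (r \<omega>)" "(1 - d) * norm (s i \<omega>) \<le> r \<omega>" if \<omega>: "\<omega> \<in> space M" for \<omega>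
      proof -
        obtain t where t: "blinfun_apply (s i \<omega>) (y (s i \<omega>)) = of_real t" "(1 - d) * norm (s i \<omega>) \<le> t"
          using y(2)[OF sDS[OF \<omega>]] by blast
        moreover have "0 \<le> t" by (rule order.trans[OF _ t(2)]) (use d in auto)
        ultimately show "blinfun_apply (s i \<omega>) (y (s i \<omega>)) = of_real (r \<omega>)" "(1 - d) * norm (s i \<omega>) \<le> r \<omega>"
          by (auto simp: r_def)
      qed
      have sfr: "simple_function M r" unfolding r_def
        by (rule simple_function_compose1[OF ssf[of i], of "\<lambda>g. norm (blinfun_apply g (y g))"])
      note [measurable] = borel_measurable_simple_function[OF sfr] pairing_measurable[OF Z strongly_measurable_simple[OF Ysf, of UNIV, simplified]]
        pairing_measurable[OF ssm[of i] strongly_measurable_simple[OF Ysf, of UNIV, simplified]]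
      have rle: "r \<omega> \<le> norm (s i \<omega>)" if "\<omega> \<in> space M" for \<omega>
        unfolding r_def by (rule order.trans[OF norm_blinfun]) (use y(1)[OF sDS[OF that]] in \<open>simp add: mult_left_le\<close>)
      have intr: "integrable M (\<lambda>\<omega>. r \<omega> * f \<omega>)"
      proof (rule Bochner_Integration.integrable_bound[OF intsf[of i]])
        show "AE \<omega> in M. norm (r \<omega> * f \<omega>) \<le> norm (norm (s i \<omega>) * f \<omega>)"
          using rle f(2) by (intro AE_I2) (auto simp: abs_mult r_def intro: mult_right_mono)
      qed measurable
      have intZY: "integrable M (\<lambda>\<omega>. blinfun_apply (Z \<omega>) (Y \<omega>))"
      proof (rule Bochner_Integration.integrable_bound[OF intZf])
        show "AE \<omega> in M. norm (blinfun_apply (Z \<omega>) (Y \<omega>)) \<le> norm (norm (Z \<omega>) * f \<omega>)"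
          using normY f(2) by (intro AE_I2) (auto intro!: order.trans[OF norm_blinfun] mult_left_mono)
      qed measurable
      have eq: "of_real (r \<omega> * f \<omega>) = blinfun_apply (s i \<omega>) (Y \<omega>)" if "\<omega> \<in> space M" for \<omega>
        unfolding Y_def blinfun.scaleR_right r(1)[OF that] by (simp add: scaleR_conv_of_real mult.commute)
      have "(1 - d) * (\<integral>\<omega>. norm (s i \<omega>) * f \<omega> \<partial>M) = (\<integral>\<omega>. (1 - d) * (norm (s i \<omega>) * f \<omega>) \<partial>M)" by simp
      also have "\<dots> \<le> (\<integral>\<omega>. r \<omega> * f \<omega> \<partial>M)"
      proof (rule integral_mono[OF integrable_mult_right[OF intsf] intr])
        show "(1 - d) * (norm (s i \<omega>) * f \<omega>) \<le> r \<omega> * f \<omega>" if "\<omega> \<in> space M" for \<omega>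
          using mult_right_mono[OF r(2)[OF that], of "f \<omega>"] f(2) by (simp add: mult.assoc)
      qed
      also have "\<dots> \<le> norm (of_real (\<integral>\<omega>. r \<omega> * f \<omega> \<partial>M) :: 'k)" by simp
      also have "of_real (\<integral>\<omega>. r \<omega> * f \<omega> \<partial>M) = (\<integral>\<omega>. (of_real (r \<omega> * f \<omega>) :: 'k) \<partial>M)"
        by (rule integral_bounded_linear[OF bounded_linear_of_real intr, symmetric])
      \<comment> \<open>Near-norming vectors were chosen for \<open>s i\<close>, while the
        hypothesis concerns \<open>Z\<close>; passing from one to the other costs the
        \<open>f\<close>-weighted distance, which vanishes in the limit.\<close>
      also have "\<dots> = (\<integral>\<omega>. blinfun_apply (Z \<omega>) (Y \<omega>) - blinfun_apply (Z \<omega> - s i \<omega>) (Y \<omega>) \<partial>M)"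
        by (rule Bochner_Integration.integral_cong[OF refl]) (simp add: eq blinfun.diff_left del: of_real_mult)
      also have "norm \<dots> \<le> C + (\<integral>\<omega>. norm (Z \<omega> - s i \<omega>) * f \<omega> \<partial>M)"
      proof -
        have le: "norm (blinfun_apply (Z \<omega> - s i \<omega>) (Y \<omega>)) \<le> norm (Z \<omega> - s i \<omega>) * f \<omega>" if "\<omega> \<in> space M" for \<omega>
          by (rule order.trans[OF norm_blinfun]) (use normY[OF that] in \<open>auto intro: mult_left_mono\<close>)
        have i2: "integrable M (\<lambda>\<omega>. blinfun_apply (Z \<omega> - s i \<omega>) (Y \<omega>))"
        proof (rule Bochner_Integration.integrable_bound[OF intdf[of i]])
          show "AE \<omega> in M. norm (blinfun_apply (Z \<omega> - s i \<omega>) (Y \<omega>)) \<le> norm (norm (Z \<omega> - s i \<omega>) * f \<omega>)"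
            using le f(2) by (intro AE_I2) auto
        qed (simp add: blinfun.diff_left)
        have "norm (\<integral>\<omega>. blinfun_apply (Z \<omega>) (Y \<omega>) - blinfun_apply (Z \<omega> - s i \<omega>) (Y \<omega>) \<partial>M)
          \<le> norm (\<integral>\<omega>. blinfun_apply (Z \<omega>) (Y \<omega>) \<partial>M) + norm (\<integral>\<omega>. blinfun_apply (Z \<omega> - s i \<omega>) (Y \<omega>) \<partial>M)"
          by (subst Bochner_Integration.integral_diff[OF intZY i2]) (rule norm_triangle_ineq4)
        also have "norm (\<integral>\<omega>. blinfun_apply (Z \<omega> - s i \<omega>) (Y \<omega>) \<partial>M) \<le> (\<integral>\<omega>. norm (Z \<omega> - s i \<omega>) * f \<omega> \<partial>M)"
          by (rule order.trans[OF integral_norm_bound integral_mono[OF integrable_norm[OF i2] intdf[of i] le]])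
        finally show ?thesis using 1 by simp
      qed
      finally show ?thesis .
    qed
    have l1: "(\<lambda>i. \<integral>\<omega>. norm (s i \<omega>) * f \<omega> \<partial>M) \<longlonglongrightarrow> (\<integral>\<omega>. norm (Z \<omega>) * f \<omega> \<partial>M)"
    proof (rule integral_dominated_convergence[OF _ _ integrable_mult_right[OF intZf, of 2]])
      show "AE \<omega> in M. (\<lambda>i. norm (s i \<omega>) * f \<omega>) \<longlonglongrightarrow> norm (Z \<omega>) * f \<omega>"
        by (intro AE_I2 tendsto_intros s(2))
      show "AE \<omega> in M. norm (norm (s i \<omega>) * f \<omega>) \<le> 2 * (norm (Z \<omega>) * f \<omega>)" for i
        using s(3) f(2) by (intro AE_I2) (auto simp: abs_mult intro: mult_right_mono simp flip: mult.assoc)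
    qed measurable
    have l2: "(\<lambda>i. \<integral>\<omega>. norm (Z \<omega> - s i \<omega>) * f \<omega> \<partial>M) \<longlonglongrightarrow> (\<integral>\<omega>. 0 \<partial>M)"
    proof (rule integral_dominated_convergence[where w = "\<lambda>\<omega>. 3 * (norm (Z \<omega>) * f \<omega>)"])
      show "AE \<omega> in M. (\<lambda>i. norm (Z \<omega> - s i \<omega>) * f \<omega>) \<longlonglongrightarrow> 0"
      proof (rule AE_I2)
        fix \<omega> assume "\<omega> \<in> space M"
        then have "(\<lambda>i. norm (Z \<omega> - s i \<omega>) * f \<omega>) \<longlonglongrightarrow> norm (Z \<omega> - Z \<omega>) * f \<omega>" by (intro tendsto_intros s(2))
        then show "(\<lambda>i. norm (Z \<omega> - s i \<omega>) * f \<omega>) \<longlonglongrightarrow> 0" by simp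
      qed
      show "AE \<omega> in M. norm (norm (Z \<omega> - s i \<omega>) * f \<omega>) \<le> 3 * (norm (Z \<omega>) * f \<omega>)" for i
      proof (rule AE_I2)
        fix \<omega> assume "\<omega> \<in> space M"
        then have "norm (Z \<omega> - s i \<omega>) \<le> 3 * norm (Z \<omega>)"
          using norm_triangle_ineq4[of "Z \<omega>" "s i \<omega>"] s(3)[of \<omega> i] by simp
        then show "norm (norm (Z \<omega> - s i \<omega>) * f \<omega>) \<le> 3 * (norm (Z \<omega>) * f \<omega>)"
          using f(2) by (simp add: abs_mult mult_right_mono flip: mult.assoc)
      qed
    qed (use intZf in auto)
    have "(\<lambda>i. C + (\<integral>\<omega>. norm (Z \<omega> - s i \<omega>) * f \<omega> \<partial>M)) \<longlonglongrightarrow> C + 0"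
      using l2 by (intro tendsto_add tendsto_const) simp
    then show ?thesis
      using LIMSEQ_le[OF tendsto_mult_left[OF l1, of "1 - d"]] step by auto
  qed
  have "(\<integral>\<omega>. norm (Z \<omega>) * f \<omega> \<partial>M) \<le> C"
  proof (rule tendsto_upperbound[of "\<lambda>d. (1 - d) * (\<integral>\<omega>. norm (Z \<omega>) * f \<omega> \<partial>M)" _ "at_right 0"])
    show "((\<lambda>d. (1 - d) * (\<integral>\<omega>. norm (Z \<omega>) * f \<omega> \<partial>M)) \<longlongrightarrow> (\<integral>\<omega>. norm (Z \<omega>) * f \<omega> \<partial>M)) (at_right 0)"
      by (rule tendsto_eq_intros refl | simp)+
    show "\<forall>\<^sub>F d in at_right 0. (1 - d) * (\<integral>\<omega>. norm (Z \<omega>) * f \<omega> \<partial>M) \<le> C"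
    proof -
      have "\<forall>\<^sub>F d in at_right 0. d \<in> {0<..<1::real}" by (rule eventually_at_right_real) simp
      then show ?thesis by eventually_elim (use main in auto)
    qed
  qed auto
  then show "(\<integral>\<^sup>+\<omega>. ennreal (norm (Z \<omega>) * f \<omega>) \<partial>M) \<le> ennreal C"
    using f(2) by (subst nn_integral_eq_integral[OF intZf]) (auto intro: ennreal_leI)
qed

section \<open>The canonical map on classes\<close>

abbreviation "cls \<equiv> ae_class M LS"
abbreviation "dcls \<equiv> ae_class M LST"
abbreviation "\<L> \<equiv> L_sigma M \<sigma> p sc"
abbreviation "\<L>' \<equiv> L_star M \<sigma> q sc"
abbreviation "\<iota> \<equiv> iota M \<sigma> p sc"

lemma L_sigma_sel [simp]: "vcarrier \<L> = cls ` LS" "vnorm \<L> A = nrm (ae_rep A)"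
    "vadd \<L> A B = cls (\<lambda>\<omega>. ae_rep A \<omega> + ae_rep B \<omega>)" "vscale \<L> c A = cls (\<lambda>\<omega>. sc c (ae_rep A \<omega>))"
  by (simp_all add: L_sigma_def ae_space_def)

lemma L_star_sel [simp]: "vcarrier \<L>' = dcls ` LST" "vnorm \<L>' A = enn2real (L_star_norm M \<sigma> q (ae_rep A))"
    "vadd \<L>' A B = dcls (\<lambda>\<omega>. ae_rep A \<omega> + ae_rep B \<omega>)" "vscale \<L>' c A = dcls (\<lambda>\<omega>. dual_scale c (ae_rep A \<omega>))"
  by (simp_all add: L_star_def ae_space_def)

lemma vadd_cls: assumes "Y \<in> LS" "Y' \<in> LS" shows "vadd \<L> (cls Y) (cls Y') = cls (\<lambda>\<omega>. Y \<omega> + Y' \<omega>)"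
  using ae_rep_class(2)[OF assms(1), of M] ae_rep_class(2)[OF assms(2), of M]
  by (auto intro!: ae_class_eqI elim: eventually_elim2)

lemma vscale_cls: assumes "Y \<in> LS" shows "vscale \<L> c (cls Y) = cls (\<lambda>\<omega>. sc c (Y \<omega>))"
  using ae_rep_class(2)[OF assms, of M] by (auto intro!: ae_class_eqI elim: eventually_mono)

lemma vnorm_cls: assumes "Y \<in> LS" shows "vnorm \<L> (cls Y) = nrm Y"
  using nrm_cong[OF ae_rep_class(2)[OF assms, of M]] by simp

lemma pairing_cong:
  assumes "Z \<in> LST" "Y \<in> LS" "AE \<omega> in M. Z' \<omega> = Z \<omega>" "AE \<omega> in M. Y' \<omega> = Y \<omega>" "Z' \<in> LST" "Y' \<in> LS"
  shows "(\<integral>\<omega>. blinfun_apply (Z' \<omega>) (Y' \<omega>) \<partial>M) = (\<integral>\<omega>. blinfun_apply (Z \<omega>) (Y \<omega>) \<partial>M)"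
  using assms(3,4)
  by (intro integral_cong_AE pairing_measurable[OF LST_meas LS_meas] assms) (auto elim: eventually_elim2)

lemma iota_cls:
  assumes "Z \<in> LST" "Y \<in> LS"
  shows "\<iota> (dcls Z) (cls Y) = (\<integral>\<omega>. blinfun_apply (Z \<omega>) (Y \<omega>) \<partial>M)"
proof -
  have "\<iota> (dcls Z) (cls Y) = (\<integral>\<omega>. blinfun_apply (ae_rep (dcls Z) \<omega>) (ae_rep (cls Y) \<omega>) \<partial>M)"
    using assms(2) by (auto simp: iota_def)
  also have "\<dots> = (\<integral>\<omega>. blinfun_apply (Z \<omega>) (Y \<omega>) \<partial>M)"
    by (intro pairing_cong assms ae_rep_class)
  finally show ?thesis .
qed

lemma nn_integral_norm_LST:
  assumes "Z \<in> LST" shows "(\<integral>\<^sup>+\<omega>. ennreal (norm (Z \<omega>)) \<partial>M) < \<infinity>"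
  using nn_integral_le_dual_sup[OF strongly_measurable_norm[OF LST_meas[OF assms]] p_pos(1)] assms
  by (auto simp: mem_LST intro: order.strict_trans1)

lemma continuous_dual_sel [simp]:
  "vadd (continuous_dual N) = (\<lambda>\<phi> \<psi>. \<lambda>v\<in>vcarrier N. \<phi> v + \<psi> v)"
  "vscale (continuous_dual N) = (\<lambda>c \<phi>. \<lambda>v\<in>vcarrier N. c * \<phi> v)"
  "vnorm (continuous_dual N) = (\<lambda>\<phi>. SUP v\<in>{v \<in> vcarrier N. vnorm N v \<le> 1}. norm (\<phi> v))"
  by (simp_all add: continuous_dual_def)

lemma mem_continuous_dual:
  "\<phi> \<in> vcarrier (continuous_dual \<L>) \<longleftrightarrow> \<phi> \<in> extensional (cls ` LS) \<and>
    (\<forall>Y\<in>LS. \<forall>Y'\<in>LS. \<phi> (cls (\<lambda>\<omega>. Y \<omega> + Y' \<omega>)) = \<phi> (cls Y) + \<phi> (cls Y')) \<and>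
    (\<forall>c. \<forall>Y\<in>LS. \<phi> (cls (\<lambda>\<omega>. sc c (Y \<omega>))) = c * \<phi> (cls Y)) \<and>
    (\<exists>C. \<forall>Y\<in>LS. norm (\<phi> (cls Y)) \<le> C * nrm Y)"
  unfolding continuous_dual_def
  by (simp add: vadd_cls vscale_cls vnorm_cls del: L_sigma_sel(2-4))

lemma iota_mem: assumes "Z \<in> LST" shows "\<iota> (dcls Z) \<in> vcarrier (continuous_dual \<L>)"
  unfolding mem_continuous_dual
proof (intro conjI ballI allI exI)
  show "\<iota> (dcls Z) \<in> extensional (cls ` LS)" by (simp add: iota_def)
  fix Y :: "'w \<Rightarrow> 'x" assume Y: "Y \<in> LS"
  show "\<iota> (dcls Z) (cls (\<lambda>\<omega>. Y \<omega> + Y' \<omega>)) = \<iota> (dcls Z) (cls Y) + \<iota> (dcls Z) (cls Y')" if Y': "Y' \<in> LS" for Y'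
    by (simp add: iota_cls assms Y Y' LS_add blinfun.add_right pairing(1) Bochner_Integration.integral_add)
  show "\<iota> (dcls Z) (cls (\<lambda>\<omega>. sc c (Y \<omega>))) = c * \<iota> (dcls Z) (cls Y)" for c
  proof -
    have "(\<integral>\<omega>. blinfun_apply (Z \<omega>) (sc c (Y \<omega>)) \<partial>M) = (\<integral>\<omega>. c * blinfun_apply (Z \<omega>) (Y \<omega>) \<partial>M)"
      by (rule Bochner_Integration.integral_cong[OF refl])
        (use LST_meas[OF assms] in \<open>auto simp: strongly_measurable_def intro!: DS_apply\<close>)
    then show ?thesis by (simp add: iota_cls assms Y LS_scale)
  qed
  show "norm (\<iota> (dcls Z) (cls Y)) \<le> enn2real (dnrm Z) * nrm Y"
    unfolding iota_cls[OF assms Y] by (rule pairing(2)[OF assms Y])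
qed

text \<open>The upper bound is the pairing estimate. For the lower bound the supremum
  \<open>C\<close> over the unit ball becomes, by homogeneity, a constant for all simple
  \<open>Y\<close>, and \<open>dual_sup_le_functional\<close> transfers it to
  \<open>Z\<close>.\<close>

lemma vnorm_iota:
  assumes Z: "Z \<in> LST" shows "vnorm (continuous_dual \<L>) (\<iota> (dcls Z)) = enn2real (dnrm Z)"
proof -
  define N where "N = enn2real (dnrm Z)"
  have N: "dnrm Z = ennreal N" "0 \<le> N" using Z by (auto simp: mem_LST N_def)
  let ?V = "{v \<in> cls ` LS. vnorm \<L> v \<le> 1}"
  let ?\<phi> = "\<iota> (dcls Z)"
  have le: "norm (?\<phi> v) \<le> N" if v: "v \<in> ?V" for v
  proof -
    obtain Y where Y: "v = cls Y" "Y \<in> LS" using v by auto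
    then have "nrm Y \<le> 1" using v vnorm_cls[OF Y(2)] by auto
    then have "N * nrm Y \<le> N" using N(2) by (simp add: mult_left_le)
    then show ?thesis using pairing(2)[OF Z Y(2)] unfolding Y(1) iota_cls[OF Z Y(2)] N_def by linarith
  qed
  have zero: "(\<lambda>_. 0) \<in> LS" by (rule LS_simple) simp
  have "nrm (\<lambda>_. 0) \<le> 1" using modular_le_1[OF p_pos(2), of "\<lambda>_. 0 :: 'x"] by (subst nrm_le_iff[OF zero]) auto
  then have zV: "cls (\<lambda>_. 0) \<in> ?V" using zero vnorm_cls[OF zero] by auto
  have bdd: "bdd_above ((\<lambda>v. norm (?\<phi> v)) ` ?V)" by (rule bdd_aboveI[of _ N]) (use le in auto)
  define C where "C = (SUP v\<in>?V. norm (?\<phi> v))"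
  have C_up: "norm (?\<phi> v) \<le> C" if "v \<in> ?V" for v unfolding C_def by (rule cSUP_upper[OF that bdd])
  have C0: "0 \<le> C" using C_up[OF zV] norm_ge_zero by (rule order.trans[rotated])
  have "C \<le> N" unfolding C_def by (rule cSUP_least) (use zV le in auto)
  moreover have "dnrm Z \<le> ennreal C"
  proof (rule dual_sup_le_functional[OF LST_meas[OF Z] nn_integral_norm_LST[OF Z] C0])
    fix Y :: "'w \<Rightarrow> 'x" assume "simple_function M Y"
    then have Y: "Y \<in> LS" by (rule LS_simple)
    show "norm (\<integral>\<omega>. blinfun_apply (Z \<omega>) (Y \<omega>) \<partial>M) \<le> C * nrm Y"
    \<comment> \<open>A function of norm 0 cannot be normalised; there the pairing estimate already
      gives 0.\<close>
    proof (cases "nrm Y = 0")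
      case True then show ?thesis using pairing(2)[OF Z Y] by simp
    next
      case False
      then have pos: "0 < nrm Y" using enn2real_nonneg[of "sigma_norm M \<sigma> p Y"] by linarith
      define Y' where "Y' \<omega> = (1 / nrm Y) *\<^sub>R Y \<omega>" for \<omega>
      have Y': "Y' \<in> LS" unfolding Y'_def[abs_def] by (rule LS_scaleR[OF Y])
      have "modular M \<sigma> p Y' = ennreal ((1 / nrm Y) powr p) * modular M \<sigma> p Y"
        using pos by (intro modular_cmult strongly_measurable_norm[OF LS_meas[OF Y]]) (auto simp: Y'_def)
      also have "\<dots> \<le> ennreal ((1 / nrm Y) powr p) * ennreal (nrm Y powr p)"
        using nrm_le_iff[OF Y, of "nrm Y"] by (intro mult_left_mono) auto
      also have "\<dots> = 1" using pos by (simp add: powr_divide flip: ennreal_mult)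
      finally have "nrm Y' \<le> 1" using nrm_le_iff[OF Y', of 1] by simp
      then have "norm (?\<phi> (cls Y')) \<le> C" using Y' vnorm_cls[OF Y'] by (intro C_up) auto
      moreover have "(\<integral>\<omega>. blinfun_apply (Z \<omega>) (Y' \<omega>) \<partial>M) = (1 / nrm Y) *\<^sub>R (\<integral>\<omega>. blinfun_apply (Z \<omega>) (Y \<omega>) \<partial>M)"
        by (simp add: Y'_def blinfun.scaleR_right)
      ultimately show ?thesis unfolding iota_cls[OF Z Y'] using pos by (simp add: field_simps)
    qed
  qed
  then have "N \<le> C" unfolding N using C0 by (simp add: ennreal_le_iff)
  ultimately show ?thesis unfolding N_def C_def by simp
qed

lemma iota_linear_isometry: "linear_isometry \<L>' (continuous_dual \<L>) \<iota>"
  unfolding linear_isometry_def linear_map_def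
proof (intro conjI ballI allI)
  show "\<iota> \<in> vcarrier \<L>' \<rightarrow> vcarrier (continuous_dual \<L>)" using iota_mem by auto
  show "vnorm (continuous_dual \<L>) (\<iota> A) = vnorm \<L>' A" if "A \<in> vcarrier \<L>'" for A
  proof -
    have mem: "A \<in> dcls ` LST" using that by simp
    have rep: "ae_rep A \<in> LST" by (rule ae_rep_mem[OF mem])
    show ?thesis using vnorm_iota[OF rep] unfolding ae_class_rep[OF mem] by (simp add: L_star_norm_eq[OF LST_meas[OF rep]])
  qed
  show "\<iota> (vadd \<L>' A B) = vadd (continuous_dual \<L>) (\<iota> A) (\<iota> B)" if "A \<in> vcarrier \<L>'" "B \<in> vcarrier \<L>'" for A B
  proof
    fix v
    have mem: "A \<in> dcls ` LST" "B \<in> dcls ` LST" using that by auto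
    note rep = ae_rep_mem[OF mem(1)] ae_rep_mem[OF mem(2)]
    show "\<iota> (vadd \<L>' A B) v = vadd (continuous_dual \<L>) (\<iota> A) (\<iota> B) v"
    proof (cases "v \<in> cls ` LS")
      case True
      then obtain Y where Y: "v = cls Y" "Y \<in> LS" by auto
      have "\<iota> (vadd \<L>' A B) v = (\<integral>\<omega>. blinfun_apply (ae_rep A \<omega> + ae_rep B \<omega>) (Y \<omega>) \<partial>M)"
        unfolding Y(1) by (simp add: iota_cls[OF LST_add[OF rep] Y(2)])
      also have "\<dots> = \<iota> A v + \<iota> B v"
        using iota_cls[OF rep(1) Y(2)] iota_cls[OF rep(2) Y(2)] unfolding ae_class_rep[OF mem(1)] ae_class_rep[OF mem(2)] Y(1)
        by (simp add: blinfun.add_left pairing(1)[OF rep(1) Y(2)] pairing(1)[OF rep(2) Y(2)])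
      finally show ?thesis using True by simp
    qed (simp add: iota_def)
  qed
  show "\<iota> (vscale \<L>' c A) = vscale (continuous_dual \<L>) c (\<iota> A)" if "A \<in> vcarrier \<L>'" for c A
  proof
    fix v
    have mem: "A \<in> dcls ` LST" using that by auto
    note rep = ae_rep_mem[OF mem(1)]
    show "\<iota> (vscale \<L>' c A) v = vscale (continuous_dual \<L>) c (\<iota> A) v"
    proof (cases "v \<in> cls ` LS")
      case True
      then obtain Y where Y: "v = cls Y" "Y \<in> LS" by auto
      have "\<iota> (vscale \<L>' c A) v = (\<integral>\<omega>. blinfun_apply (dual_scale c (ae_rep A \<omega>)) (Y \<omega>) \<partial>M)"
        unfolding Y(1) by (simp add: iota_cls[OF LST_scale[OF rep] Y(2)])
      also have "\<dots> = c * \<iota> A v"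
        using iota_cls[OF rep Y(2)] unfolding ae_class_rep[OF mem] Y(1)
        by (simp add: dual_scale_apply)
      finally show ?thesis using True by simp
    qed (simp add: iota_def)
  qed
qed

lemma LST_diff: assumes "Z \<in> LST" "Z' \<in> LST" shows "(\<lambda>\<omega>. Z \<omega> - Z' \<omega>) \<in> LST"
proof -
  have "dual_scale (-1) g = - g" for g :: "'x \<Rightarrow>\<^sub>L 'k"
    by (rule blinfun_eqI) (simp add: dual_scale_apply blinfun.minus_left)
  then show ?thesis using LST_add[OF assms(1) LST_scale[OF assms(2), of "-1"]] by simp
qed

text \<open>The difference of two representatives pairs to 0 with all simple functions, so its dual
  norm vanishes; since that norm dominates the \<open>L^1\<close> norm, the representatives agree
  almost everywhere.\<close>

lemma iota_inj: "inj_on \<iota> (dcls ` LST)"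
proof (rule inj_onI)
  fix A B assume mem: "A \<in> dcls ` LST" "B \<in> dcls ` LST" and eq: "\<iota> A = \<iota> B"
  note rep = ae_rep_mem[OF mem(1)] ae_rep_mem[OF mem(2)]
  define Z where "Z \<omega> = ae_rep A \<omega> - ae_rep B \<omega>" for \<omega>
  have Z: "Z \<in> LST" unfolding Z_def[abs_def] by (rule LST_diff[OF rep])
  have "dnrm Z \<le> ennreal 0"
  proof (rule dual_sup_le_functional[OF LST_meas[OF Z] nn_integral_norm_LST[OF Z] order_refl])
    fix Y :: "'w \<Rightarrow> 'x" assume "simple_function M Y"
    then have Y: "Y \<in> LS" by (rule LS_simple)
    have "(\<integral>\<omega>. blinfun_apply (Z \<omega>) (Y \<omega>) \<partial>M) = \<iota> A (cls Y) - \<iota> B (cls Y)"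
      using iota_cls[OF rep(1) Y] iota_cls[OF rep(2) Y] unfolding ae_class_rep[OF mem(1)] ae_class_rep[OF mem(2)]
      by (simp add: Z_def blinfun.diff_left pairing(1)[OF rep(1) Y] pairing(1)[OF rep(2) Y])
    then show "norm (\<integral>\<omega>. blinfun_apply (Z \<omega>) (Y \<omega>) \<partial>M) \<le> 0 * nrm Y" using eq by simp
  qed
  then have "(\<integral>\<^sup>+\<omega>. ennreal (norm (Z \<omega>)) \<partial>M) = 0"
    using nn_integral_le_dual_sup[OF strongly_measurable_norm[OF LST_meas[OF Z]] p_pos(1)] by simp
  then have "AE \<omega> in M. Z \<omega> = 0"
    by (subst (asm) nn_integral_0_iff_AE) (use strongly_measurable_norm[OF LST_meas[OF Z]] in auto)
  then have "dcls (ae_rep A) = dcls (ae_rep B)" by (intro ae_class_eqI) (auto simp: Z_def elim: eventually_mono)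
  then show "A = B" using ae_class_rep[OF mem(1)] ae_class_rep[OF mem(2)] by simp
qed

text \<open>An injective linear isometry is bounded in both directions, so only surjectivity is in
  question, here expressed through representatives.\<close>

lemma iota_isomorphism_iff:
  "normed_isomorphism \<L>' (continuous_dual \<L>) \<iota> \<longleftrightarrow>
    (\<forall>\<phi>\<in>vcarrier (continuous_dual \<L>). \<exists>Z\<in>LST. \<forall>Y\<in>LS. \<phi> (cls Y) = (\<integral>\<omega>. blinfun_apply (Z \<omega>) (Y \<omega>) \<partial>M))" (is "?L \<longleftrightarrow> ?R")
proof
  assume ?L
  then have surj: "\<iota> ` (dcls ` LST) = vcarrier (continuous_dual \<L>)"
    by (simp add: normed_isomorphism_def bij_betw_def)
  show ?R
  proof
    fix \<phi> assume "\<phi> \<in> vcarrier (continuous_dual \<L>)"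
    then obtain Z where "Z \<in> LST" "\<phi> = \<iota> (dcls Z)" using surj by blast
    then show "\<exists>Z\<in>LST. \<forall>Y\<in>LS. \<phi> (cls Y) = (\<integral>\<omega>. blinfun_apply (Z \<omega>) (Y \<omega>) \<partial>M)"
      by (auto simp: iota_cls)
  qed
next
  assume R: ?R
  have iso: "linear_map \<L>' (continuous_dual \<L>) \<iota>" "\<And>A. A \<in> vcarrier \<L>' \<Longrightarrow> vnorm (continuous_dual \<L>) (\<iota> A) = vnorm \<L>' A"
    using iota_linear_isometry unfolding linear_isometry_def by blast+
  have surj: "\<iota> ` (dcls ` LST) = vcarrier (continuous_dual \<L>)"
  proof
    show "\<iota> ` (dcls ` LST) \<subseteq> vcarrier (continuous_dual \<L>)" using iota_mem by auto
    show "vcarrier (continuous_dual \<L>) \<subseteq> \<iota> ` (dcls ` LST)"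
    proof
      fix \<phi> assume \<phi>: "\<phi> \<in> vcarrier (continuous_dual \<L>)"
      then obtain Z where Z: "Z \<in> LST" "\<And>Y. Y \<in> LS \<Longrightarrow> \<phi> (cls Y) = (\<integral>\<omega>. blinfun_apply (Z \<omega>) (Y \<omega>) \<partial>M)" using R by blast
      have "\<phi> = \<iota> (dcls Z)"
      proof (rule extensionalityI)
        show "\<phi> \<in> extensional (cls ` LS)" using \<phi> by (simp add: mem_continuous_dual)
        show "\<iota> (dcls Z) \<in> extensional (cls ` LS)" by (simp add: iota_def)
      qed (use Z in \<open>auto simp: iota_cls\<close>)
      then show "\<phi> \<in> \<iota> ` (dcls ` LST)" using Z(1) by blast
    qed
  qed
  have "\<forall>v\<in>vcarrier \<L>'. vnorm (continuous_dual \<L>) (\<iota> v) \<le> 1 * vnorm \<L>' v"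
    "\<forall>v\<in>vcarrier \<L>'. vnorm \<L>' v \<le> 1 * vnorm (continuous_dual \<L>) (\<iota> v)"
    using iso(2) by auto
  moreover have "bij_betw \<iota> (vcarrier \<L>') (vcarrier (continuous_dual \<L>))"
    using surj iota_inj by (simp add: bij_betw_def)
  ultimately show ?L unfolding normed_isomorphism_def using iso(1) by blast
qed

end

section \<open>The Radon-Nikodym property implies surjectivity\<close>

text \<open>A single simple integrable approximant within \<open>L^1\<close> distance 1 of
  \<open>f\<close> already bounds the integral of the norm.\<close>

lemma has_bochner_integral_into_finite:
  assumes "has_bochner_integral_into M S f x" shows "(\<integral>\<^sup>+\<omega>. ennreal (norm (f \<omega>)) \<partial>M) < \<infinity>"
proof -
  obtain s where sm: "strongly_measurable M S f" and s: "\<And>i::nat. simple_into M S (s i)" "\<And>i. Bochner_Integration.simple_bochner_integrable M (s i)"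
    "(\<lambda>i. \<integral>\<^sup>+\<omega>. ennreal (norm (f \<omega> - s i \<omega>)) \<partial>M) \<longlonglongrightarrow> 0"
    using assms unfolding has_bochner_integral_into_def by blast
  have ssm: "strongly_measurable M S (s i)" for i
    using s(1)[of i] by (auto simp: simple_into_def intro: strongly_measurable_simple)
  note [measurable] = strongly_measurable_norm_diff[OF sm ssm] strongly_measurable_norm[OF ssm]
  have "\<forall>\<^sub>F i in sequentially. (\<integral>\<^sup>+\<omega>. ennreal (norm (f \<omega> - s i \<omega>)) \<partial>M) < 1"
    using order_tendstoD(2)[OF s(3), of 1] by simp
  then obtain i where i: "(\<integral>\<^sup>+\<omega>. ennreal (norm (f \<omega> - s i \<omega>)) \<partial>M) < 1"
    using eventually_happens'[OF sequentially_bot] by blast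
  have sb: "Bochner_Integration.simple_bochner_integrable M (\<lambda>\<omega>. norm (s i \<omega>))"
    using simple_bochner_integrable_compose2[where p = "\<lambda>x y. norm x", OF _ s(2) s(2)] by simp
  have "(\<integral>\<^sup>+\<omega>. ennreal (norm (f \<omega>)) \<partial>M) \<le> (\<integral>\<^sup>+\<omega>. ennreal (norm (f \<omega> - s i \<omega>)) + ennreal (norm (s i \<omega>)) \<partial>M)"
  proof (rule nn_integral_mono)
    fix \<omega>
    have "norm (f \<omega>) \<le> norm (f \<omega> - s i \<omega>) + norm (s i \<omega>)" using norm_triangle_ineq[of "f \<omega> - s i \<omega>" "s i \<omega>"] by simp
    then show "ennreal (norm (f \<omega>)) \<le> ennreal (norm (f \<omega> - s i \<omega>)) + ennreal (norm (s i \<omega>))"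
      by (simp flip: ennreal_plus add: ennreal_leI)
  qed
  also have "\<dots> = (\<integral>\<^sup>+\<omega>. ennreal (norm (f \<omega> - s i \<omega>)) \<partial>M) + (\<integral>\<^sup>+\<omega>. ennreal (norm (s i \<omega>)) \<partial>M)"
    by (rule nn_integral_add) auto
  also have "(\<integral>\<^sup>+\<omega>. ennreal (norm (s i \<omega>)) \<partial>M) = ennreal (Bochner_Integration.simple_bochner_integral M (\<lambda>\<omega>. norm (s i \<omega>)))"
    by (rule simple_bochner_integral_eq_nn_integral[OF sb, symmetric]) simp
  also have "(\<integral>\<^sup>+\<omega>. ennreal (norm (f \<omega> - s i \<omega>)) \<partial>M) + \<dots> < \<infinity>"
    using order.strict_trans[OF i, of top] by simp
  finally show ?thesis .
qed

section \<open>Dominated convergence for the modular\<close>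

context distorted_prob
begin

abbreviation s_above :: "real \<Rightarrow> real \<Rightarrow> real" where "s_above c u \<equiv> (if c < s u then s u else 0)"

lemma profile_s_above: "profile (s_above c)"
proof (rule profileI)
  show "s_above c u \<le> s_above c v" if "0 < u" "u \<le> v" "v < 1" for u v
    using profile_mono[OF profile_s that] by auto
qed (simp, auto simp: clip_def)

text \<open>The part of the weight up to \<open>c\<close> contributes at most \<open>c\<close> times
  a plain integral. The part above \<open>c\<close> is controlled by Hardy-Littlewood against the
  majorant \<open>G\<close>. Neither bound depends on the uniform variable, so both survive the
  supremum.\<close>

lemma modular_le_split:
  assumes "0 \<le> r" and [measurable]: "(\<lambda>\<omega>. norm (Y \<omega>)) \<in> borel_measurable M" and V: "V \<in> uniform_rvs M" and G: "profile G"
    and le: "AE \<omega> in M. norm (Y \<omega>) powr r \<le> G (V \<omega>)" and c: "0 \<le> c"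
  shows "modular M \<sigma> r Y \<le> ennreal c * (\<integral>\<^sup>+\<omega>. ennreal (norm (Y \<omega>) powr r) \<partial>M) + tail_integral (\<lambda>u. s_above c u * G u) 0"
  unfolding modular_s
proof (rule SUP_least)
  fix U assume U: "U \<in> uniform_rvs M"
  note [measurable] = uniform_measurable[OF U] uniform_measurable[OF V] profile_measurable[OF G]
    profile_measurable[OF profile_s_above[of c]]
  have "(\<integral>\<^sup>+\<omega>. ennreal (s (U \<omega>) * norm (Y \<omega>) powr r) \<partial>M) \<le>
    (\<integral>\<^sup>+\<omega>. ennreal c * ennreal (norm (Y \<omega>) powr r) + ennreal (s_above c (U \<omega>) * G (V \<omega>)) \<partial>M)"
  proof (rule nn_integral_mono_AE)
    show "AE \<omega> in M. ennreal (s (U \<omega>) * norm (Y \<omega>) powr r) \<le>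
      ennreal c * ennreal (norm (Y \<omega>) powr r) + ennreal (s_above c (U \<omega>) * G (V \<omega>))"
      using le
    proof eventually_elim
      case (elim \<omega>)
      have "s (U \<omega>) * norm (Y \<omega>) powr r \<le> c * norm (Y \<omega>) powr r + s_above c (U \<omega>) * G (V \<omega>)"
      proof (cases "c < s (U \<omega>)")
        case True
        then show ?thesis using mult_left_mono[OF elim s_nonneg[of "U \<omega>"]] c by (simp add: add_increasing)
      next
        case False
        then show ?thesis by (auto intro: mult_right_mono)
      qed
      then have "ennreal (s (U \<omega>) * norm (Y \<omega>) powr r) \<le> ennreal (c * norm (Y \<omega>) powr r + s_above c (U \<omega>) * G (V \<omega>))"
        by (rule ennreal_leI)
      also have "\<dots> = ennreal (c * norm (Y \<omega>) powr r) + ennreal (s_above c (U \<omega>) * G (V \<omega>))"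
        using c profile_nonneg[OF G] by (intro ennreal_plus) auto
      finally show ?case using c by (simp add: ennreal_mult)
    qed
  qed
  also have "\<dots> = ennreal c * (\<integral>\<^sup>+\<omega>. ennreal (norm (Y \<omega>) powr r) \<partial>M) + (\<integral>\<^sup>+\<omega>. ennreal (s_above c (U \<omega>) * G (V \<omega>)) \<partial>M)"
    by (subst nn_integral_add) (auto simp: nn_integral_cmult)
  also have "(\<integral>\<^sup>+\<omega>. ennreal (s_above c (U \<omega>) * G (V \<omega>)) \<partial>M) \<le> tail_integral (\<lambda>u. s_above c u * G u) 0"
    by (rule Hardy_Littlewood_uniform[OF V U G profile_s_above])
  finally show "(\<integral>\<^sup>+\<omega>. ennreal (s (U \<omega>) * norm (Y \<omega>) powr r) \<partial>M) \<le>
      ennreal c * (\<integral>\<^sup>+\<omega>. ennreal (norm (Y \<omega>) powr r) \<partial>M) + tail_integral (\<lambda>u. s_above c u * G u) 0"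
    by (simp add: add_left_mono)
qed

lemma tail_s_above_tendsto_0:
  assumes G: "profile G" and fin: "tail_integral (\<lambda>u. s u * G u) 0 < \<infinity>"
  shows "(\<lambda>k. tail_integral (\<lambda>u. s_above (real k) u * G u) 0) \<longlonglongrightarrow> 0"
proof -
  note [measurable] = profile_measurable[OF G] profile_measurable[OF profile_s_above]
  have "(\<lambda>k. tail_integral (\<lambda>u. s_above (real k) u * G u) 0) \<longlonglongrightarrow> (\<integral>\<^sup>+(u::real). 0 \<partial>lborel)"
    unfolding tail_integral_def
  proof (rule nn_integral_dominated_convergence[where w = "\<lambda>u. ennreal (s u * G u) * indicator {0<..<1} u"])
    show "(\<integral>\<^sup>+u. ennreal (s u * G u) * indicator {0<..<1} u \<partial>lborel) < \<infinity>" using fin unfolding tail_integral_def .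
    show "AE u in lborel. ennreal (s_above (real k) u * G u) * indicator {0<..<1} u \<le> ennreal (s u * G u) * indicator {0<..<1} u" for k
      using profile_nonneg[OF G] by (intro AE_I2 mult_right_mono ennreal_leI) auto
    show "AE u in lborel. (\<lambda>k. ennreal (s_above (real k) u * G u) * indicator {0<..<1} u) \<longlonglongrightarrow> 0"
    proof (intro AE_I2 tendsto_eventually)
      fix u :: real
      obtain n :: nat where n: "s u < real n" using reals_Archimedean2 by blast
      show "\<forall>\<^sub>F k in sequentially. ennreal (s_above (real k) u * G u) * indicator {0<..<1} u = 0"
        using eventually_ge_at_top[of n] by eventually_elim (use n in auto)
    qed
  qed measurable
  then show ?thesis by simp
qed

text \<open>A level \<open>k\<close> is chosen first so that the part of the weight above it is
  small for every \<open>n\<close>; below that level ordinary dominated convergence takes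
  over.\<close>

lemma modular_dominated:
  assumes "0 \<le> r" and [measurable]: "\<And>n. (\<lambda>\<omega>. norm (D n \<omega>)) \<in> borel_measurable M" "(\<lambda>\<omega>. norm (Y \<omega>)) \<in> borel_measurable M"
    and K: "0 \<le> K" "\<And>n \<omega>. \<omega> \<in> space M \<Longrightarrow> norm (D n \<omega>) \<le> K * norm (Y \<omega>)"
    and lim: "\<And>\<omega>. \<omega> \<in> space M \<Longrightarrow> (\<lambda>n. norm (D n \<omega>) powr r) \<longlonglongrightarrow> 0"
    and fin: "modular M \<sigma> r Y < \<infinity>"
  shows "(\<lambda>n. modular M \<sigma> r (D n)) \<longlonglongrightarrow> 0"
proof -
  let ?g = "clip (quantile M (\<lambda>\<omega>. norm (Y \<omega>)))"
  have g: "profile ?g" by (rule profile_quantile) auto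
  obtain V where V: "V \<in> uniform_rvs M" "AE \<omega> in M. norm (Y \<omega>) = ?g (V \<omega>)"
    by (rule profile_rep[of "\<lambda>\<omega>. norm (Y \<omega>)"]) auto
  \<comment> \<open>The rearranged power of the majorant \<open>K * norm (Y \<omega>)\<close>; its
    weighted integral is finite because the modular of \<open>Y\<close> is.\<close>
  define G where "G u = K powr r * ?g u powr r" for u
  have G: "profile G" unfolding G_def[abs_def] by (intro profile_cmult profile_powr g assms(1)) simp
  note [measurable] = profile_measurable[OF g] profile_measurable[OF G] uniform_measurable[OF V(1)]
  have pw: "norm (D n \<omega>) powr r \<le> K powr r * norm (Y \<omega>) powr r" if "\<omega> \<in> space M" for n \<omega>
  proof -
    have "norm (D n \<omega>) powr r \<le> (K * norm (Y \<omega>)) powr r" using K(2)[OF that] assms(1) by (intro powr_mono2) auto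
    then show ?thesis using K(1) by (simp add: powr_mult)
  qed
  have GY: "AE \<omega> in M. norm (D n \<omega>) powr r \<le> G (V \<omega>)" for n
    using V(2) AE_space
  proof eventually_elim
    case (elim \<omega>)
    show ?case unfolding G_def elim(1)[symmetric] by (rule pw[OF elim(2)])
  qed
  have fG: "tail_integral (\<lambda>u. s u * G u) 0 < \<infinity>"
  proof -
    have "tail_integral (\<lambda>u. s u * G u) 0 = ennreal (K powr r) * tail_integral (\<lambda>u. s u * ?g u powr r) 0"
      unfolding tail_integral_def
      by (subst nn_integral_cmult[symmetric]) (auto simp: G_def ennreal_mult ac_simps)
    also have "tail_integral (\<lambda>u. s u * ?g u powr r) 0 = modular M \<sigma> r Y"
      by (rule modular_profile[OF assms(1) V(1) g V(2), symmetric])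
    finally show ?thesis using fin by (simp add: ennreal_mult_less_top)
  qed
  have int0: "(\<lambda>n. \<integral>\<^sup>+\<omega>. ennreal (norm (D n \<omega>) powr r) \<partial>M) \<longlonglongrightarrow> (\<integral>\<^sup>+\<omega>. 0 \<partial>M)"
  proof (rule nn_integral_dominated_convergence[where w = "\<lambda>\<omega>. ennreal (K powr r) * ennreal (norm (Y \<omega>) powr r)"])
    have "(\<integral>\<^sup>+\<omega>. ennreal (norm (Y \<omega>) powr r) \<partial>M) < \<infinity>"
      by (rule order.strict_trans1[OF nn_integral_le_modular[OF assms(3,1)] fin])
    then show "(\<integral>\<^sup>+\<omega>. ennreal (K powr r) * ennreal (norm (Y \<omega>) powr r) \<partial>M) < \<infinity>"
      by (simp add: nn_integral_cmult ennreal_mult_less_top)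
    show "AE \<omega> in M. ennreal (norm (D n \<omega>) powr r) \<le> ennreal (K powr r) * ennreal (norm (Y \<omega>) powr r)" for n
      using pw by (intro AE_I2) (auto simp flip: ennreal_mult intro: ennreal_leI)
    show "AE \<omega> in M. (\<lambda>n. ennreal (norm (D n \<omega>) powr r)) \<longlonglongrightarrow> 0"
      using lim tendsto_ennrealI[of _ 0] by (intro AE_I2) auto
  qed measurable
  show ?thesis
  proof (rule order_tendstoI)
    fix e :: ennreal assume "0 < e"
    then obtain d where d: "0 < d" "d < e" using dense by blast
    then obtain x where x: "d = ennreal x" "0 < x" by (cases d) auto
    define d2 where "d2 = ennreal (x / 2)"
    have d2: "0 < d2" "d2 + d2 = d" using x by (auto simp: d2_def simp flip: ennreal_plus)
    from order_tendstoD(2)[OF tail_s_above_tendsto_0[OF G fG] d2(1)]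
    obtain k :: nat where k: "tail_integral (\<lambda>u. s_above (real k) u * G u) 0 < d2"
      using eventually_happens'[OF sequentially_bot] by blast
    have "(\<lambda>n. ennreal (real k) * (\<integral>\<^sup>+\<omega>. ennreal (norm (D n \<omega>) powr r) \<partial>M)) \<longlonglongrightarrow> ennreal (real k) * 0"
      using int0 by (intro ennreal_tendsto_cmult) auto
    then have "\<forall>\<^sub>F n in sequentially. ennreal (real k) * (\<integral>\<^sup>+\<omega>. ennreal (norm (D n \<omega>) powr r) \<partial>M) < d2"
      using d2(1) by (intro order_tendstoD(2)) auto
    then show "\<forall>\<^sub>F n in sequentially. modular M \<sigma> r (D n) < e"
    proof eventually_elim
      case (elim n)
      have "modular M \<sigma> r (D n) \<le> ennreal (real k) * (\<integral>\<^sup>+\<omega>. ennreal (norm (D n \<omega>) powr r) \<partial>M) + tail_integral (\<lambda>u. s_above (real k) u * G u) 0"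
        by (rule modular_le_split[OF assms(1,2) V(1) G GY]) simp
      also have "\<dots> \<le> d2 + d2" using elim k by (intro add_mono) auto
      finally show ?case using d d2 by simp
    qed
  qed simp
qed

text \<open>The same splitting with the majorant 1. It is the source of continuity and of countable
  additivity for the vector measure of a functional.\<close>

lemma modular_indicator_small:
  assumes "0 \<le> r" "0 < e"
  obtains d where "0 < d" "\<And>E. E \<in> sets M \<Longrightarrow> measure M E < d \<Longrightarrow> modular M \<sigma> r (indicat_real E) \<le> ennreal e"
proof -
  obtain V where V: "V \<in> uniform_rvs M" using uniform_nonempty by auto
  define G where "G = clip (\<lambda>_. 1)"
  have G: "profile G" unfolding G_def by (rule profile_clip) (auto intro: monotone_onI)
  have "tail_integral (\<lambda>u. s u * G u) 0 = tail_integral s 0" by (rule tail_integral_cong) (auto simp: G_def clip_def)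
  then have "tail_integral (\<lambda>u. s u * G u) 0 < \<infinity>" by (simp add: tail_s_0)
  from order_tendstoD(2)[OF tail_s_above_tendsto_0[OF G this], of "ennreal (e / 2)"]
  obtain k :: nat where k: "tail_integral (\<lambda>u. s_above (real k) u * G u) 0 < ennreal (e / 2)"
    using \<open>0 < e\<close> eventually_happens'[OF sequentially_bot] by fastforce
  show thesis
  \<comment> \<open>Chosen so that \<open>k * measure M E \<le> e / 2\<close>; the summand 1 keeps
    the denominator positive for \<open>k = 0\<close>.\<close>
  proof (rule that[of "e / (2 * (real k + 1))"])
    fix E assume E: "E \<in> sets M" "measure M E < e / (2 * (real k + 1))"
    have [measurable]: "E \<in> sets M" by fact
    have "modular M \<sigma> r (indicat_real E) \<le> ennreal (real k) * (\<integral>\<^sup>+\<omega>. ennreal (norm (indicat_real E \<omega>) powr r) \<partial>M) + tail_integral (\<lambda>u. s_above (real k) u * G u) 0"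
    proof (rule modular_le_split[OF assms(1) _ V G])
      show "AE \<omega> in M. norm (indicat_real E \<omega>) powr r \<le> G (V \<omega>)"
        using uniform_interior[OF V] by eventually_elim (auto simp: G_def clip_def indicator_def)
    qed auto
    also have "(\<integral>\<^sup>+\<omega>. ennreal (norm (indicat_real E \<omega>) powr r) \<partial>M) = (\<integral>\<^sup>+\<omega>. indicator E \<omega> \<partial>M)"
      by (rule nn_integral_cong) (auto simp: indicator_def)
    also have "\<dots> = ennreal (measure M E)" by (simp add: emeasure_eq_measure)
    also have "ennreal (real k) * ennreal (measure M E) + tail_integral (\<lambda>u. s_above (real k) u * G u) 0 \<le> ennreal (e / 2) + ennreal (e / 2)"
    proof (rule add_mono)
      have "real k * measure M E \<le> (real k + 1) * measure M E" by (simp add: mult_right_mono)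
      also have "\<dots> \<le> (real k + 1) * (e / (2 * (real k + 1)))" using E(2) by (intro mult_left_mono) auto
      also have "\<dots> = e / 2" by (simp add: field_simps)
      finally show "ennreal (real k) * ennreal (measure M E) \<le> ennreal (e / 2)" by (simp flip: ennreal_mult add: ennreal_leI)
    qed (use k in simp)
    also have "\<dots> = ennreal e" using \<open>0 < e\<close> by (simp flip: ennreal_plus)
    finally show "modular M \<sigma> r (indicat_real E) \<le> ennreal e" .
  qed (use \<open>0 < e\<close> in auto)
qed

end

section \<open>Density of simple functions and the representing density\<close>

context lp_dual
begin

lemma LS_diff: "Y \<in> LS \<Longrightarrow> Y' \<in> LS \<Longrightarrow> (\<lambda>\<omega>. Y \<omega> - Y' \<omega>) \<in> LS"
  using LS_add[of Y "\<lambda>\<omega>. (-1) *\<^sub>R Y' \<omega>"] LS_scaleR[of Y' "-1"] by simp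

text \<open>Simple approximations bounded by twice the norm of \<open>Y\<close> differ from
  \<open>Y\<close> by at most \<open>3 * norm (Y \<omega>)\<close>, so
  \<open>modular_dominated\<close> turns pointwise into norm convergence.\<close>

lemma LS_dense:
  assumes Y: "Y \<in> LS"
  obtains S where "\<And>n::nat. simple_function M (S n)" "(\<lambda>n. nrm (\<lambda>\<omega>. Y \<omega> - S n \<omega>)) \<longlonglongrightarrow> 0"
proof -
  obtain S where S: "\<And>i::nat. simple_into M UNIV (S i)" "\<And>\<omega>. \<omega> \<in> space M \<Longrightarrow> (\<lambda>i. S i \<omega>) \<longlonglongrightarrow> Y \<omega>"
    "\<And>i \<omega>. \<omega> \<in> space M \<Longrightarrow> norm (S i \<omega>) \<le> 2 * norm (Y \<omega>)"
    by (rule strongly_measurable_approx[OF LS_meas[OF Y]]) auto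
  have sf: "simple_function M (S i)" for i using S(1)[of i] by (simp add: simple_into_def)
  note [measurable] = strongly_measurable_norm_diff[OF LS_meas[OF Y] LS_meas[OF LS_simple[OF sf]]]
    strongly_measurable_norm[OF LS_meas[OF Y]]
  have lim: "(\<lambda>n. modular M \<sigma> p (\<lambda>\<omega>. Y \<omega> - S n \<omega>)) \<longlonglongrightarrow> 0"
  proof (rule modular_dominated[OF p_pos(2), where K = 3 and Y = Y])
    show "norm (Y \<omega> - S n \<omega>) \<le> 3 * norm (Y \<omega>)" if "\<omega> \<in> space M" for n \<omega>
      using norm_triangle_ineq4[of "Y \<omega>" "S n \<omega>"] S(3)[OF that, of n] by simp
    show "(\<lambda>n. norm (Y \<omega> - S n \<omega>) powr p) \<longlonglongrightarrow> 0" if "\<omega> \<in> space M" for \<omega>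
    proof -
      have "(\<lambda>n. norm (Y \<omega> - S n \<omega>)) \<longlonglongrightarrow> norm (Y \<omega> - Y \<omega>)" by (intro tendsto_intros S(2) that)
      then have "(\<lambda>n. norm (Y \<omega> - S n \<omega>) powr p) \<longlonglongrightarrow> 0 powr p"
        using p_pos by (intro tendsto_powr') auto
      then show ?thesis by simp
    qed
    show "modular M \<sigma> p Y < \<infinity>" using Y by (simp add: mem_LS)
  qed auto
  have "(\<lambda>n. nrm (\<lambda>\<omega>. Y \<omega> - S n \<omega>)) \<longlonglongrightarrow> 0"
  proof (rule LIMSEQ_I)
    fix e :: real assume e: "0 < e"
    then have "0 < ennreal ((e / 2) powr p)" by simp
    from order_tendstoD(2)[OF lim this] obtain N where N: "\<And>n. N \<le> n \<Longrightarrow> modular M \<sigma> p (\<lambda>\<omega>. Y \<omega> - S n \<omega>) < ennreal ((e / 2) powr p)"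
      by (auto simp: eventually_sequentially)
    have "nrm (\<lambda>\<omega>. Y \<omega> - S n \<omega>) \<le> e / 2" if "N \<le> n" for n
      using nrm_le_iff[OF LS_diff[OF Y LS_simple[OF sf]], of "e / 2" n] N[OF that] e by auto
    then have "norm (nrm (\<lambda>\<omega>. Y \<omega> - S n \<omega>) - 0) < e" if "N \<le> n" for n
      using that e by fastforce
    then show "\<exists>no. \<forall>n\<ge>no. norm (nrm (\<lambda>\<omega>. Y \<omega> - S n \<omega>) - 0) < e" by blast
  qed
  with sf show thesis by (rule that)
qed

lemma simple_function_decomp:
  fixes Y :: "'w \<Rightarrow> 'z::real_vector"
  assumes "simple_function M Y" "\<omega> \<in> space M"
  shows "Y \<omega> = (\<Sum>y\<in>Y ` space M. indicator (Y -` {y} \<inter> space M) \<omega> *\<^sub>R y)"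
proof -
  have "(\<Sum>y\<in>Y ` space M. indicator (Y -` {y} \<inter> space M) \<omega> *\<^sub>R y) = (\<Sum>y\<in>{Y \<omega>}. indicator (Y -` {y} \<inter> space M) \<omega> *\<^sub>R y)"
    using assms by (intro sum.mono_neutral_right) (auto simp: simple_function_def indicator_def)
  then show ?thesis using assms(2) by simp
qed

lemma LS_sum: "finite I \<Longrightarrow> (\<And>i. i \<in> I \<Longrightarrow> F i \<in> LS) \<Longrightarrow> (\<lambda>\<omega>. \<Sum>i\<in>I. F i \<omega>) \<in> LS"
proof (induction I rule: finite_induct)
  case empty then show ?case by (simp add: LS_simple)
next
  case (insert i I) then show ?case by (simp add: LS_add)
qed

lemma additive_sum:
  fixes \<Psi> :: "('w \<Rightarrow> 'x) \<Rightarrow> 'z::ab_group_add"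
  assumes add: "\<And>Y Y'. Y \<in> LS \<Longrightarrow> Y' \<in> LS \<Longrightarrow> \<Psi> (\<lambda>\<omega>. Y \<omega> + Y' \<omega>) = \<Psi> Y + \<Psi> Y'"
  shows "finite I \<Longrightarrow> (\<And>i. i \<in> I \<Longrightarrow> F i \<in> LS) \<Longrightarrow> \<Psi> (\<lambda>\<omega>. \<Sum>i\<in>I. F i \<omega>) = (\<Sum>i\<in>I. \<Psi> (F i))"
proof (induction I rule: finite_induct)
  case empty
  have "(\<lambda>_. 0) \<in> LS" by (rule LS_simple) simp
  from add[OF this this] show ?case by simp
next
  case (insert i I) then show ?case by (simp add: add LS_sum)
qed

lemma LS_indicator: "E \<in> sets M \<Longrightarrow> (\<lambda>\<omega>. indicator E \<omega> *\<^sub>R x) \<in> LS"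
  by (rule LS_simple) (rule simple_function_compose1[of _ "indicat_real E" "\<lambda>r. r *\<^sub>R x"], auto)

text \<open>The density \<open>Z\<close> is at first known only to be integrable and to represent
  the functional on simple functions. Boundedness of the functional there already forces
  \<open>dnrm Z \<le> C\<close>, which places \<open>Z\<close> in the dual space and makes both
  sides continuous, so that density finishes the proof.\<close>

lemma representation_from_RNP:
  assumes RNP: "radon_nikodym_property M DS" and \<phi>: "\<phi> \<in> vcarrier (continuous_dual \<L>)"
  shows "\<exists>Z\<in>LST. \<forall>Y\<in>LS. \<phi> (cls Y) = (\<integral>\<omega>. blinfun_apply (Z \<omega>) (Y \<omega>) \<partial>M)"
proof -
  define \<Phi> where "\<Phi> Y = \<phi> (cls Y)" for Y
  have \<Phi>_add: "\<Phi> (\<lambda>\<omega>. Y \<omega> + Y' \<omega>) = \<Phi> Y + \<Phi> Y'" if "Y \<in> LS" "Y' \<in> LS" for Y Y'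
    using \<phi> that by (simp add: mem_continuous_dual \<Phi>_def)
  have \<Phi>_sc: "\<Phi> (\<lambda>\<omega>. sc c (Y \<omega>)) = c * \<Phi> Y" if "Y \<in> LS" for c Y
    using \<phi> that by (simp add: mem_continuous_dual \<Phi>_def)
  have \<Phi>_cong: "\<Phi> Y = \<Phi> Y'" if "\<And>\<omega>. \<omega> \<in> space M \<Longrightarrow> Y \<omega> = Y' \<omega>" for Y Y'
    unfolding \<Phi>_def by (subst ae_class_eqI[of Y Y' M]) (auto intro!: AE_I2 that)
  obtain C0 where "\<forall>Y\<in>LS. norm (\<Phi> Y) \<le> C0 * nrm Y" using \<phi> by (auto simp: mem_continuous_dual \<Phi>_def)
  then obtain C where C: "0 < C" "\<And>Y. Y \<in> LS \<Longrightarrow> norm (\<Phi> Y) \<le> C * nrm Y"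
    by (metis enn2real_nonneg max.cobounded1 max.cobounded2 mult_right_mono order.trans zero_less_one less_le_trans)
  define ind :: "'w set \<Rightarrow> 'x \<Rightarrow> 'w \<Rightarrow> 'x" where "ind E x = (\<lambda>\<omega>. indicator E \<omega> *\<^sub>R x)" for E x
  have ind: "ind E x \<in> LS" if "E \<in> sets M" for E x unfolding ind_def by (rule LS_indicator[OF that])
  have nrm_ind: "nrm (ind E x) \<le> e * norm x" if "E \<in> sets M" "0 \<le> e" "modular M \<sigma> p (indicat_real E) \<le> ennreal (e powr p)" for E x e
  proof -
    have "modular M \<sigma> p (ind E x) = ennreal (norm x powr p) * modular M \<sigma> p (indicat_real E)"
      using that(1) by (intro modular_cmult) (auto simp: ind_def)
    also have "\<dots> \<le> ennreal (norm x powr p) * ennreal (e powr p)" by (intro mult_left_mono that) simp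
    also have "\<dots> = ennreal ((e * norm x) powr p)" using that(2) by (simp add: powr_mult mult.commute flip: ennreal_mult)
    finally show ?thesis using nrm_le_iff[OF ind[OF that(1)], of "e * norm x"] that(2) by simp
  qed
  have nrm_ind1: "nrm (ind E x) \<le> 1 * norm x" if "E \<in> sets M" for E x
    using that by (intro nrm_ind) (auto intro!: modular_le_1 p_pos simp: indicator_def)
  define \<mu> where "\<mu> E = Blinfun (\<lambda>x. \<Phi> (ind E x))" for E
  have \<mu>: "blinfun_apply (\<mu> E) x = \<Phi> (ind E x)" if E: "E \<in> sets M" for E x
  proof -
    have "bounded_linear (\<lambda>x. \<Phi> (ind E x))"
    proof (rule bounded_linear_intro)
      show "\<Phi> (ind E (x + y)) = \<Phi> (ind E x) + \<Phi> (ind E y)" for x y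
        using \<Phi>_add[OF ind[OF E, of x] ind[OF E, of y]] by (simp add: ind_def scaleR_add_right)
      show "\<Phi> (ind E (r *\<^sub>R x)) = r *\<^sub>R \<Phi> (ind E x)" for r x
        using \<Phi>_sc[OF ind[OF E, of x], of "of_real r"]
        by (simp add: ind_def scale_of_real scaleR_conv_of_real[where x = "\<Phi> _"] mult.commute)
      show "norm (\<Phi> (ind E x)) \<le> norm x * C" for x
        using order.trans[OF C(2)[OF ind[OF E]] mult_left_mono[OF nrm_ind1[OF E]]] C(1) by (simp add: mult.commute)
    qed
    then show ?thesis unfolding \<mu>_def by (simp add: bounded_linear_Blinfun_apply)
  qed
  have \<mu>_DS: "\<mu> E \<in> DS" if E: "E \<in> sets M" for E
  proof -
    have "ind E (sc c x) = (\<lambda>\<omega>. sc c (ind E x \<omega>))" for c x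
      by (auto simp: ind_def indicator_def)
    then show ?thesis by (simp add: dual_space_def \<mu>[OF E] \<Phi>_sc[OF ind[OF E]])
  qed
  \<comment> \<open>This serves twice: it is continuity with respect to the probability, and applied
    to the remainders of a disjoint union it upgrades finite to countable additivity.\<close>
  have small: "\<exists>\<delta>>0. \<forall>E\<in>sets M. measure M E < \<delta> \<longrightarrow> norm (\<mu> E) < \<epsilon>" if e: "0 < \<epsilon>" for \<epsilon>
  proof -
    define e where "e = \<epsilon> / (2 * C)"
    have e0: "0 < e" using e C(1) by (simp add: e_def)
    then obtain d where d: "0 < d" "\<And>E. E \<in> sets M \<Longrightarrow> measure M E < d \<Longrightarrow> modular M \<sigma> p (indicat_real E) \<le> ennreal (e powr p)"
      using modular_indicator_small[OF p_pos(2), of "e powr p"] by (metis powr_gt_zero less_irrefl)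
    have "norm (\<mu> E) < \<epsilon>" if E: "E \<in> sets M" "measure M E < d" for E
    proof -
      have "norm (\<mu> E) \<le> C * e"
      proof (rule norm_blinfun_bound)
        fix x
        have "norm (\<Phi> (ind E x)) \<le> C * nrm (ind E x)" by (rule C(2)[OF ind[OF E(1)]])
        also have "\<dots> \<le> C * (e * norm x)" using C(1) e0 by (intro mult_left_mono nrm_ind E d) auto
        finally show "norm (blinfun_apply (\<mu> E) x) \<le> C * e * norm x" by (simp add: \<mu>[OF E(1)] mult.assoc)
      qed (use C e0 in auto)
      also have "\<dots> < \<epsilon>" using e C(1) by (simp add: e_def)
      finally show ?thesis .
    qed
    then show ?thesis using d(1) by blast
  qed
  have \<mu>_Un: "\<mu> (E \<union> F) = \<mu> E + \<mu> F" if EF: "E \<in> sets M" "F \<in> sets M" "E \<inter> F = {}" for E F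
  proof (rule blinfun_eqI)
    fix x
    have "ind (E \<union> F) x = (\<lambda>\<omega>. ind E x \<omega> + ind F x \<omega>)"
      using EF(3) by (intro ext) (auto simp: ind_def split: split_indicator)
    then show "blinfun_apply (\<mu> (E \<union> F)) x = blinfun_apply (\<mu> E + \<mu> F) x"
      using EF by (simp add: \<mu> blinfun.add_left \<Phi>_add ind)
  qed
  have "vector_measure M DS \<mu>"
    unfolding vector_measure_def
  proof (intro conjI allI impI)
    show "\<mu> \<in> sets M \<rightarrow> DS" using \<mu>_DS by auto
    fix A :: "nat \<Rightarrow> 'w set" assume A: "range A \<subseteq> sets M" "disjoint_family A"
    have A' [measurable]: "A i \<in> sets M" for i using A(1) by auto
    have fin: "(\<Sum>i<n. \<mu> (A i)) = \<mu> (\<Union>i<n. A i)" for n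
    proof (induction n)
      case 0
      show ?case using \<mu>_Un[of "{}" "{}"] by simp
    next
      case (Suc n)
      have "A i \<inter> A n = {}" if "i < n" for i using disjoint_family_onD[OF A(2), of i n] that by auto
      then have "(\<Union>i<n. A i) \<inter> A n = {}" by auto
      then have "\<mu> ((\<Union>i<n. A i) \<union> A n) = \<mu> (\<Union>i<n. A i) + \<mu> (A n)"
        by (rule \<mu>_Un[rotated 2]) (rule sets.countable_UN', auto)
      moreover have "(\<Union>i<Suc n. A i) = (\<Union>i<n. A i) \<union> A n" by (auto simp: lessThan_Suc)
      ultimately show ?case using Suc by simp
    qed
    show "(\<lambda>i. \<mu> (A i)) sums \<mu> (\<Union>i. A i)"
      unfolding sums_def fin
    proof (rule LIMSEQ_I)
      fix e :: real assume "0 < e"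
      then obtain d where d: "0 < d" "\<And>E. E \<in> sets M \<Longrightarrow> measure M E < d \<Longrightarrow> norm (\<mu> E) < e" using small by blast
      have "(\<lambda>n. measure M (\<Union>i<n. A i)) \<longlonglongrightarrow> measure M (\<Union>n. \<Union>i<n. A i)"
        by (rule finite_Lim_measure_incseq) (auto intro!: incseq_SucI simp: lessThan_Suc)
      also have "(\<Union>n. \<Union>i<n. A i) = (\<Union>i. A i)" by auto
      finally obtain N where N: "\<And>n. N \<le> n \<Longrightarrow> norm (measure M (\<Union>i<n. A i) - measure M (\<Union>i. A i)) < d"
        using d(1) by (meson LIMSEQ_D)
      have "norm (\<mu> (\<Union>i<n. A i) - \<mu> (\<Union>i. A i)) < e" if n: "N \<le> n" for n
      proof -
        let ?D = "(\<Union>i. A i) - (\<Union>i<n. A i)"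
        have "measure M ?D = measure M (\<Union>i. A i) - measure M (\<Union>i<n. A i)"
          by (rule finite_measure_Diff) auto
        then have "norm (\<mu> ?D) < e" using N[OF n] by (intro d(2)) auto
        moreover have "\<mu> ((\<Union>i<n. A i) \<union> ?D) = \<mu> (\<Union>i<n. A i) + \<mu> ?D" by (rule \<mu>_Un) auto
        moreover have "(\<Union>i<n. A i) \<union> ?D = (\<Union>i. A i)" by auto
        ultimately show ?thesis by simp
      qed
      then show "\<exists>no. \<forall>n\<ge>no. norm (\<mu> (\<Union>i<n. A i) - \<mu> (\<Union>i. A i)) < e" by blast
    qed
  qed
  moreover have "continuous_wrt M \<mu>" unfolding continuous_wrt_def using small by blast
  moreover have "finite_variation M \<mu>"
    unfolding finite_variation_def
  proof (intro exI[of _ "2 * C"] allI impI)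
    fix \<pi> assume \<pi>: "finite \<pi>" "\<pi> \<subseteq> sets M" "partition_on (space M) \<pi>"
    \<comment> \<open>Half of the norm is enough for a near-norming vector; this is the origin of
      the constant \<open>2 * C\<close>.\<close>
    have "\<forall>E\<in>\<pi>. \<exists>y r. norm y \<le> 1 \<and> blinfun_apply (\<mu> E) y = of_real r \<and> (1 - 1 / 2) * norm (\<mu> E) \<le> r"
      using near_norming[OF \<mu>_DS, of _ "1 / 2"] \<pi>(2) by auto
    then obtain y where y: "\<forall>E\<in>\<pi>. \<exists>r. norm (y E) \<le> 1 \<and> blinfun_apply (\<mu> E) (y E) = of_real r \<and> (1 - 1 / 2) * norm (\<mu> E) \<le> r"
      by (auto dest!: bchoice)
    obtain r where r: "\<forall>E\<in>\<pi>. norm (y E) \<le> 1 \<and> blinfun_apply (\<mu> E) (y E) = of_real (r E) \<and> (1 - 1 / 2) * norm (\<mu> E) \<le> r E"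
      using bchoice[OF y] by blast
    have yr: "norm (y E) \<le> 1" "blinfun_apply (\<mu> E) (y E) = of_real (r E)" "norm (\<mu> E) \<le> 2 * r E" if "E \<in> \<pi>" for E
      using bspec[OF r that] by auto
    \<comment> \<open>Vectors of norm at most 1 on disjoint sets add up to a function of pointwise
      norm at most 1, hence of norm at most 1, while the values of the functional on the pieces are
      real and add without cancellation.\<close>
    define Y where "Y \<omega> = (\<Sum>E\<in>\<pi>. ind E (y E) \<omega>)" for \<omega>
    have Y: "Y \<in> LS" unfolding Y_def[abs_def] using \<pi> by (intro LS_sum ind) auto
    have "norm (Y \<omega>) \<le> 1" if \<omega>: "\<omega> \<in> space M" for \<omega>
    proof -
      obtain E where E: "E \<in> \<pi>" "\<omega> \<in> E" using \<pi>(3) \<omega> unfolding partition_on_def by auto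
      then have "F = E" if "F \<in> \<pi>" "\<omega> \<in> F" for F using \<pi>(3) that unfolding partition_on_def disjoint_def by auto
      then have "Y \<omega> = (\<Sum>E\<in>{E}. ind E (y E) \<omega>)"
        unfolding Y_def using E(1) \<pi>(1) by (intro sum.mono_neutral_right) (auto simp: ind_def indicator_def)
      then show ?thesis using yr(1)[OF E(1)] E(2) by (simp add: ind_def)
    qed
    then have "nrm Y \<le> 1" using nrm_le_iff[OF Y, of 1] modular_le_1[OF p_pos(2), of Y] by (auto intro: AE_I2)
    have "(\<Sum>E\<in>\<pi>. norm (\<mu> E)) \<le> (\<Sum>E\<in>\<pi>. 2 * r E)" by (rule sum_mono) (rule yr(3))
    also have "\<dots> = 2 * (\<Sum>E\<in>\<pi>. r E)" by (simp add: sum_distrib_left)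
    also have "(\<Sum>E\<in>\<pi>. r E) \<le> norm (of_real (\<Sum>E\<in>\<pi>. r E) :: 'k)" by (simp del: of_real_sum)
    also have "of_real (\<Sum>E\<in>\<pi>. r E) = (\<Sum>E\<in>\<pi>. \<Phi> (ind E (y E)))"
      unfolding of_real_sum using \<pi>(2) by (intro sum.cong) (auto simp: yr(2)[symmetric] \<mu>)
    also have "\<dots> = \<Phi> Y" unfolding Y_def[abs_def]
      using \<pi> ind by (intro additive_sum[where \<Psi> = \<Phi>, symmetric]) (auto simp: \<Phi>_add)
    also have "norm (\<Phi> Y) \<le> C * 1" using C(2)[OF Y] C(1) \<open>nrm Y \<le> 1\<close> by (meson less_imp_le mult_left_mono order.trans)
    finally show "(\<Sum>E\<in>\<pi>. norm (\<mu> E)) \<le> 2 * C" by simp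
  qed
  ultimately obtain Z where Z: "bochner_integrable_into M DS Z"
    "\<And>E. E \<in> sets M \<Longrightarrow> has_bochner_integral_into M DS (\<lambda>\<omega>. indicator E \<omega> *\<^sub>R Z \<omega>) (\<mu> E)"
    using RNP unfolding radon_nikodym_property_def by blast
  obtain z where z: "has_bochner_integral_into M DS Z z" using Z(1) unfolding bochner_integrable_into_def by blast
  have Zm: "strongly_measurable M DS Z" using z by (simp add: has_bochner_integral_into_def)
  have Zfin: "(\<integral>\<^sup>+\<omega>. ennreal (norm (Z \<omega>)) \<partial>M) < \<infinity>" by (rule has_bochner_integral_into_finite[OF z])
  have Z_ind: "has_bochner_integral M (\<lambda>\<omega>. blinfun_apply (Z \<omega>) (ind E x \<omega>)) (\<Phi> (ind E x))" if "E \<in> sets M" for E x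
    using has_bochner_integral_into_linear[OF Z(2)[OF that] blinfun.bounded_linear_left[of x]]
    by (simp add: \<mu>[OF that] ind_def blinfun.scaleR_left blinfun.scaleR_right)
  have Z_simple: "(\<integral>\<omega>. blinfun_apply (Z \<omega>) (Y \<omega>) \<partial>M) = \<Phi> Y" if Y: "simple_function M Y" for Y
  proof -
    let ?E = "\<lambda>y. Y -` {y} \<inter> space M"
    have fin: "finite (Y ` space M)" and E: "?E y \<in> sets M" for y using Y by (auto simp: simple_functionD)
    have dec: "Y \<omega> = (\<Sum>y\<in>Y ` space M. ind (?E y) y \<omega>)" if "\<omega> \<in> space M" for \<omega>
      unfolding ind_def by (rule simple_function_decomp[OF Y that])
    have "(\<integral>\<omega>. blinfun_apply (Z \<omega>) (Y \<omega>) \<partial>M) = (\<integral>\<omega>. (\<Sum>y\<in>Y ` space M. blinfun_apply (Z \<omega>) (ind (?E y) y \<omega>)) \<partial>M)"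
      by (rule Bochner_Integration.integral_cong[OF refl]) (simp only: blinfun.sum_right[symmetric] dec[symmetric])
    also have "\<dots> = (\<Sum>y\<in>Y ` space M. \<Phi> (ind (?E y) y))"
      by (rule has_bochner_integral_integral_eq, rule has_bochner_integral_sum) (rule Z_ind[OF E])
    also have "\<dots> = \<Phi> (\<lambda>\<omega>. \<Sum>y\<in>Y ` space M. ind (?E y) y \<omega>)"
      using fin E ind by (intro additive_sum[where \<Psi> = \<Phi>, symmetric]) (auto simp: \<Phi>_add)
    also have "\<dots> = \<Phi> Y" by (rule \<Phi>_cong) (rule dec[symmetric])
    finally show ?thesis .
  qed
  have "dnrm Z \<le> ennreal C"
    by (rule dual_sup_le_functional[OF Zm Zfin]) (use C LS_simple in \<open>auto simp: Z_simple\<close>)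
  then have ZL: "Z \<in> LST" using Zm by (auto simp: mem_LST intro: order.strict_trans1)
  have "\<Phi> Y = (\<integral>\<omega>. blinfun_apply (Z \<omega>) (Y \<omega>) \<partial>M)" if Y: "Y \<in> LS" for Y
  proof -
    obtain S where S: "\<And>n::nat. simple_function M (S n)" "(\<lambda>n. nrm (\<lambda>\<omega>. Y \<omega> - S n \<omega>)) \<longlonglongrightarrow> 0"
      by (rule LS_dense[OF Y]) blast
    let ?J = "\<lambda>Y. \<integral>\<omega>. blinfun_apply (Z \<omega>) (Y \<omega>) \<partial>M"
    have bd: "norm (\<Phi> Y - ?J Y) \<le> (C + enn2real (dnrm Z)) * nrm (\<lambda>\<omega>. Y \<omega> - S n \<omega>)" for n
    proof -
      have SL: "S n \<in> LS" by (rule LS_simple[OF S(1)])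
      let ?D = "\<lambda>\<omega>. Y \<omega> - S n \<omega>"
      have D: "?D \<in> LS" by (rule LS_diff[OF Y SL])
      have "\<Phi> Y = \<Phi> ?D + \<Phi> (S n)" using \<Phi>_add[OF D SL] by simp
      moreover have "?J Y = ?J ?D + ?J (S n)"
        using Bochner_Integration.integral_add[OF pairing(1)[OF ZL D] pairing(1)[OF ZL SL]] by (simp add: blinfun.diff_right)
      ultimately have "norm (\<Phi> Y - ?J Y) = norm (\<Phi> ?D - ?J ?D)" by (simp add: Z_simple[OF S(1)])
      also have "\<dots> \<le> norm (\<Phi> ?D) + norm (?J ?D)" by (rule norm_triangle_ineq4)
      also have "\<dots> \<le> C * nrm ?D + enn2real (dnrm Z) * nrm ?D" by (intro add_mono C(2)[OF D] pairing(2)[OF ZL D])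
      finally show ?thesis by (simp add: distrib_right)
    qed
    have "(\<lambda>n. (C + enn2real (dnrm Z)) * nrm (\<lambda>\<omega>. Y \<omega> - S n \<omega>)) \<longlonglongrightarrow> 0" by (rule tendsto_mult_right_zero[OF S(2)])
    then have "norm (\<Phi> Y - ?J Y) \<le> 0" by (rule LIMSEQ_le_const) (use bd in auto)
    then show ?thesis by simp
  qed
  then show ?thesis using ZL unfolding \<Phi>_def by blast
qed

end

section \<open>Surjectivity implies the Radon-Nikodym property\<close>

lemma vector_measure_empty: assumes "vector_measure M S \<mu>" shows "\<mu> {} = 0"
proof -
  have "(\<lambda>i::nat. \<mu> {}) sums \<mu> (\<Union>i::nat. {})"
    using assms unfolding vector_measure_def by (auto simp: disjoint_family_on_def dest!: spec[of _ "\<lambda>_. {}"])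
  then have "(\<lambda>i::nat. \<mu> {}) \<longlonglongrightarrow> 0" by (intro summable_LIMSEQ_zero sums_summable)
  then show ?thesis by (simp add: LIMSEQ_const_iff)
qed

lemma vector_measure_Un:
  assumes "vector_measure M S \<mu>" "E \<in> sets M" "F \<in> sets M" "E \<inter> F = {}" shows "\<mu> (E \<union> F) = \<mu> E + \<mu> F"
proof -
  have "disjoint_family (binaryset E F)"
    using assms(4) by (auto simp: disjoint_family_on_def binaryset_def split: if_split_asm)
  moreover have "range (binaryset E F) \<subseteq> sets M" by (simp add: range_binaryset_eq assms)
  ultimately have "(\<lambda>i. \<mu> (binaryset E F i)) sums \<mu> (\<Union>i. binaryset E F i)"
    using assms(1) unfolding vector_measure_def by blast
  moreover have "(\<lambda>i. \<mu> (binaryset E F i)) sums (\<mu> E + \<mu> F)"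
    by (rule binaryset_sums) (rule vector_measure_empty[OF assms(1)])
  ultimately show ?thesis using sums_unique2 by (simp add: UN_binaryset_eq)
qed

text \<open>A finite disjoint family becomes a partition by adding the uncovered part and deleting
  the empty set, which \<open>partition_on\<close> excludes and on which the measure
  vanishes.\<close>

lemma disjoint_variation_le:
  assumes "vector_measure M S \<mu>"
    and C: "\<And>\<pi>. finite \<pi> \<Longrightarrow> \<pi> \<subseteq> sets M \<Longrightarrow> partition_on (space M) \<pi> \<Longrightarrow> (\<Sum>E\<in>\<pi>. norm (\<mu> E)) \<le> C"
    and F: "finite F" "F \<subseteq> sets M" "disjoint F"
  shows "(\<Sum>E\<in>F. norm (\<mu> E)) \<le> C"
proof -
  let ?R = "space M - \<Union>F"
  let ?\<pi> = "insert ?R F - {{}}"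
  have R: "?R \<in> sets M" using F by auto
  have "F \<subseteq> Pow (space M)" using F(2) sets.space_closed by blast
  moreover have "disjoint ?\<pi>"
    unfolding disjoint_def
  proof (intro ballI impI)
    fix a b assume "a \<in> ?\<pi>" "b \<in> ?\<pi>" "a \<noteq> b"
    then consider "a \<in> F" "b \<in> F" | "a = ?R" "b \<in> F" | "a \<in> F" "b = ?R" by blast
    then show "a \<inter> b = {}"
    proof cases
      case 1 then show ?thesis using F(3) \<open>a \<noteq> b\<close> unfolding disjoint_def by blast
    qed blast+
  qed
  ultimately have "partition_on (space M) ?\<pi>" unfolding partition_on_def by blast
  then have "(\<Sum>E\<in>?\<pi>. norm (\<mu> E)) \<le> C" using F R by (intro C) auto
  moreover have "(\<Sum>E\<in>F. norm (\<mu> E)) \<le> (\<Sum>E\<in>insert ?R F. norm (\<mu> E))"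
    using F(1) by (intro sum_mono2) auto
  moreover have "(\<Sum>E\<in>insert ?R F. norm (\<mu> E)) = (\<Sum>E\<in>?\<pi>. norm (\<mu> E))"
    using F(1) by (intro sum.mono_neutral_right) (auto simp: vector_measure_empty[OF assms(1)])
  ultimately show ?thesis by simp
qed

text \<open>Exhaustion: remove a maximal disjoint family of sets on which the average of \<open>\<mu>\<close> exceeds \<open>n\<close>.\<close>

lemma (in prob_space) bounded_average_set:
  assumes \<mu>: "vector_measure M S \<mu>" and ac: "continuous_wrt M \<mu>"
    and C: "\<And>\<pi>. finite \<pi> \<Longrightarrow> \<pi> \<subseteq> sets M \<Longrightarrow> partition_on (space M) \<pi> \<Longrightarrow> (\<Sum>E\<in>\<pi>. norm (\<mu> E)) \<le> C"
    and n: "0 < n"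
  obtains A where "A \<in> sets M" "measure M (space M - A) \<le> C / n"
    "\<And>E. E \<in> sets M \<Longrightarrow> E \<subseteq> A \<Longrightarrow> norm (\<mu> E) \<le> n * measure M E"
proof -
  define bad where "bad = {B \<in> sets M. n * measure M B < norm (\<mu> B)}"
  have bad_sets: "B \<in> sets M" if "B \<in> bad" for B using that by (simp add: bad_def)
  have bad_ne: "{} \<notin> bad" by (simp add: bad_def vector_measure_empty[OF \<mu>])
  \<comment> \<open>Continuity makes the measure vanish on null sets, so a null set is never bad.
    This positivity is what makes the maximal family countable.\<close>
  have bad_pos: "measure M B \<noteq> 0" if B: "B \<in> bad" for B
  proof
    assume 0: "measure M B = 0"
    have pos: "0 < norm (\<mu> B)" using B 0 by (simp add: bad_def)
    then obtain d where "0 < d" "\<And>E. E \<in> sets M \<Longrightarrow> measure M E < d \<Longrightarrow> norm (\<mu> E) < norm (\<mu> B)"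
      using ac unfolding continuous_wrt_def by blast
    from this(2)[OF bad_sets[OF B]] show False using \<open>0 < d\<close> 0 by simp
  qed
  let ?D = "{\<B>. \<B> \<subseteq> bad \<and> disjoint \<B>}"
  have "\<exists>\<B>\<in>?D. \<forall>X\<in>?D. \<B> \<subseteq> X \<longrightarrow> X = \<B>"
  proof (rule subset_Zorn')
    fix c assume c: "subset.chain ?D c"
    then have cD: "c \<subseteq> ?D" and ch: "\<And>X Y. X \<in> c \<Longrightarrow> Y \<in> c \<Longrightarrow> X \<subseteq> Y \<or> Y \<subseteq> X"
      by (auto simp: subset_chain_def)
    have "disjoint (\<Union>c)"
      unfolding disjoint_def
    proof (intro ballI impI)
      fix a b assume "a \<in> \<Union>c" "b \<in> \<Union>c" "a \<noteq> b"
      then obtain X Y where XY: "X \<in> c" "a \<in> X" "Y \<in> c" "b \<in> Y" by auto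
      then have "a \<in> Y \<and> b \<in> Y \<or> a \<in> X \<and> b \<in> X" using ch[of X Y] by auto
      then show "a \<inter> b = {}" using XY cD \<open>a \<noteq> b\<close> unfolding disjoint_def by blast
    qed
    then show "\<Union>c \<in> ?D" using cD by auto
  qed
  then obtain \<B> where \<B>: "\<B> \<subseteq> bad" "disjoint \<B>" "\<And>X. X \<subseteq> bad \<Longrightarrow> disjoint X \<Longrightarrow> \<B> \<subseteq> X \<Longrightarrow> X = \<B>" by auto
  have fin: "(\<Sum>B\<in>F. measure M B) \<le> C / n" if F: "finite F" "F \<subseteq> \<B>" for F
  proof -
    have "n * (\<Sum>B\<in>F. measure M B) = (\<Sum>B\<in>F. n * measure M B)" by (rule sum_distrib_left)
    also have "\<dots> \<le> (\<Sum>B\<in>F. norm (\<mu> B))" using F \<B>(1) by (intro sum_mono) (auto simp: bad_def less_imp_le)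
    also have "\<dots> \<le> C"
    proof (rule disjoint_variation_le[OF \<mu> C F(1)])
      show "F \<subseteq> sets M" using F(2) \<B>(1) bad_sets by blast
      show "disjoint F" using \<B>(2) F(2) unfolding disjoint_def by blast
    qed
    finally show ?thesis using n by (simp add: field_simps)
  qed
  \<comment> \<open>Finite subfamilies have bounded total probability and every member has positive
    probability, hence the family is countable and its union measurable.\<close>
  have "(\<lambda>B. measure M B) summable_on \<B>"
    by (rule nonneg_bdd_above_summable_on) (use fin in \<open>auto simp: bdd_above_def\<close>)
  then have "countable {B \<in> \<B>. measure M B \<noteq> 0}" by (rule summable_countable_real)
  moreover have "{B \<in> \<B>. measure M B \<noteq> 0} = \<B>" using bad_pos \<B>(1) by auto
  ultimately have cnt: "countable \<B>" by simp
  have [measurable]: "\<Union>\<B> \<in> sets M" using cnt \<B>(1) bad_sets by (intro sets.countable_Union) auto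
  have "measure M (\<Union>\<B>) \<le> C / n"
  proof (cases "\<B> = {}")
    case True
    then show ?thesis using fin[of "{}"] by simp
  next
    case False
    let ?f = "from_nat_into \<B>"
    have rng: "range ?f = \<B>" by (rule range_from_nat_into[OF False cnt])
    then have fB: "?f i \<in> \<B>" for i by auto
    then have [measurable]: "?f i \<in> sets M" for i using \<B>(1) bad_sets by blast
    have "(\<lambda>k. measure M (\<Union>i<k. ?f i)) \<longlonglongrightarrow> measure M (\<Union>k. \<Union>i<k. ?f i)"
      by (rule finite_Lim_measure_incseq) (auto intro!: incseq_SucI simp: lessThan_Suc)
    also have "(\<Union>k. \<Union>i<k. ?f i) = \<Union>(range ?f)" by auto
    also have "\<dots> = \<Union>\<B>" by (simp only: rng)
    finally have lim: "(\<lambda>k. measure M (\<Union>i<k. ?f i)) \<longlonglongrightarrow> measure M (\<Union>\<B>)" .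
    have "measure M (\<Union>i<k. ?f i) \<le> C / n" for k
    proof -
      have "measure M (\<Union>B\<in>?f ` {..<k}. B) \<le> (\<Sum>B\<in>?f ` {..<k}. measure M B)"
        by (rule measure_UNION_le) auto
      also have "\<dots> \<le> C / n" by (rule fin) (use fB in auto)
      finally show ?thesis by simp
    qed
    then show ?thesis by (intro LIMSEQ_le_const2[OF lim]) auto
  qed
  moreover have "\<Union>\<B> \<subseteq> space M" by (rule sets.sets_into_space) measurable
  ultimately show thesis
  proof (intro that[of "space M - \<Union>\<B>"])
    fix E assume E: "E \<in> sets M" "E \<subseteq> space M - \<Union>\<B>"
    show "norm (\<mu> E) \<le> n * measure M E"
    proof (rule ccontr)
      assume "\<not> ?thesis"
      \<comment> \<open>A bad set outside the union could be added to the family; maximality leaves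
        only the empty set, which is not bad.\<close>
      then have "E \<in> bad" using E(1) by (simp add: bad_def not_le)
      moreover have "disjoint (insert E \<B>)" using \<B>(2) E(2) unfolding disjoint_def by auto
      ultimately have "insert E \<B> = \<B>" using \<B>(1) by (intro \<B>(3)) auto
      then have "E = {}" using E(2) by auto
      then show False using \<open>E \<in> bad\<close> bad_ne by simp
    qed
  qed (auto simp: double_diff)
qed

text \<open>A diagonal argument: the \<open>i\<close>-th approximant uses the \<open>i\<close>-th
  approximations on the first \<open>i\<close> pieces and 0 elsewhere. It stays simple, and each
  point is treated correctly as soon as \<open>i\<close> exceeds the index of its piece.\<close>

lemma strongly_measurable_glue:
  assumes E: "\<And>n::nat. E n \<in> sets M" "disjoint_family E" and Z: "\<And>n. strongly_measurable M S (Z n)" and "0 \<in> S"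
    and W: "\<And>n \<omega>. \<omega> \<in> E n \<Longrightarrow> W \<omega> = Z n \<omega>" "\<And>\<omega>. \<omega> \<notin> (\<Union>n. E n) \<Longrightarrow> W \<omega> = 0"
  shows "strongly_measurable M S W"
proof -
  have "\<exists>s. \<forall>n. (\<forall>i::nat. simple_into M S (s n i)) \<and> (\<forall>\<omega>\<in>space M. (\<lambda>i. s n i \<omega>) \<longlonglongrightarrow> Z n \<omega>)"
    using Z unfolding strongly_measurable_def by (intro choice) blast
  then obtain s where s: "\<And>n i. simple_into M S (s n i)" "\<And>n \<omega>. \<omega> \<in> space M \<Longrightarrow> (\<lambda>i. s n i \<omega>) \<longlonglongrightarrow> Z n \<omega>" by blast
  define t where "t = (\<lambda>i. rec_nat (\<lambda>_. 0) (\<lambda>k g \<omega>. if \<omega> \<in> E k then s k i \<omega> else g \<omega>))"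
  have t0: "t i 0 = (\<lambda>_. 0)" and tS: "t i (Suc k) = (\<lambda>\<omega>. if \<omega> \<in> E k then s k i \<omega> else t i k \<omega>)" for i k
    unfolding t_def by simp_all
  have simple: "simple_into M S (t i k)" for i k
  proof (induction k)
    case 0 show ?case using \<open>0 \<in> S\<close> by (auto simp: t0 simple_into_def)
  next
    case (Suc k)
    have "simple_function M (\<lambda>\<omega>. if \<omega> \<in> E k then s k i \<omega> else t i k \<omega>)"
      using Suc s(1)[of k i] E(1)[of k] by (intro simple_function_If_set) (auto simp: simple_into_def)
    then show ?case using Suc s(1)[of k i] by (auto simp: tS simple_into_def)
  qed
  have in_E: "t i k \<omega> = s n i \<omega>" if "\<omega> \<in> E n" "n < k" for i k n \<omega>
    using that(2)
  proof (induction k)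
    case (Suc k)
    show ?case
    proof (cases "n = k")
      case False
      then have "\<omega> \<notin> E k" using disjoint_family_onD[OF E(2), of n k] that(1) by auto
      then show ?thesis using Suc False by (simp add: tS)
    qed (use that in \<open>simp add: tS\<close>)
  qed simp
  have out_E: "t i k \<omega> = 0" if "\<omega> \<notin> (\<Union>n. E n)" for i k \<omega>
    using that by (induction k) (auto simp: t0 tS)
  have "(\<lambda>i. t i i \<omega>) \<longlonglongrightarrow> W \<omega>" if \<omega>: "\<omega> \<in> space M" for \<omega>
  proof (cases "\<omega> \<in> (\<Union>n. E n)")
    case True
    then obtain n where n: "\<omega> \<in> E n" by auto
    have "\<forall>\<^sub>F i in sequentially. t i i \<omega> = s n i \<omega>"
      using eventually_gt_at_top[of n] by eventually_elim (rule in_E[OF n])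
    then show ?thesis using s(2)[OF \<omega>, of n] W(1)[OF n] by (simp add: tendsto_cong)
  next
    case False
    then show ?thesis using out_E[OF False] W(2)[OF False] by simp
  qed
  moreover have "W \<in> space M \<rightarrow> S"
  proof
    fix \<omega> assume \<omega>: "\<omega> \<in> space M"
    show "W \<omega> \<in> S"
    proof (cases "\<omega> \<in> (\<Union>n. E n)")
      case True
      then show ?thesis using Z \<omega> W(1) unfolding strongly_measurable_def by (metis Pi_mem UN_E)
    qed (use W(2) \<open>0 \<in> S\<close> in auto)
  qed
  ultimately show ?thesis unfolding strongly_measurable_def using simple by (intro conjI exI[of _ "\<lambda>i. t i i"]) auto
qed

context lp_dual
begin

text \<open>For \<open>p \<ge> 1\<close> a nonnegative number is at most 1 plus its
  \<open>p\<close>-th power, and the integral of the power is at most the modular. This gives the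
  embedding into \<open>L^1\<close> with constant 2.\<close>

lemma dual_sup_1_le_2: "dual_sup p (\<lambda>_. 1) \<le> 2"
  unfolding dual_sup_def
proof (rule SUP_least, safe)
  fix f :: "'w \<Rightarrow> real" assume f: "simple_function M f" "\<forall>\<omega>. 0 \<le> f \<omega>" "modular M \<sigma> p f \<le> 1"
  note [measurable] = borel_measurable_simple_function[OF f(1)]
  have "(\<integral>\<^sup>+\<omega>. ennreal (1 * f \<omega>) \<partial>M) \<le> (\<integral>\<^sup>+\<omega>. 1 + ennreal (norm (f \<omega>) powr p) \<partial>M)"
  proof (rule nn_integral_mono)
    fix \<omega>
    have "f \<omega> \<le> 1 + norm (f \<omega>) powr p"
    proof (cases "f \<omega> \<le> 1")
      case False
      then have "f \<omega> powr 1 \<le> f \<omega> powr p" using p_ge_1 by (intro powr_mono) auto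
      then show ?thesis using False by simp
    qed (simp add: add_increasing2)
    then have "ennreal (1 * f \<omega>) \<le> ennreal (1 + norm (f \<omega>) powr p)" by (intro ennreal_leI) simp
    then show "ennreal (1 * f \<omega>) \<le> 1 + ennreal (norm (f \<omega>) powr p)" by simp
  qed
  also have "\<dots> = 1 + (\<integral>\<^sup>+\<omega>. ennreal (norm (f \<omega>) powr p) \<partial>M)"
    by (subst nn_integral_add) (auto simp: emeasure_space_1)
  also have "\<dots> \<le> 1 + 1" using f(3) p_pos by (intro add_left_mono order.trans[OF nn_integral_le_modular]) auto
  finally show "(\<integral>\<^sup>+\<omega>. ennreal (1 * f \<omega>) \<partial>M) \<le> 2" by simp
qed

lemma LS_integrable:
  assumes Y: "Y \<in> LS"
  shows "integrable M (\<lambda>\<omega>. norm (Y \<omega>))" "(\<integral>\<omega>. norm (Y \<omega>) \<partial>M) \<le> 2 * nrm Y"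
proof -
  note [measurable] = strongly_measurable_norm[OF LS_meas[OF Y]]
  have le: "(\<integral>\<^sup>+\<omega>. ennreal (norm (Y \<omega>)) \<partial>M) \<le> ennreal (2 * c)" if c: "0 < c" "nrm Y \<le> c" for c
  proof -
    have "modular M \<sigma> p (\<lambda>\<omega>. norm (Y \<omega>)) = modular M \<sigma> p Y" using p_pos by (intro modular_cong) auto
    then have "(\<integral>\<^sup>+\<omega>. ennreal (1 * norm (Y \<omega>)) \<partial>M) \<le> ennreal c * dual_sup p (\<lambda>_. 1)"
      using nrm_le_iff[OF Y, of c] c p_pos by (intro dual_sup_bound) auto
    also have "\<dots> \<le> ennreal c * 2" by (intro mult_left_mono dual_sup_1_le_2) simp
    also have "\<dots> = ennreal (2 * c)" using c by (simp add: ennreal_mult mult.commute)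
    finally show ?thesis by simp
  qed
  have "(\<integral>\<^sup>+\<omega>. ennreal (norm (Y \<omega>)) \<partial>M) < \<infinity>"
    by (rule order.strict_trans1[OF le[of "nrm Y + 1"]]) (auto intro: add_nonneg_pos)
  then show int: "integrable M (\<lambda>\<omega>. norm (Y \<omega>))" by (intro integrableI_nonneg) auto
  show "(\<integral>\<omega>. norm (Y \<omega>) \<partial>M) \<le> 2 * nrm Y"
  proof (rule field_le_epsilon)
    fix e :: real assume e: "0 < e"
    have pos: "0 < nrm Y + e / 2" using e by (intro add_nonneg_pos) auto
    have "ennreal (\<integral>\<omega>. norm (Y \<omega>) \<partial>M) = (\<integral>\<^sup>+\<omega>. ennreal (norm (Y \<omega>)) \<partial>M)"
      by (rule nn_integral_eq_integral[OF int, symmetric]) simp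
    also have "\<dots> \<le> ennreal (2 * (nrm Y + e / 2))" using e by (intro le pos) simp
    finally have "ennreal (\<integral>\<omega>. norm (Y \<omega>) \<partial>M) \<le> ennreal (2 * (nrm Y + e / 2))" .
    moreover have "0 \<le> 2 * (nrm Y + e / 2)" using e by simp
    ultimately show "(\<integral>\<omega>. norm (Y \<omega>) \<partial>M) \<le> 2 * nrm Y + e" using ennreal_le_iff by fastforce
  qed
qed

section \<open>The functional of a vector measure with bounded averages\<close>

context
  fixes \<nu> :: "'w set \<Rightarrow> 'x \<Rightarrow>\<^sub>L 'k" and K :: real
  assumes \<nu>_DS: "\<And>E. E \<in> sets M \<Longrightarrow> \<nu> E \<in> DS"
    and \<nu>_empty: "\<nu> {} = 0" and \<nu>_Un: "\<And>E F. E \<in> sets M \<Longrightarrow> F \<in> sets M \<Longrightarrow> E \<inter> F = {} \<Longrightarrow> \<nu> (E \<union> F) = \<nu> E + \<nu> F"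
    and \<nu>_le: "\<And>E. E \<in> sets M \<Longrightarrow> norm (\<nu> E) \<le> K * measure M E"
begin

text \<open>The integral of a simple function with values in \<open>X\<close> against a measure with
  values in the dual.\<close>

definition sint :: "('w \<Rightarrow> 'x) \<Rightarrow> 'k" where
  "sint S = (\<Sum>y\<in>S ` space M. blinfun_apply (\<nu> (S -` {y} \<inter> space M)) y)"

lemma K_nonneg: "0 \<le> K"
  using order.trans[OF norm_ge_zero \<nu>_le[OF sets.top]] by (simp add: prob_space)

lemma \<nu>_UN: "finite I \<Longrightarrow> (\<And>i. i \<in> I \<Longrightarrow> A i \<in> sets M) \<Longrightarrow> disjoint_family_on A I \<Longrightarrow> \<nu> (\<Union>i\<in>I. A i) = (\<Sum>i\<in>I. \<nu> (A i))"
proof (induction I rule: finite_induct)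
  case (insert i I)
  have "A i \<inter> (\<Union>j\<in>I. A j) = {}"
    using insert.prems(2) insert.hyps(2) by (auto simp: disjoint_family_on_def)
  moreover have "disjoint_family_on A I" using insert.prems(2) by (auto simp: disjoint_family_on_def)
  ultimately show ?case using insert by (simp add: \<nu>_Un sets.finite_UN)
qed (simp add: \<nu>_empty)

text \<open>The integral may be computed over any finer finite partition. With the pair of two
  simple functions as \<open>g\<close>, additivity becomes termwise.\<close>

lemma sint_partition:
  fixes g :: "'w \<Rightarrow> 'z"
  assumes g: "simple_function M g" and S: "\<And>\<omega>. \<omega> \<in> space M \<Longrightarrow> S \<omega> = v (g \<omega>)"
  shows "sint S = (\<Sum>z\<in>g ` space M. blinfun_apply (\<nu> (g -` {z} \<inter> space M)) (v z))"
proof -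
  have fin: "finite (g ` space M)" and sets: "g -` {z} \<inter> space M \<in> sets M" for z using g by (auto simp: simple_functionD)
  have img: "S ` space M = v ` g ` space M" using S by (auto simp: image_image)
  have "(\<Sum>z\<in>g ` space M. blinfun_apply (\<nu> (g -` {z} \<inter> space M)) (v z)) =
      (\<Sum>y\<in>v ` g ` space M. \<Sum>z\<in>{z \<in> g ` space M. v z = y}. blinfun_apply (\<nu> (g -` {z} \<inter> space M)) (v z))"
    by (rule sum.image_gen[OF fin])
  also have "\<dots> = sint S"
    unfolding sint_def img
  proof (rule sum.cong[OF refl])
    fix y assume "y \<in> v ` g ` space M"
    let ?I = "{z \<in> g ` space M. v z = y}"
    have "S -` {y} \<inter> space M = (\<Union>z\<in>?I. g -` {z} \<inter> space M)" using S by auto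
    then have "\<nu> (S -` {y} \<inter> space M) = (\<Sum>z\<in>?I. \<nu> (g -` {z} \<inter> space M))"
      using fin sets by (simp only:) (rule \<nu>_UN, auto simp: disjoint_family_on_def)
    then show "(\<Sum>z\<in>?I. blinfun_apply (\<nu> (g -` {z} \<inter> space M)) (v z)) = blinfun_apply (\<nu> (S -` {y} \<inter> space M)) y"
      by (simp add: blinfun.sum_left)
  qed
  finally show ?thesis ..
qed

lemma sint_add:
  assumes "simple_function M S" "simple_function M T" shows "sint (\<lambda>\<omega>. S \<omega> + T \<omega>) = sint S + sint T"
proof -
  have g: "simple_function M (\<lambda>\<omega>. (S \<omega>, T \<omega>))" by (rule simple_function_Pair[OF assms])
  show ?thesis
    using sint_partition[OF g, of "\<lambda>\<omega>. S \<omega> + T \<omega>" "\<lambda>z. fst z + snd z"] sint_partition[OF g, of S fst] sint_partition[OF g, of T snd]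
    by (simp add: blinfun.add_right sum.distrib)
qed

lemma sint_sc: assumes "simple_function M S" shows "sint (\<lambda>\<omega>. sc c (S \<omega>)) = c * sint S"
proof -
  have "sint (\<lambda>\<omega>. sc c (S \<omega>)) = (\<Sum>y\<in>S ` space M. blinfun_apply (\<nu> (S -` {y} \<inter> space M)) (sc c y))"
    by (rule sint_partition[OF assms]) simp
  also have "\<dots> = (\<Sum>y\<in>S ` space M. c * blinfun_apply (\<nu> (S -` {y} \<inter> space M)) y)"
    using assms by (intro sum.cong DS_apply \<nu>_DS) (auto simp: simple_functionD)
  finally show ?thesis by (simp add: sint_def sum_distrib_left)
qed

lemma sint_le: assumes S: "simple_function M S" shows "norm (sint S) \<le> K * (\<integral>\<omega>. norm (S \<omega>) \<partial>M)"
proof -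
  have sb: "Bochner_Integration.simple_bochner_integrable M (\<lambda>\<omega>. norm (S \<omega>))"
    by (rule simple_bochner_integrable_finite[OF simple_function_compose1[OF S]])
  have "norm (sint S) \<le> (\<Sum>y\<in>S ` space M. norm (blinfun_apply (\<nu> (S -` {y} \<inter> space M)) y))"
    unfolding sint_def by (rule norm_sum)
  also have "\<dots> \<le> (\<Sum>y\<in>S ` space M. K * (measure M {x\<in>space M. S x = y} *\<^sub>R norm y))"
  proof (rule sum_mono)
    fix y
    have "{x\<in>space M. S x = y} = S -` {y} \<inter> space M" by auto
    moreover have "S -` {y} \<inter> space M \<in> sets M" using S by (rule simple_functionD)
    ultimately show "norm (blinfun_apply (\<nu> (S -` {y} \<inter> space M)) y) \<le> K * (measure M {x\<in>space M. S x = y} *\<^sub>R norm y)"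
      using order.trans[OF norm_blinfun mult_right_mono[OF \<nu>_le norm_ge_zero]] by (simp add: mult.assoc)
  qed
  also have "\<dots> = K * Bochner_Integration.simple_bochner_integral M (\<lambda>\<omega>. norm (S \<omega>))"
    by (subst simple_bochner_integral_partition[OF sb S, of norm]) (auto simp: sum_distrib_left)
  also have "Bochner_Integration.simple_bochner_integral M (\<lambda>\<omega>. norm (S \<omega>)) = (\<integral>\<omega>. norm (S \<omega>) \<partial>M)"
    by (rule simple_bochner_integrable_eq_integral[OF sb])
  finally show ?thesis .
qed

lemma sint_diff:
  assumes "simple_function M S" "simple_function M T" shows "sint (\<lambda>\<omega>. S \<omega> - T \<omega>) = sint S - sint T"
  using sint_add[OF simple_function_compose2[OF assms, of "\<lambda>x y. x - y"] assms(2)] by simp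

text \<open>The extension of \<open>sint\<close> to a function \<open>Y\<close> is the only number \<open>L\<close> satisfying this relation.\<close>

definition int_rel :: "('w \<Rightarrow> 'x) \<Rightarrow> 'k \<Rightarrow> bool" where
  "int_rel Y L \<longleftrightarrow> (\<forall>S. simple_function M S \<longrightarrow> norm (L - sint S) \<le> K * (\<integral>\<omega>. norm (Y \<omega> - S \<omega>) \<partial>M))"

lemma LS_L1_dense:
  assumes Y: "Y \<in> LS"
  obtains S where "\<And>n::nat. simple_function M (S n)" "(\<lambda>n. \<integral>\<omega>. norm (Y \<omega> - S n \<omega>) \<partial>M) \<longlonglongrightarrow> 0"
proof -
  obtain S where S: "\<And>n::nat. simple_function M (S n)" "(\<lambda>n. nrm (\<lambda>\<omega>. Y \<omega> - S n \<omega>)) \<longlonglongrightarrow> 0"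
    by (rule LS_dense[OF Y]) blast
  have "(\<lambda>n. \<integral>\<omega>. norm (Y \<omega> - S n \<omega>) \<partial>M) \<longlonglongrightarrow> 0"
  proof (rule tendsto_sandwich[OF _ _ tendsto_const tendsto_mult_right_zero[OF S(2), of 2]])
    show "\<forall>\<^sub>F n in sequentially. (\<integral>\<omega>. norm (Y \<omega> - S n \<omega>) \<partial>M) \<le> 2 * nrm (\<lambda>\<omega>. Y \<omega> - S n \<omega>)"
      by (intro always_eventually allI LS_integrable(2) LS_diff Y LS_simple S(1))
  qed auto
  with S(1) show thesis by (rule that)
qed

lemma L1_triangle:
  assumes "Y \<in> LS" "Y' \<in> LS" "\<And>\<omega>. norm (Y'' \<omega>) \<le> norm (Y \<omega>) + norm (Y' \<omega>)" "Y'' \<in> LS"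
  shows "(\<integral>\<omega>. norm (Y'' \<omega>) \<partial>M) \<le> (\<integral>\<omega>. norm (Y \<omega>) \<partial>M) + (\<integral>\<omega>. norm (Y' \<omega>) \<partial>M)"
proof -
  have "(\<integral>\<omega>. norm (Y'' \<omega>) \<partial>M) \<le> (\<integral>\<omega>. norm (Y \<omega>) + norm (Y' \<omega>) \<partial>M)"
    by (intro integral_mono LS_integrable(1) Bochner_Integration.integrable_add assms)
  then show ?thesis by (simp add: LS_integrable(1) assms)
qed

text \<open>On simple functions the integral is Lipschitz with constant \<open>K\<close> for the
  \<open>L^1\<close> distance, so its values along approximations of \<open>Y\<close> are Cauchy,
  and the estimate against a fixed simple function passes to the limit.\<close>

lemma int_rel_exists: assumes Y: "Y \<in> LS" shows "\<exists>L. int_rel Y L"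
proof -
  obtain S where S: "\<And>n::nat. simple_function M (S n)" "(\<lambda>n. \<integral>\<omega>. norm (Y \<omega> - S n \<omega>) \<partial>M) \<longlonglongrightarrow> 0"
    by (rule LS_L1_dense[OF Y]) blast
  let ?d = "\<lambda>n. K * (\<integral>\<omega>. norm (Y \<omega> - S n \<omega>) \<partial>M)"
  have d0: "?d \<longlonglongrightarrow> 0" by (rule tendsto_mult_right_zero[OF S(2)])
  have bd: "norm (sint (S n) - sint T) \<le> ?d n + K * (\<integral>\<omega>. norm (Y \<omega> - T \<omega>) \<partial>M)" if T: "simple_function M T" for n T
  proof -
    have ST: "simple_function M (\<lambda>\<omega>. S n \<omega> - T \<omega>)" by (rule simple_function_compose2[OF S(1) T])
    have "norm (sint (S n) - sint T) \<le> K * (\<integral>\<omega>. norm (S n \<omega> - T \<omega>) \<partial>M)"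
      unfolding sint_diff[OF S(1) T, symmetric] by (rule sint_le[OF ST])
    also have "\<dots> \<le> K * ((\<integral>\<omega>. norm (Y \<omega> - S n \<omega>) \<partial>M) + (\<integral>\<omega>. norm (Y \<omega> - T \<omega>) \<partial>M))"
    proof (rule mult_left_mono[OF L1_triangle K_nonneg])
      show "norm (S n \<omega> - T \<omega>) \<le> norm (Y \<omega> - S n \<omega>) + norm (Y \<omega> - T \<omega>)" for \<omega>
        using norm_triangle_ineq4[of "Y \<omega> - T \<omega>" "Y \<omega> - S n \<omega>"] by simp
    qed (intro LS_diff Y LS_simple S(1) T ST)+
    finally show ?thesis by (simp add: distrib_left)
  qed
  have "Cauchy (\<lambda>n. sint (S n))"
  proof (rule CauchyI)
    fix e :: real assume "0 < e"
    then obtain N where N: "\<And>n. N \<le> n \<Longrightarrow> ?d n < e / 2"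
      using order_tendstoD(2)[OF d0, of "e / 2"] by (auto simp: eventually_sequentially)
    have "norm (sint (S m) - sint (S n)) < e" if "N \<le> m" "N \<le> n" for m n
      using bd[OF S(1), of m n] N[OF that(1)] N[OF that(2)] by linarith
    then show "\<exists>N. \<forall>m\<ge>N. \<forall>n\<ge>N. norm (sint (S m) - sint (S n)) < e" by blast
  qed
  then obtain L where L: "(\<lambda>n. sint (S n)) \<longlonglongrightarrow> L" using Cauchy_convergent convergent_def by blast
  have "int_rel Y L" unfolding int_rel_def
  proof (intro allI impI)
    fix T :: "'w \<Rightarrow> 'x" assume T: "simple_function M T"
    have "(\<lambda>n. norm (sint (S n) - sint T)) \<longlonglongrightarrow> norm (L - sint T)" by (intro tendsto_intros L)
    moreover have "(\<lambda>n. ?d n + K * (\<integral>\<omega>. norm (Y \<omega> - T \<omega>) \<partial>M)) \<longlonglongrightarrow> 0 + K * (\<integral>\<omega>. norm (Y \<omega> - T \<omega>) \<partial>M)"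
      by (intro tendsto_add d0 tendsto_const)
    ultimately have "norm (L - sint T) \<le> 0 + K * (\<integral>\<omega>. norm (Y \<omega> - T \<omega>) \<partial>M)" by (rule LIMSEQ_le) (use bd[OF T] in auto)
    then show "norm (L - sint T) \<le> K * (\<integral>\<omega>. norm (Y \<omega> - T \<omega>) \<partial>M)" by simp
  qed
  then show ?thesis ..
qed

lemma int_rel_limit:
  assumes "int_rel Y L" "\<And>n. simple_function M (S n)" "(\<lambda>n. \<integral>\<omega>. norm (Y \<omega> - S n \<omega>) \<partial>M) \<longlonglongrightarrow> 0"
  shows "(\<lambda>n. sint (S n)) \<longlonglongrightarrow> L"
proof (rule LIM_zero_cancel, rule Lim_null_comparison[OF always_eventually tendsto_mult_right_zero[OF assms(3), of K]], rule allI)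
  show "norm (sint (S n) - L) \<le> K * (\<integral>\<omega>. norm (Y \<omega> - S n \<omega>) \<partial>M)" for n
    using assms(1,2) unfolding int_rel_def norm_minus_commute[of "sint (S n)" L] by blast
qed

definition int_val :: "('w \<Rightarrow> 'x) \<Rightarrow> 'k" where "int_val Y = (SOME L. int_rel Y L)"

lemma int_val: "Y \<in> LS \<Longrightarrow> int_rel Y (int_val Y)"
  unfolding int_val_def by (rule someI_ex) (rule int_rel_exists)

lemma int_val_eqI: assumes Y: "Y \<in> LS" and "int_rel Y L" shows "int_val Y = L"
proof -
  obtain S where S: "\<And>n::nat. simple_function M (S n)" "(\<lambda>n. \<integral>\<omega>. norm (Y \<omega> - S n \<omega>) \<partial>M) \<longlonglongrightarrow> 0"
    by (rule LS_L1_dense[OF Y]) blast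
  show ?thesis
    by (rule LIMSEQ_unique[OF int_rel_limit[OF int_val[OF Y] S] int_rel_limit[OF assms(2) S]])
qed

lemma int_val_simple: assumes "simple_function M Y" shows "int_val Y = sint Y"
proof (rule int_val_eqI[OF LS_simple[OF assms]])
  show "int_rel Y (sint Y)" unfolding int_rel_def
    using sint_le[OF simple_function_compose2[OF assms, of _ "\<lambda>x y. x - y"]] by (simp add: sint_diff[OF assms, symmetric])
qed

lemma int_val_cong: assumes "Y \<in> LS" "Y' \<in> LS" "AE \<omega> in M. Y \<omega> = Y' \<omega>" shows "int_val Y = int_val Y'"
proof -
  have "int_rel Y = int_rel Y'"
    unfolding int_rel_def
  proof (intro ext all_cong1 imp_cong refl)
    fix L and S :: "'w \<Rightarrow> 'x" assume S: "simple_function M S"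
    have "(\<integral>\<omega>. norm (Y \<omega> - S \<omega>) \<partial>M) = (\<integral>\<omega>. norm (Y' \<omega> - S \<omega>) \<partial>M)"
      using assms(3) by (intro integral_cong_AE strongly_measurable_norm_diff[OF LS_meas LS_meas] assms LS_simple S)
        (auto elim: eventually_mono)
    then show "norm (L - sint S) \<le> K * (\<integral>\<omega>. norm (Y \<omega> - S \<omega>) \<partial>M) \<longleftrightarrow> norm (L - sint S) \<le> K * (\<integral>\<omega>. norm (Y' \<omega> - S \<omega>) \<partial>M)" by simp
  qed
  then show ?thesis unfolding int_val_def by simp
qed

lemma int_val_add: assumes Y: "Y \<in> LS" "Y' \<in> LS" shows "int_val (\<lambda>\<omega>. Y \<omega> + Y' \<omega>) = int_val Y + int_val Y'"
proof -
  obtain S where S: "\<And>n::nat. simple_function M (S n)" "(\<lambda>n. \<integral>\<omega>. norm (Y \<omega> - S n \<omega>) \<partial>M) \<longlonglongrightarrow> 0"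
    by (rule LS_L1_dense[OF Y(1)]) blast
  obtain T where T: "\<And>n::nat. simple_function M (T n)" "(\<lambda>n. \<integral>\<omega>. norm (Y' \<omega> - T n \<omega>) \<partial>M) \<longlonglongrightarrow> 0"
    by (rule LS_L1_dense[OF Y(2)]) blast
  have ST: "simple_function M (\<lambda>\<omega>. S n \<omega> + T n \<omega>)" for n by (rule simple_function_compose2[OF S(1) T(1)])
  have "(\<lambda>n. \<integral>\<omega>. norm (Y \<omega> + Y' \<omega> - (S n \<omega> + T n \<omega>)) \<partial>M) \<longlonglongrightarrow> 0"
  proof (rule tendsto_sandwich[OF _ _ tendsto_const tendsto_add_zero[OF S(2) T(2)]])
    show "\<forall>\<^sub>F n in sequentially. (\<integral>\<omega>. norm (Y \<omega> + Y' \<omega> - (S n \<omega> + T n \<omega>)) \<partial>M) \<le>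
      (\<integral>\<omega>. norm (Y \<omega> - S n \<omega>) \<partial>M) + (\<integral>\<omega>. norm (Y' \<omega> - T n \<omega>) \<partial>M)"
    proof (intro always_eventually allI L1_triangle)
      show "norm (Y \<omega> + Y' \<omega> - (S n \<omega> + T n \<omega>)) \<le> norm (Y \<omega> - S n \<omega>) + norm (Y' \<omega> - T n \<omega>)" for n \<omega>
        by (rule norm_diff_triangle_ineq)
    qed (intro LS_diff LS_add Y LS_simple S(1) T(1) ST)+
  qed auto
  from int_rel_limit[OF int_val[OF LS_add[OF Y]] ST this]
  have "(\<lambda>n. sint (S n) + sint (T n)) \<longlonglongrightarrow> int_val (\<lambda>\<omega>. Y \<omega> + Y' \<omega>)" by (simp add: sint_add S(1) T(1))
  moreover have "(\<lambda>n. sint (S n) + sint (T n)) \<longlonglongrightarrow> int_val Y + int_val Y'"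
    by (intro tendsto_add int_rel_limit[OF int_val] Y S T)
  ultimately show ?thesis by (rule LIMSEQ_unique)
qed

lemma int_val_sc: assumes Y: "Y \<in> LS" shows "int_val (\<lambda>\<omega>. sc c (Y \<omega>)) = c * int_val Y"
proof -
  obtain S where S: "\<And>n::nat. simple_function M (S n)" "(\<lambda>n. \<integral>\<omega>. norm (Y \<omega> - S n \<omega>) \<partial>M) \<longlonglongrightarrow> 0"
    by (rule LS_L1_dense[OF Y]) blast
  have "(\<lambda>n. \<integral>\<omega>. norm (sc c (Y \<omega>) - sc c (S n \<omega>)) \<partial>M) = (\<lambda>n. norm c * (\<integral>\<omega>. norm (Y \<omega> - S n \<omega>) \<partial>M))"
    by (simp add: scale_right_diff_distrib[symmetric] norm_scale)
  then have lim: "(\<lambda>n. \<integral>\<omega>. norm (sc c (Y \<omega>) - sc c (S n \<omega>)) \<partial>M) \<longlonglongrightarrow> 0"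
    by (simp add: tendsto_mult_right_zero[OF S(2)])
  have "(\<lambda>n. sint (\<lambda>\<omega>. sc c (S n \<omega>))) \<longlonglongrightarrow> int_val (\<lambda>\<omega>. sc c (Y \<omega>))"
    by (rule int_rel_limit[OF int_val[OF LS_scale[OF Y]] simple_function_compose1[OF S(1)] lim])
  moreover have "(\<lambda>n. sint (\<lambda>\<omega>. sc c (S n \<omega>))) \<longlonglongrightarrow> c * int_val Y"
    unfolding sint_sc[OF S(1)] by (intro tendsto_mult_left int_rel_limit[OF int_val[OF Y]] S)
  ultimately show ?thesis by (rule LIMSEQ_unique)
qed

lemma int_val_le: assumes Y: "Y \<in> LS" shows "norm (int_val Y) \<le> 2 * K * nrm Y"
proof -
  have "sint (\<lambda>_. 0) = 0" using sint_le[of "\<lambda>_. 0"] by simp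
  then have "norm (int_val Y) \<le> K * (\<integral>\<omega>. norm (Y \<omega>) \<partial>M)"
    using int_val[OF Y] unfolding int_rel_def by (auto dest!: spec[of _ "\<lambda>_. 0"])
  also have "\<dots> \<le> K * (2 * nrm Y)" by (intro mult_left_mono LS_integrable Y K_nonneg)
  finally show ?thesis by simp
qed

lemma functional_of_bounded_measure:
  shows "\<exists>\<phi>\<in>vcarrier (continuous_dual \<L>). \<forall>E\<in>sets M. \<forall>x. \<phi> (cls (\<lambda>\<omega>. indicator E \<omega> *\<^sub>R x)) = blinfun_apply (\<nu> E) x"
proof -
  define \<phi> where "\<phi> = (\<lambda>B\<in>cls ` LS. int_val (ae_rep B))"
  have \<phi>: "\<phi> (cls Y) = int_val Y" if "Y \<in> LS" for Y
    using that int_val_cong[OF ae_rep_class(1)[OF that] that ae_rep_class(2)[OF that, of M]] by (auto simp: \<phi>_def)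
  show ?thesis
  proof (intro bexI[of _ \<phi>] ballI allI)
    show "\<phi> \<in> vcarrier (continuous_dual \<L>)"
      unfolding mem_continuous_dual
      by (auto simp: \<phi> LS_add LS_scale int_val_add int_val_sc int_val_le intro!: exI[of _ "2 * K"])
        (simp add: \<phi>_def)
    fix E and x :: 'x assume E: "E \<in> sets M"
    let ?Y = "\<lambda>\<omega>. indicator E \<omega> *\<^sub>R x"
    have g: "simple_function M (indicat_real E)" using E by simp
    have sf: "simple_function M ?Y" by (rule simple_function_compose1[OF g])
    have "\<phi> (cls ?Y) = sint ?Y" by (simp add: \<phi> LS_simple[OF sf] int_val_simple[OF sf])
    also have "\<dots> = (\<Sum>z\<in>indicat_real E ` space M. blinfun_apply (\<nu> (indicat_real E -` {z} \<inter> space M)) (z *\<^sub>R x))"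
      by (rule sint_partition[OF g]) simp
    also have "\<dots> = (\<Sum>z\<in>{1}. blinfun_apply (\<nu> (indicat_real E -` {z} \<inter> space M)) (z *\<^sub>R x))"
    proof (rule sum.mono_neutral_cong)
      show "blinfun_apply (\<nu> (indicat_real E -` {z} \<inter> space M)) (z *\<^sub>R x) = 0" if "z \<in> indicat_real E ` space M - {1}" for z
        using that by (auto simp: indicator_def blinfun.zero_right split: if_splits)
      \<comment> \<open>For empty \<open>E\<close> the value 1 is not taken; its preimage is then
        empty and contributes 0.\<close>
      show "blinfun_apply (\<nu> (indicat_real E -` {z} \<inter> space M)) (z *\<^sub>R x) = 0" if "z \<in> {1} - indicat_real E ` space M" for z
      proof -
        have "indicat_real E -` {z} \<inter> space M = {}" using that by auto
        then show ?thesis by (simp add: \<nu>_empty blinfun.zero_left)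
      qed
    qed (use g in \<open>auto simp: simple_functionD\<close>)
    also have "\<dots> = blinfun_apply (\<nu> (indicat_real E -` {1} \<inter> space M)) x" by simp
    also have "indicat_real E -` {1} \<inter> space M = E" using sets.sets_into_space[OF E] by (auto simp: indicator_def)
    finally show "\<phi> (cls ?Y) = blinfun_apply (\<nu> E) x" .
  qed
qed

end

section \<open>Variation bounds and gluing of densities\<close>

text \<open>On a level set of a simple approximation of \<open>W\<close>, probability times the
  value there differs from the measure of the set by at most the approximation error on it. Summing
  over the disjoint level sets compares the \<open>L^1\<close> norm of the approximation with the
  variation.\<close>

lemma norm_integral_le_variation:
  assumes W: "strongly_measurable M DS W" and fin: "(\<integral>\<^sup>+\<omega>. ennreal (norm (W \<omega>)) \<partial>M) < \<infinity>"
    and \<nu>: "\<And>E x. E \<in> sets M \<Longrightarrow> (\<integral>\<omega>. indicator E \<omega> *\<^sub>R blinfun_apply (W \<omega>) x \<partial>M) = blinfun_apply (\<nu> E) x"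
    and C: "\<And>\<pi>. finite \<pi> \<Longrightarrow> \<pi> \<subseteq> sets M \<Longrightarrow> disjoint \<pi> \<Longrightarrow> (\<Sum>E\<in>\<pi>. norm (\<nu> E)) \<le> C"
  shows "(\<integral>\<omega>. norm (W \<omega>) \<partial>M) \<le> C"
proof -
  note [measurable] = strongly_measurable_norm[OF W]
  have intW: "integrable M (\<lambda>\<omega>. norm (W \<omega>))" using fin by (intro integrableI_nonneg) auto
  obtain s where s: "\<And>i::nat. simple_into M DS (s i)" "\<And>\<omega>. \<omega> \<in> space M \<Longrightarrow> (\<lambda>i. s i \<omega>) \<longlonglongrightarrow> W \<omega>"
    "\<And>i \<omega>. \<omega> \<in> space M \<Longrightarrow> norm (s i \<omega>) \<le> 2 * norm (W \<omega>)" by (rule strongly_measurable_approx[OF W DS_0]) blast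
  have ssf: "simple_function M (s i)" for i using s(1)[of i] by (simp add: simple_into_def)
  have ssm: "strongly_measurable M UNIV (s i)" for i by (rule strongly_measurable_simple[OF ssf]) simp
  note [measurable] = strongly_measurable_norm_diff[OF W ssm] strongly_measurable_norm[OF ssm]
  have bd3: "norm (W \<omega> - s i \<omega>) \<le> 3 * norm (W \<omega>)" if "\<omega> \<in> space M" for i \<omega>
    using norm_triangle_ineq4[of "W \<omega>" "s i \<omega>"] s(3)[OF that, of i] by simp
  have int_d: "integrable M (\<lambda>\<omega>. norm (W \<omega> - s i \<omega>))" for i
    by (rule Bochner_Integration.integrable_bound[OF integrable_mult_right[OF intW, of 3]])
      (use bd3 in \<open>auto intro!: AE_I2\<close>)
  have int_s: "integrable M (\<lambda>\<omega>. norm (s i \<omega>))" for i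
    by (rule Bochner_Integration.integrable_bound[OF integrable_mult_right[OF intW, of 2]])
      (use s(3) in \<open>auto intro!: AE_I2\<close>)
  let ?d = "\<lambda>i. \<integral>\<omega>. norm (W \<omega> - s i \<omega>) \<partial>M"
  have lim: "?d \<longlonglongrightarrow> (\<integral>\<omega>. 0 \<partial>M)"
  proof (rule integral_dominated_convergence[OF _ _ integrable_mult_right[OF intW, of 3]])
    show "AE \<omega> in M. (\<lambda>i. norm (W \<omega> - s i \<omega>)) \<longlonglongrightarrow> 0"
    proof (rule AE_I2)
      fix \<omega> assume "\<omega> \<in> space M"
      then have "(\<lambda>i. norm (W \<omega> - s i \<omega>)) \<longlonglongrightarrow> norm (W \<omega> - W \<omega>)" by (intro tendsto_intros s(2))
      then show "(\<lambda>i. norm (W \<omega> - s i \<omega>)) \<longlonglongrightarrow> 0" by simp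
    qed
  qed (use bd3 in \<open>auto intro!: AE_I2\<close>)
  have step: "(\<integral>\<omega>. norm (s i \<omega>) \<partial>M) \<le> C + ?d i" for i
  proof -
    let ?F = "\<lambda>y. s i -` {y} \<inter> space M"
    have F [measurable]: "?F y \<in> sets M" for y using ssf by (rule simple_functionD)
    have finY: "finite (s i ` space M)" using ssf by (simp add: simple_functionD)
    have sb: "Bochner_Integration.simple_bochner_integrable M (\<lambda>\<omega>. norm (s i \<omega>))"
      by (rule simple_bochner_integrable_finite[OF simple_function_compose1[OF ssf]])
    have int_Fd: "integrable M (\<lambda>\<omega>. indicator (?F y) \<omega> *\<^sub>R norm (W \<omega> - s i \<omega>))" for y
      by (rule integrable_mult_indicator[OF F int_d])
    have piece: "measure M (?F y) * norm y \<le> norm (\<nu> (?F y)) + (\<integral>\<omega>. indicator (?F y) \<omega> *\<^sub>R norm (W \<omega> - s i \<omega>) \<partial>M)" for y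
    proof -
      \<comment> \<open>The measure is given only through its evaluations, so the estimate is proved
        vector by vector and reassembled into an operator norm bound.\<close>
      have "norm (measure M (?F y) *\<^sub>R y) \<le> norm (\<nu> (?F y)) + (\<integral>\<omega>. indicator (?F y) \<omega> *\<^sub>R norm (W \<omega> - s i \<omega>) \<partial>M)"
      proof (rule norm_blinfun_bound)
        fix x
        have meas [measurable]: "(\<lambda>\<omega>. blinfun_apply (W \<omega>) x) \<in> borel_measurable M" "(\<lambda>\<omega>. blinfun_apply (s i \<omega>) x) \<in> borel_measurable M"
          using pairing_measurable[OF W LS_meas[OF LS_simple[OF simple_function_const[of _ x]]]]
            pairing_measurable[OF ssm[of i] LS_meas[OF LS_simple[OF simple_function_const[of _ x]]]] by auto
        have intWx: "integrable M (\<lambda>\<omega>. indicator (?F y) \<omega> *\<^sub>R blinfun_apply (W \<omega>) x)"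
        proof (rule Bochner_Integration.integrable_bound[OF integrable_mult_left[OF intW, of "norm x"]])
          show "AE \<omega> in M. norm (indicat_real (?F y) \<omega> *\<^sub>R blinfun_apply (W \<omega>) x) \<le> norm (norm (W \<omega>) * norm x)"
            by (auto intro!: AE_I2 norm_blinfun simp: indicator_def)
        qed measurable
        have [measurable]: "(\<lambda>\<omega>. blinfun_apply (W \<omega> - s i \<omega>) x) \<in> borel_measurable M"
          by (simp add: blinfun.diff_left)
        have intdx: "integrable M (\<lambda>\<omega>. indicator (?F y) \<omega> *\<^sub>R blinfun_apply (W \<omega> - s i \<omega>) x)"
        proof (rule Bochner_Integration.integrable_bound[OF integrable_mult_left[OF int_d[of i], of "norm x"]])
          show "AE \<omega> in M. norm (indicat_real (?F y) \<omega> *\<^sub>R blinfun_apply (W \<omega> - s i \<omega>) x) \<le> norm (norm (W \<omega> - s i \<omega>) * norm x)"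
            by (auto intro!: AE_I2 norm_blinfun simp: indicator_def)
        qed measurable
        have "blinfun_apply (measure M (?F y) *\<^sub>R y) x = (\<integral>\<omega>. indicator (?F y) \<omega> *\<^sub>R blinfun_apply y x \<partial>M)"
        proof -
          have "(\<integral>\<omega>. indicat_real (?F y) \<omega> *\<^sub>R blinfun_apply y x \<partial>M) = (\<integral>\<omega>. indicat_real (?F y) \<omega> \<partial>M) *\<^sub>R blinfun_apply y x"
            by (rule integral_scaleR_left) (auto intro!: integrable_real_indicator simp: emeasure_eq_measure)
          then show ?thesis by (simp add: blinfun.scaleR_left)
        qed
        also have "\<dots> = (\<integral>\<omega>. indicator (?F y) \<omega> *\<^sub>R blinfun_apply (W \<omega>) x - indicator (?F y) \<omega> *\<^sub>R blinfun_apply (W \<omega> - s i \<omega>) x \<partial>M)"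
          by (rule Bochner_Integration.integral_cong[OF refl]) (auto simp: indicator_def blinfun.diff_left)
        also have "\<dots> = blinfun_apply (\<nu> (?F y)) x - (\<integral>\<omega>. indicator (?F y) \<omega> *\<^sub>R blinfun_apply (W \<omega> - s i \<omega>) x \<partial>M)"
          by (subst Bochner_Integration.integral_diff[OF intWx intdx]) (simp only: \<nu>[OF F])
        finally have "norm (blinfun_apply (measure M (?F y) *\<^sub>R y) x) \<le> norm (blinfun_apply (\<nu> (?F y)) x) +
          norm (\<integral>\<omega>. indicator (?F y) \<omega> *\<^sub>R blinfun_apply (W \<omega> - s i \<omega>) x \<partial>M)"
          by (simp only: norm_triangle_ineq4)
        also have "norm (blinfun_apply (\<nu> (?F y)) x) \<le> norm (\<nu> (?F y)) * norm x" by (rule norm_blinfun)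
        also have "norm (\<integral>\<omega>. indicator (?F y) \<omega> *\<^sub>R blinfun_apply (W \<omega> - s i \<omega>) x \<partial>M) \<le>
          (\<integral>\<omega>. (indicator (?F y) \<omega> *\<^sub>R norm (W \<omega> - s i \<omega>)) * norm x \<partial>M)"
        proof (rule order.trans[OF integral_norm_bound integral_mono[OF integrable_norm[OF intdx] integrable_mult_left[OF int_Fd]]])
          show "norm (indicat_real (?F y) \<omega> *\<^sub>R blinfun_apply (W \<omega> - s i \<omega>) x) \<le> indicat_real (?F y) \<omega> *\<^sub>R norm (W \<omega> - s i \<omega>) * norm x" for \<omega>
            using norm_blinfun[of "W \<omega> - s i \<omega>" x] by (auto simp: indicator_def)
        qed
        also have "(\<integral>\<omega>. (indicator (?F y) \<omega> *\<^sub>R norm (W \<omega> - s i \<omega>)) * norm x \<partial>M) = (\<integral>\<omega>. indicator (?F y) \<omega> *\<^sub>R norm (W \<omega> - s i \<omega>) \<partial>M) * norm x"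
          by (rule integral_mult_left_zero)
        finally show "norm (blinfun_apply (measure M (?F y) *\<^sub>R y) x) \<le>
          (norm (\<nu> (?F y)) + (\<integral>\<omega>. indicator (?F y) \<omega> *\<^sub>R norm (W \<omega> - s i \<omega>) \<partial>M)) * norm x"
          by (simp add: distrib_right)
      qed (auto intro!: add_nonneg_nonneg Bochner_Integration.integral_nonneg)
      then show ?thesis by simp
    qed
    have "(\<integral>\<omega>. norm (s i \<omega>) \<partial>M) = Bochner_Integration.simple_bochner_integral M (\<lambda>\<omega>. norm (s i \<omega>))"
      by (rule simple_bochner_integrable_eq_integral[OF sb, symmetric])
    also have "\<dots> = (\<Sum>y\<in>s i ` space M. measure M (?F y) * norm y)"
      by (subst simple_bochner_integral_partition[OF sb ssf[of i], of norm])
        (auto intro!: sum.cong arg_cong[where f = "measure M"])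
    also have "\<dots> \<le> (\<Sum>y\<in>s i ` space M. norm (\<nu> (?F y)) + (\<integral>\<omega>. indicator (?F y) \<omega> *\<^sub>R norm (W \<omega> - s i \<omega>) \<partial>M))"
      by (rule sum_mono) (rule piece)
    also have "\<dots> = (\<Sum>y\<in>s i ` space M. norm (\<nu> (?F y))) + (\<Sum>y\<in>s i ` space M. \<integral>\<omega>. indicator (?F y) \<omega> *\<^sub>R norm (W \<omega> - s i \<omega>) \<partial>M)"
      by (rule sum.distrib)
    also have "(\<Sum>y\<in>s i ` space M. norm (\<nu> (?F y))) = (\<Sum>E\<in>?F ` s i ` space M. norm (\<nu> E))"
    proof (rule sum.reindex_cong[symmetric, OF _ refl refl])
      show "inj_on ?F (s i ` space M)" by (rule inj_onI) blast
    qed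
    also have "\<dots> \<le> C"
      by (rule C) (use finY F in \<open>auto simp: disjoint_def\<close>)
    also have "(\<Sum>y\<in>s i ` space M. \<integral>\<omega>. indicator (?F y) \<omega> *\<^sub>R norm (W \<omega> - s i \<omega>) \<partial>M) =
      (\<integral>\<omega>. (\<Sum>y\<in>s i ` space M. indicator (?F y) \<omega> *\<^sub>R norm (W \<omega> - s i \<omega>)) \<partial>M)"
      by (rule Bochner_Integration.integral_sum[symmetric]) (rule int_Fd)
    also have "\<dots> = ?d i"
    proof (rule Bochner_Integration.integral_cong[OF refl])
      fix \<omega> assume \<omega>: "\<omega> \<in> space M"
      have "(\<Sum>y\<in>s i ` space M. indicat_real (?F y) \<omega> *\<^sub>R norm (W \<omega> - s i \<omega>)) = (\<Sum>y\<in>{s i \<omega>}. indicat_real (?F y) \<omega> *\<^sub>R norm (W \<omega> - s i \<omega>))"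
        using finY \<omega> by (intro sum.mono_neutral_right) (auto simp: indicator_def)
      then show "(\<Sum>y\<in>s i ` space M. indicat_real (?F y) \<omega> *\<^sub>R norm (W \<omega> - s i \<omega>)) = norm (W \<omega> - s i \<omega>)" using \<omega> by simp
    qed
    finally show ?thesis by simp
  qed
  \<comment> \<open>The error enters twice: in replacing \<open>W\<close> by \<open>s i\<close>, and
    in \<open>step\<close>.\<close>
  have "(\<integral>\<omega>. norm (W \<omega>) \<partial>M) \<le> C + 2 * ?d i" for i
  proof -
    have "(\<integral>\<omega>. norm (W \<omega>) \<partial>M) \<le> (\<integral>\<omega>. norm (W \<omega> - s i \<omega>) + norm (s i \<omega>) \<partial>M)"
      by (intro integral_mono intW Bochner_Integration.integrable_add int_d int_s) (metis norm_triangle_sub add.commute)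
    also have "\<dots> = ?d i + (\<integral>\<omega>. norm (s i \<omega>) \<partial>M)" by (rule Bochner_Integration.integral_add[OF int_d int_s])
    finally show ?thesis using step[of i] by simp
  qed
  moreover have "(\<lambda>i. C + 2 * ?d i) \<longlonglongrightarrow> C + 2 * 0" using lim by (intro tendsto_intros) simp
  ultimately show ?thesis by (intro LIMSEQ_le_const[of "\<lambda>i. C + 2 * ?d i" C]) auto
qed

text \<open>The densities of the pieces are integrable one by one, but their number is infinite.
  Integrability of the glued function comes from the variation of \<open>\<mu>\<close>, which bounds
  the integral over the first \<open>k\<close> pieces independently of \<open>k\<close>.\<close>

lemma RNP_from_representation:
  assumes rep: "\<forall>\<phi>\<in>vcarrier (continuous_dual \<L>). \<exists>Z\<in>LST. \<forall>Y\<in>LS. \<phi> (cls Y) = (\<integral>\<omega>. blinfun_apply (Z \<omega>) (Y \<omega>) \<partial>M)"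
  shows "radon_nikodym_property M DS"
  unfolding radon_nikodym_property_def
proof (intro allI impI)
  fix \<mu> :: "'w set \<Rightarrow> 'x \<Rightarrow>\<^sub>L 'k"
  assume \<mu>: "vector_measure M DS \<mu>" and ac: "continuous_wrt M \<mu>" and "finite_variation M \<mu>"
  then obtain C where C: "\<And>\<pi>. finite \<pi> \<Longrightarrow> \<pi> \<subseteq> sets M \<Longrightarrow> partition_on (space M) \<pi> \<Longrightarrow> (\<Sum>E\<in>\<pi>. norm (\<mu> E)) \<le> C"
    unfolding finite_variation_def by blast
  have \<mu>_DS: "\<mu> E \<in> DS" if "E \<in> sets M" for E using \<mu> that unfolding vector_measure_def by auto
  note \<mu>_empty = vector_measure_empty[OF \<mu>] and \<mu>_Un = vector_measure_Un[OF \<mu>]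
  have "\<exists>A. A \<in> sets M \<and> measure M (space M - A) \<le> C / real (Suc n) \<and>
      (\<forall>E\<in>sets M. E \<subseteq> A \<longrightarrow> norm (\<mu> E) \<le> real (Suc n) * measure M E)" for n
    by (rule bounded_average_set[OF \<mu> ac C, of "real (Suc n)"]) auto
  then obtain A where A [measurable]: "\<And>n. A n \<in> sets M" and A_small: "\<And>n. measure M (space M - A n) \<le> C / real (Suc n)"
    and A_le: "\<And>n E. E \<in> sets M \<Longrightarrow> E \<subseteq> A n \<Longrightarrow> norm (\<mu> E) \<le> real (Suc n) * measure M E" by metis
  define B where "B k = (\<Union>n<k. A n)" for k
  have B [measurable]: "B k \<in> sets M" for k unfolding B_def by measurable
  \<comment> \<open>Disjoint pieces are needed for gluing; as subsets of \<open>A n\<close> they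
    keep its bound on the averages.\<close>
  define D where "D n = A n - B n" for n
  have D [measurable]: "D n \<in> sets M" for n unfolding D_def by measurable
  have BS: "B (Suc k) = B k \<union> D k" and BD: "B k \<inter> D k = {}" for k by (auto simp: B_def D_def lessThan_Suc)
  have D_disj_less: "D m \<inter> D n = {}" if "m < n" for m n using that unfolding D_def B_def by blast
  have D_disj: "disjoint_family D"
    unfolding disjoint_family_on_def
  proof (intro ballI impI)
    fix m n :: nat assume "m \<noteq> n"
    then show "D m \<inter> D n = {}" using D_disj_less[of m n] D_disj_less[of n m] by (cases m n rule: linorder_cases) auto
  qed
  have B_eq: "\<omega> \<in> B k \<longleftrightarrow> (\<exists>n<k. \<omega> \<in> D n)" for \<omega> k
    by (induction k) (simp add: B_def, auto simp: BS less_Suc_eq)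
  have "\<exists>Z\<in>LST. \<forall>E\<in>sets M. \<forall>x. has_bochner_integral M (\<lambda>\<omega>. indicator E \<omega> *\<^sub>R blinfun_apply (Z \<omega>) x) (blinfun_apply (\<mu> (E \<inter> D n)) x)" for n
  proof -
    have "\<exists>\<phi>\<in>vcarrier (continuous_dual \<L>). \<forall>E\<in>sets M. \<forall>x. \<phi> (cls (\<lambda>\<omega>. indicator E \<omega> *\<^sub>R x)) = blinfun_apply (\<mu> (E \<inter> D n)) x"
    proof (rule functional_of_bounded_measure[where K = "real (Suc n)"])
      show "\<mu> ((E \<union> F) \<inter> D n) = \<mu> (E \<inter> D n) + \<mu> (F \<inter> D n)" if [measurable]: "E \<in> sets M" "F \<in> sets M" and EF: "E \<inter> F = {}" for E F
        unfolding Int_Un_distrib2 by (rule \<mu>_Un) (use EF in auto)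
      show "norm (\<mu> (E \<inter> D n)) \<le> real (Suc n) * measure M E" if [measurable]: "E \<in> sets M" for E
      proof -
        have "norm (\<mu> (E \<inter> D n)) \<le> real (Suc n) * measure M (E \<inter> D n)" by (rule A_le) (auto simp: D_def)
        also have "\<dots> \<le> real (Suc n) * measure M E" by (intro mult_left_mono finite_measure_mono) auto
        finally show ?thesis .
      qed
    qed (auto intro: \<mu>_DS simp: \<mu>_empty)
    then obtain \<phi> where \<phi>: "\<phi> \<in> vcarrier (continuous_dual \<L>)"
      "\<forall>E\<in>sets M. \<forall>x. \<phi> (cls (\<lambda>\<omega>. indicator E \<omega> *\<^sub>R x)) = blinfun_apply (\<mu> (E \<inter> D n)) x"
      by (rule bexE) (rule that)
    from bspec[OF rep \<phi>(1)] obtain Z where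
      Z: "Z \<in> LST" "\<forall>Y\<in>LS. \<phi> (cls Y) = (\<integral>\<omega>. blinfun_apply (Z \<omega>) (Y \<omega>) \<partial>M)" by (rule bexE) (rule that)
    show ?thesis
    proof (intro bexI[OF _ Z(1)] ballI allI)
      fix E and x :: 'x assume E: "E \<in> sets M"
      show "has_bochner_integral M (\<lambda>\<omega>. indicator E \<omega> *\<^sub>R blinfun_apply (Z \<omega>) x) (blinfun_apply (\<mu> (E \<inter> D n)) x)"
        using has_bochner_integral_integrable[OF pairing(1)[OF Z(1) LS_indicator[OF E, of x]]]
        unfolding bspec[OF Z(2) LS_indicator[OF E, of x], symmetric] \<phi>(2)[rule_format, OF E] by (simp add: blinfun.scaleR_right)
    qed
  qed
  then obtain Zn where Zn: "\<And>n. Zn n \<in> LST" and Zn_int: "\<And>n E x. E \<in> sets M \<Longrightarrow>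
    has_bochner_integral M (\<lambda>\<omega>. indicator E \<omega> *\<^sub>R blinfun_apply (Zn n \<omega>) x) (blinfun_apply (\<mu> (E \<inter> D n)) x)" by metis
  define Z where "Z \<omega> = (if \<omega> \<in> (\<Union>n. D n) then Zn (THE n. \<omega> \<in> D n) \<omega> else 0)" for \<omega>
  have Z_D: "Z \<omega> = Zn n \<omega>" if "\<omega> \<in> D n" for n \<omega>
  proof -
    have "(THE m. \<omega> \<in> D m) = n"
      by (rule the_equality) (use that disjoint_family_onD[OF D_disj] in blast)+
    then show ?thesis using that unfolding Z_def by auto
  qed
  have Zm: "strongly_measurable M DS Z"
    by (rule strongly_measurable_glue[OF D D_disj LST_meas[OF Zn] DS_0 Z_D]) (auto simp: Z_def)
  note [measurable] = strongly_measurable_norm[OF Zm] strongly_measurable_norm[OF LST_meas[OF Zn]]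
  have HB: "has_bochner_integral M (\<lambda>\<omega>. indicator E \<omega> *\<^sub>R blinfun_apply (indicat_real (B k) \<omega> *\<^sub>R Z \<omega>) x) (blinfun_apply (\<mu> (E \<inter> B k)) x)"
    if E [measurable]: "E \<in> sets M" for k E x
  proof (induction k)
    case 0
    show ?case by (simp add: B_def \<mu>_empty blinfun.zero_left has_bochner_integral_zero)
  next
    case (Suc k)
    have "E \<inter> B (Suc k) = (E \<inter> B k) \<union> (E \<inter> D k)" by (auto simp: BS)
    then have "\<mu> (E \<inter> B (Suc k)) = \<mu> (E \<inter> B k) + \<mu> (E \<inter> D k)"
      using BD[of k] by (simp only:) (rule \<mu>_Un, auto)
    moreover have "has_bochner_integral M (\<lambda>\<omega>. indicator (E \<inter> D k) \<omega> *\<^sub>R blinfun_apply (Zn k \<omega>) x) (blinfun_apply (\<mu> (E \<inter> D k)) x)"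
      using Zn_int[of "E \<inter> D k" k x] by (simp add: Int_assoc)
    from has_bochner_integral_add[OF Suc this]
    have "has_bochner_integral M (\<lambda>\<omega>. indicator E \<omega> *\<^sub>R blinfun_apply (indicat_real (B (Suc k)) \<omega> *\<^sub>R Z \<omega>) x)
        (blinfun_apply (\<mu> (E \<inter> B k)) x + blinfun_apply (\<mu> (E \<inter> D k)) x)"
    proof (rule has_bochner_integral_cong[THEN iffD1, rotated -1])
      fix \<omega>
      show "indicat_real E \<omega> *\<^sub>R blinfun_apply (indicat_real (B k) \<omega> *\<^sub>R Z \<omega>) x + indicat_real (E \<inter> D k) \<omega> *\<^sub>R blinfun_apply (Zn k \<omega>) x
        = indicat_real E \<omega> *\<^sub>R blinfun_apply (indicat_real (B (Suc k)) \<omega> *\<^sub>R Z \<omega>) x"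
        using BD[of k] Z_D[of \<omega> k] by (cases "\<omega> \<in> E"; cases "\<omega> \<in> B k"; cases "\<omega> \<in> D k") (auto simp: BS blinfun.zero_left)
    qed auto
    ultimately show ?case by (simp add: blinfun.add_left)
  qed
  \<comment> \<open>A qualitative bound only, growing with \<open>k\<close>; it is the hypothesis
    under which \<open>norm_integral_le_variation\<close> gives the uniform bound
    \<open>C\<close>.\<close>
  have fin_B: "(\<integral>\<^sup>+\<omega>. ennreal (norm (indicat_real (B k) \<omega> *\<^sub>R Z \<omega>)) \<partial>M) < \<infinity>" for k
  proof (induction k)
    case 0 show ?case by (simp add: B_def)
  next
    case (Suc k)
    have "(\<integral>\<^sup>+\<omega>. ennreal (norm (indicat_real (B (Suc k)) \<omega> *\<^sub>R Z \<omega>)) \<partial>M) \<le>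
      (\<integral>\<^sup>+\<omega>. ennreal (norm (indicat_real (B k) \<omega> *\<^sub>R Z \<omega>)) + ennreal (norm (Zn k \<omega>)) \<partial>M)"
    proof (rule nn_integral_mono)
      fix \<omega>
      show "ennreal (norm (indicat_real (B (Suc k)) \<omega> *\<^sub>R Z \<omega>)) \<le> ennreal (norm (indicat_real (B k) \<omega> *\<^sub>R Z \<omega>)) + ennreal (norm (Zn k \<omega>))"
        using Z_D[of \<omega> k] by (cases "\<omega> \<in> B k"; cases "\<omega> \<in> D k") (auto simp: BS)
    qed
    also have "\<dots> = (\<integral>\<^sup>+\<omega>. ennreal (norm (indicat_real (B k) \<omega> *\<^sub>R Z \<omega>)) \<partial>M) + (\<integral>\<^sup>+\<omega>. ennreal (norm (Zn k \<omega>)) \<partial>M)"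
      by (rule nn_integral_add) auto
    also have "\<dots> < \<infinity>" using Suc nn_integral_norm_LST[OF Zn] by simp
    finally show ?case .
  qed
  have sm_B: "strongly_measurable M DS (\<lambda>\<omega>. indicat_real (B k) \<omega> *\<^sub>R Z \<omega>)" for k
    by (rule strongly_measurable_compose2[OF borel_imp_strongly_measurable[of "indicat_real (B k)" M] Zm, of scaleR])
      (auto intro: tendsto_scaleR DS_scaleR)
  have le_B: "(\<integral>\<^sup>+\<omega>. ennreal (norm (indicat_real (B k) \<omega> *\<^sub>R Z \<omega>)) \<partial>M) \<le> ennreal C" for k
  proof -
    have int: "integrable M (\<lambda>\<omega>. norm (indicat_real (B k) \<omega> *\<^sub>R Z \<omega>))"
      using fin_B[of k] by (intro integrableI_nonneg) auto
    have "(\<integral>\<omega>. norm (indicat_real (B k) \<omega> *\<^sub>R Z \<omega>) \<partial>M) \<le> C"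
    proof (rule norm_integral_le_variation[OF sm_B fin_B, where \<nu> = "\<lambda>E. \<mu> (E \<inter> B k)"])
      show "(\<integral>\<omega>. indicator E \<omega> *\<^sub>R blinfun_apply (indicat_real (B k) \<omega> *\<^sub>R Z \<omega>) x \<partial>M) = blinfun_apply (\<mu> (E \<inter> B k)) x"
        if "E \<in> sets M" for E x by (rule has_bochner_integral_integral_eq[OF HB[OF that]])
      fix \<pi> assume \<pi>: "finite \<pi>" "\<pi> \<subseteq> sets M" "disjoint \<pi>"
      \<comment> \<open>Several members of the family may share the empty trace on
        \<open>B k\<close>. These contribute 0 and are dropped, which makes taking traces
        injective.\<close>
      have "(\<Sum>E\<in>\<pi>. norm (\<mu> (E \<inter> B k))) = (\<Sum>E\<in>{E \<in> \<pi>. E \<inter> B k \<noteq> {}}. norm (\<mu> (E \<inter> B k)))"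
        using \<pi>(1) by (intro sum.mono_neutral_right) (auto simp: \<mu>_empty)
      also have "\<dots> = (\<Sum>E\<in>(\<lambda>E. E \<inter> B k) ` {E \<in> \<pi>. E \<inter> B k \<noteq> {}}. norm (\<mu> E))"
      proof (rule sum.reindex_cong[symmetric, OF _ refl refl])
        show "inj_on (\<lambda>E. E \<inter> B k) {E \<in> \<pi>. E \<inter> B k \<noteq> {}}"
        proof (rule inj_onI, rule ccontr)
          fix E F assume "E \<in> {E \<in> \<pi>. E \<inter> B k \<noteq> {}}" "F \<in> {E \<in> \<pi>. E \<inter> B k \<noteq> {}}" "E \<inter> B k = F \<inter> B k" "E \<noteq> F"
          moreover from this have "E \<inter> F = {}" using \<pi>(3) unfolding disjoint_def by blast
          ultimately show False by blast
        qed
      qed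
      also have "\<dots> \<le> C"
      proof (rule disjoint_variation_le[OF \<mu> C])
        show "disjoint ((\<lambda>E. E \<inter> B k) ` {E \<in> \<pi>. E \<inter> B k \<noteq> {}})"
          using \<pi>(3) unfolding disjoint_def by blast
      qed (use \<pi> in auto)
      finally show "(\<Sum>E\<in>\<pi>. norm (\<mu> (E \<inter> B k))) \<le> C" .
    qed
    then show ?thesis by (subst nn_integral_eq_integral[OF int]) (auto intro: ennreal_leI)
  qed
  have B_lim: "(\<lambda>k. indicat_real (B k) \<omega> *\<^sub>R v) \<longlonglongrightarrow> v" if supp: "v \<noteq> 0 \<Longrightarrow> \<omega> \<in> (\<Union>n. D n)" for \<omega> and v :: "'z::real_normed_vector"
  proof (cases "v = 0")
    case False
    then obtain n where n: "\<omega> \<in> D n" using supp by auto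
    have "\<forall>\<^sub>F k in sequentially. indicat_real (B k) \<omega> *\<^sub>R v = v"
      using eventually_gt_at_top[of n] by eventually_elim (use n B_eq in \<open>auto simp: indicator_def\<close>)
    then show ?thesis by (rule tendsto_eventually)
  qed simp
  have Z_supp: "\<omega> \<in> (\<Union>n. D n)" if "Z \<omega> \<noteq> 0" for \<omega> using that by (auto simp: Z_def split: if_splits)
  have Zfin: "(\<integral>\<^sup>+\<omega>. ennreal (norm (Z \<omega>)) \<partial>M) < \<infinity>"
  proof -
    have "(\<lambda>k. \<integral>\<^sup>+\<omega>. ennreal (norm (indicat_real (B k) \<omega> *\<^sub>R Z \<omega>)) \<partial>M) \<longlonglongrightarrow> (\<integral>\<^sup>+\<omega>. ennreal (norm (Z \<omega>)) \<partial>M)"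
    proof (rule nn_integral_LIMSEQ)
      show "incseq (\<lambda>k \<omega>. ennreal (norm (indicat_real (B k) \<omega> *\<^sub>R Z \<omega>)))"
        by (intro incseq_SucI le_funI ennreal_leI) (auto simp: BS indicator_def)
      show "(\<lambda>k. ennreal (norm (indicat_real (B k) \<omega> *\<^sub>R Z \<omega>))) \<longlonglongrightarrow> ennreal (norm (Z \<omega>))" for \<omega>
        by (intro tendsto_ennrealI tendsto_norm B_lim Z_supp)
    qed auto
    then have "(\<integral>\<^sup>+\<omega>. ennreal (norm (Z \<omega>)) \<partial>M) \<le> ennreal C" by (rule LIMSEQ_le_const2) (use le_B in auto)
    then show ?thesis by (auto intro: order.strict_trans1)
  qed
  have intZ: "integrable M (\<lambda>\<omega>. norm (Z \<omega>))" using Zfin by (intro integrableI_nonneg) auto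
  have \<mu>_lim: "(\<lambda>k. \<mu> (E \<inter> B k)) \<longlonglongrightarrow> \<mu> E" if E [measurable]: "E \<in> sets M" for E
  proof (rule LIMSEQ_I)
    fix e :: real assume "0 < e"
    then obtain d where d: "0 < d" "\<And>E. E \<in> sets M \<Longrightarrow> measure M E < d \<Longrightarrow> norm (\<mu> E) < e" using ac unfolding continuous_wrt_def by blast
    obtain N where N: "C / d < real N" using reals_Archimedean2 by blast
    \<comment> \<open>\<open>B k\<close> is a union over indices below \<open>k\<close>, so it
      contains \<open>A N\<close> only from \<open>k = Suc N\<close> on; the complement of
      \<open>A N\<close> has probability below \<open>d\<close> by the choice of
      \<open>N\<close>.\<close>
    have "norm (\<mu> (E \<inter> B k) - \<mu> E) < e" if k: "Suc N \<le> k" for k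
    proof -
      have "measure M (E - B k) \<le> measure M (space M - A N)"
        using k sets.sets_into_space[OF E] by (intro finite_measure_mono) (auto simp: B_def)
      also have "\<dots> \<le> C / real (Suc N)" by (rule A_small)
      also have "\<dots> < d" using N d(1) by (simp add: field_simps)
      finally have "norm (\<mu> (E - B k)) < e" by (intro d(2)) auto
      moreover have "\<mu> ((E \<inter> B k) \<union> (E - B k)) = \<mu> (E \<inter> B k) + \<mu> (E - B k)" by (rule \<mu>_Un) auto
      moreover have "(E \<inter> B k) \<union> (E - B k) = E" by auto
      ultimately show ?thesis by simp
    qed
    then show "\<exists>no. \<forall>k\<ge>no. norm (\<mu> (E \<inter> B k) - \<mu> E) < e" by blast
  qed
  have Z_int: "has_bochner_integral_into M DS (\<lambda>\<omega>. indicator E \<omega> *\<^sub>R Z \<omega>) (\<mu> E)" if E [measurable]: "E \<in> sets M" for E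
  proof -
    have sm: "strongly_measurable M DS (\<lambda>\<omega>. indicat_real E \<omega> *\<^sub>R Z \<omega>)"
      by (rule strongly_measurable_compose2[OF borel_imp_strongly_measurable[of "indicat_real E" M] Zm, of scaleR])
        (auto intro: tendsto_scaleR DS_scaleR)
    have "(\<integral>\<^sup>+\<omega>. ennreal (norm (indicat_real E \<omega> *\<^sub>R Z \<omega>)) \<partial>M) \<le> (\<integral>\<^sup>+\<omega>. ennreal (norm (Z \<omega>)) \<partial>M)"
      by (intro nn_integral_mono ennreal_leI) (auto simp: indicator_def)
    then have "(\<integral>\<^sup>+\<omega>. ennreal (norm (indicat_real E \<omega> *\<^sub>R Z \<omega>)) \<partial>M) < \<infinity>" using Zfin by (rule order.strict_trans1)
    from bochner_integral_exists[OF sm this DS_0 DS_add DS_scaleR DS_closed]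
    obtain y where y: "has_bochner_integral_into M DS (\<lambda>\<omega>. indicator E \<omega> *\<^sub>R Z \<omega>) y" by blast
    \<comment> \<open>Existence of the integral is known; its value is identified on each vector by
      letting \<open>k\<close> tend to infinity in \<open>HB\<close>, with dominated convergence on
      one side and \<open>\<mu>_lim\<close> on the other.\<close>
    have "y = \<mu> E"
    proof (rule blinfun_eqI)
      fix x
      have T: "has_bochner_integral M (\<lambda>\<omega>. blinfun_apply (indicat_real E \<omega> *\<^sub>R Z \<omega>) x) (blinfun_apply y x)"
        by (rule has_bochner_integral_into_linear[OF y blinfun.bounded_linear_left])
      have [measurable]: "(\<lambda>\<omega>. blinfun_apply (Z \<omega>) x) \<in> borel_measurable M"
        using pairing_measurable[OF Zm LS_meas[OF LS_simple[OF simple_function_const[of _ x]]]] .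
      have "(\<lambda>k. \<integral>\<omega>. indicat_real E \<omega> *\<^sub>R blinfun_apply (indicat_real (B k) \<omega> *\<^sub>R Z \<omega>) x \<partial>M) \<longlonglongrightarrow>
        (\<integral>\<omega>. blinfun_apply (indicat_real E \<omega> *\<^sub>R Z \<omega>) x \<partial>M)"
      proof (rule integral_dominated_convergence[OF _ _ integrable_mult_left[OF intZ, of "norm x"]])
        show "AE \<omega> in M. (\<lambda>k. indicat_real E \<omega> *\<^sub>R blinfun_apply (indicat_real (B k) \<omega> *\<^sub>R Z \<omega>) x) \<longlonglongrightarrow> blinfun_apply (indicat_real E \<omega> *\<^sub>R Z \<omega>) x"
          unfolding blinfun.scaleR_left
          by (intro AE_I2 tendsto_scaleR tendsto_const B_lim Z_supp) (auto simp: blinfun.zero_left)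
        show "AE \<omega> in M. norm (indicat_real E \<omega> *\<^sub>R blinfun_apply (indicat_real (B k) \<omega> *\<^sub>R Z \<omega>) x) \<le> norm (Z \<omega>) * norm x" for k
          using norm_blinfun by (intro AE_I2) (auto simp: indicator_def blinfun.zero_left)
      qed (auto simp: blinfun.scaleR_left)
      then have "(\<lambda>k. blinfun_apply (\<mu> (E \<inter> B k)) x) \<longlonglongrightarrow> blinfun_apply y x"
        unfolding has_bochner_integral_integral_eq[OF HB[OF E]] has_bochner_integral_integral_eq[OF T] .
      moreover have "(\<lambda>k. blinfun_apply (\<mu> (E \<inter> B k)) x) \<longlonglongrightarrow> blinfun_apply (\<mu> E) x"
        by (intro tendsto_intros \<mu>_lim E)
      ultimately show "blinfun_apply y x = blinfun_apply (\<mu> E) x" by (rule LIMSEQ_unique)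
    qed
    then show ?thesis using y by simp
  qed
  show "\<exists>Z. bochner_integrable_into M DS Z \<and> (\<forall>E\<in>sets M. has_bochner_integral_into M DS (\<lambda>\<omega>. indicator E \<omega> *\<^sub>R Z \<omega>) (\<mu> E))"
  proof (intro exI[of _ Z] conjI ballI Z_int)
    show "bochner_integrable_into M DS Z"
      using bochner_integral_exists[OF Zm Zfin DS_0 DS_add DS_scaleR DS_closed] unfolding bochner_integrable_into_def by blast
  qed
qed

end

theorem theorem45:
  fixes M :: "'w measure"
    and sc :: "'k::{real_normed_field, euclidean_space} \<Rightarrow> 'x::banach \<Rightarrow> 'x"
    and \<sigma> :: "real \<Rightarrow> real"
    and p :: real
    and q :: ennreal
  assumes "prob_space M"
    and "uniform_rvs M \<noteq> {}"
    and "banach_over sc"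
    and "distortion \<sigma>"
    and "1 \<le> p"
    and "inverse (ennreal p) + inverse q = 1"
  shows "linear_isometry (L_star M \<sigma> q sc) (continuous_dual (L_sigma M \<sigma> p sc)) (iota M \<sigma> p sc) \<and>
    (normed_isomorphism (L_star M \<sigma> q sc) (continuous_dual (L_sigma M \<sigma> p sc)) (iota M \<sigma> p sc)
      \<longleftrightarrow> radon_nikodym_property M (dual_space sc))"
proof -
  interpret lp_dual M \<sigma> sc p q
    using assms by (simp add: lp_dual_def lp_dual_axioms_def distorted_prob_def distorted_prob_axioms_def)
  show ?thesis
    using iota_linear_isometry iota_isomorphism_iff representation_from_RNP RNP_from_representation by blast
qed

end
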